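(* Let $F$ be a hypothesis class of functions $\mu(x,z)$ with values in $[0,b]$, let $\mathfrak{T}$ be the parameter space of quantile levels, and let $\{(x_i,z_i)\}_{i=1}^N$ be i.i.d. training inputs (with outcomes $y_i$). Let $(\hat\tau,\hat\mu_{\hat\tau})\in(\mathfrak{T},F)$ be the solution of the bi-level quantile regression problem described in the context. Let the loss function $l_\tau$ be upper bounded by $b$. Then, for any $\delta>0$, with probability at least $1-\delta$, $$\mathbb{E}_{x,z}\big[l_{\hat\tau}(\mu_{\hat\tau}(x,z)-\hat\mu_{\hat\tau}(x,z))\big]\le \frac1N\sum_{i=1}^N l_{\hat\tau}(\mu_{\hat\tau}(x_i,z_i)-\hat\mu_{\hat\tau}(x_i,z_i)) + 4\mathfrak{R}(F)+\frac{4b}{\sqrt N}+b\sqrt{\frac{\log(1/\delta)}{2N}}.$$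
   Context: $X,Y,Z$ are random variables; $\{(x_i,y_i,z_i)\}_{i=1}^N$ are the $N$ training samples, i.i.d. realizations of $(X,Y,Z)$; $\mathbb{E}_{x,z}$ is expectation over a fresh $(x,z)$ with the same distribution as the training inputs. Pin-ball loss: $l_\tau(\xi)=\tau\xi$ if $\xi\ge 0$ and $l_\tau(\xi)=(\tau-1)\xi$ if $\xi<0$, for a quantile level $\tau$. True conditional quantile function: $\mu_\tau(x,z)$ is the minimum $\mu$ such that $P(Y\le\mu\mid X=x,Z=z)=\tau$. Bi-level problem: for a sample of interest $(x^0,y^0,z^0)$ and a regression loss $L$ (e.g. $L_1$ or $L_2$), $\hat\tau=\arg\min_{\tau\in\mathfrak{T}} L(\hat\mu_\tau(x^0,z^0),y^0)$, where for each $\tau$, $\hat\mu_{\tau}=\arg\min_{\mu\in F} R_\tau[\mu]$ with $R_\tau[\mu]=\frac1N\sum_{i=1}^N l_\tau(y_i-\mu(x_i,z_i))$. Rademacher complexity: $\mathfrak{R}(F)=\mathbb{E}_{x,z,\sigma}\left[\sup_{\mu\in F}\frac1N\sum_{i=1}^N\sigma_i\mu(x_i,z_i)\right]$, where $\sigma_1,\dots,\sigma_N$ are independent and uniform on $\{-1,+1\}$. "The loss $l_\tau$ is upper bounded by $b$" means that the loss values $l_\tau(\cdot)$ occurring (for $\tau\in\mathfrak{T}$, $\mu\in F$) are at most $b$. *)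

theory Defs
  imports "HOL-Probability.Probability"
begin

definition pinball_loss :: "real \<Rightarrow> real \<Rightarrow> real" where
  "pinball_loss \<tau> \<xi> = (if \<xi> \<ge> 0 then \<tau> * \<xi> else (\<tau> - 1) * \<xi>)"

definition empirical_quantile_risk ::
  "nat \<Rightarrow> (nat \<Rightarrow> 'x) \<Rightarrow> (nat \<Rightarrow> real) \<Rightarrow> (nat \<Rightarrow> 'z) \<Rightarrow> real \<Rightarrow> ('x \<times> 'z \<Rightarrow> real) \<Rightarrow> real" where
  "empirical_quantile_risk N x y z \<tau> \<mu> =
     (1 / real N) * (\<Sum>i<N. pinball_loss \<tau> (y i - \<mu> (x i, z i)))"

(* (\<tau>\<^sub>h, \<mu>\<^sub>h) solves the bi-level problem for the training data (x, y, z) and the sample of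
   interest (x\<^sub>0, y\<^sub>0, z\<^sub>0).  The lower level is solved for every \<tau> \<in> T; the library
   predicate is_arg_min leaves open which minimizer is taken if there are several. *)
definition bilevel_solution ::
  "(real \<Rightarrow> real \<Rightarrow> real) \<Rightarrow> real set \<Rightarrow> ('x \<times> 'z \<Rightarrow> real) set \<Rightarrow>
   nat \<Rightarrow> (nat \<Rightarrow> 'x) \<Rightarrow> (nat \<Rightarrow> real) \<Rightarrow> (nat \<Rightarrow> 'z) \<Rightarrow> 'x \<times> real \<times> 'z \<Rightarrow>
   real \<Rightarrow> (real \<Rightarrow> 'x \<times> 'z \<Rightarrow> real) \<Rightarrow> bool" where
  "bilevel_solution L T F N x y z s\<^sub>0 \<tau>\<^sub>h \<mu>\<^sub>h \<longleftrightarrow>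
     (case s\<^sub>0 of (x\<^sub>0, y\<^sub>0, z\<^sub>0) \<Rightarrow>
        (\<forall>\<tau>\<in>T. is_arg_min (empirical_quantile_risk N x y z \<tau>) (\<lambda>\<mu>. \<mu> \<in> F) (\<mu>\<^sub>h \<tau>)) \<and>
        is_arg_min (\<lambda>\<tau>. L (\<mu>\<^sub>h \<tau> (x\<^sub>0, z\<^sub>0)) y\<^sub>0) (\<lambda>\<tau>. \<tau> \<in> T) \<tau>\<^sub>h)"

(* K is a regular conditional distribution of Y given the S-valued random element V,
   i.e. K v B is a version of P(Y \<in> B | V = v). *)
definition regular_cond_distr ::
  "'w measure \<Rightarrow> 'v measure \<Rightarrow> ('w \<Rightarrow> 'v) \<Rightarrow> ('w \<Rightarrow> real) \<Rightarrow> ('v \<Rightarrow> real measure) \<Rightarrow> bool" where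
  "regular_cond_distr M S V Y K \<longleftrightarrow>
     K \<in> measurable S (prob_algebra borel) \<and>
     (\<forall>A\<in>sets S. \<forall>B\<in>sets borel.
        measure M {\<omega> \<in> space M. V \<omega> \<in> A \<and> Y \<omega> \<in> B} =
        (\<integral>v. indicator A v * measure (K v) B \<partial>distr M S V))"

definition is_cond_quantile :: "('v \<Rightarrow> real measure) \<Rightarrow> real \<Rightarrow> 'v \<Rightarrow> real \<Rightarrow> bool" where
  "is_cond_quantile K \<tau> v m \<longleftrightarrow>
     measure (K v) {..m} = \<tau> \<and> (\<forall>m'. measure (K v) {..m'} = \<tau> \<longrightarrow> m \<le> m')"

(* Meaningful only if the minimum exists, see is_cond_quantile. *)
definition cond_quantile :: "('v \<Rightarrow> real measure) \<Rightarrow> real \<Rightarrow> 'v \<Rightarrow> real" where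
  "cond_quantile K \<tau> v = (LEAST m. measure (K v) {..m} = \<tau>)"

(* N i.i.d. points with law D, together with N independent uniform signs. *)
definition rademacher_space :: "nat \<Rightarrow> 'v measure \<Rightarrow> ((nat \<Rightarrow> 'v) \<times> (nat \<Rightarrow> real)) measure" where
  "rademacher_space N D =
     PiM {..<N} (\<lambda>_. D) \<Otimes>\<^sub>M PiM {..<N} (\<lambda>_. uniform_count_measure {-1, 1})"

definition rademacher_sup ::
  "nat \<Rightarrow> ('v \<Rightarrow> real) set \<Rightarrow> (nat \<Rightarrow> 'v) \<times> (nat \<Rightarrow> real) \<Rightarrow> real" where
  "rademacher_sup N F = (\<lambda>(v, \<sigma>). SUP \<mu>\<in>F. (1 / real N) * (\<Sum>i<N. \<sigma> i * \<mu> (v i)))"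

(* The Bochner integral is 0 by convention for non-integrable functions, so this is the
   Rademacher complexity only if rademacher_sup N F is integrable. *)
definition rademacher_complexity :: "nat \<Rightarrow> 'v measure \<Rightarrow> ('v \<Rightarrow> real) set \<Rightarrow> real" where
  "rademacher_complexity N D F = (\<integral>p. rademacher_sup N F p \<partial>rademacher_space N D)"

lemma cond_quantile_eq: "is_cond_quantile K \<tau> v m \<Longrightarrow> cond_quantile K \<tau> v = m"
  unfolding is_cond_quantile_def cond_quantile_def by (intro Least_equality) auto

end

theory Submission
  imports Defs
begin

text \<open>
The loss \<open>l\<^sub>\<tau> (q\<^sub>\<tau> - \<mu>)\<close> is split as
\<open>\<bar>\<mu> - c\<^sub>\<tau>\<bar> / 2 + (\<tau> - 1/2) * (c\<^sub>\<tau> - \<mu>) + p\<^sub>\<tau> + n\<^sub>\<tau>\<close>, where \<open>c\<^sub>\<tau>\<close> is the truncation of the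
conditional quantile \<open>q\<^sub>\<tau>\<close> to \<open>[0, b]\<close>, and
\<open>p\<^sub>\<tau> = \<tau> * max 0 (q\<^sub>\<tau> - b)\<close>, \<open>n\<^sub>\<tau> = (1 - \<tau>) * max 0 (- q\<^sub>\<tau>)\<close>. The families \<open>c\<close>, \<open>p\<close>, \<open>n\<close>
are chains (monotone in \<open>\<tau>\<close>) with values in \<open>[0, b]\<close>, so their superlevel sets are chains of sets:
their uniform deviations are maxima of simple random walks, whatever the size of \<open>T\<close>.
The expected maximum of a balanced walk of length \<open>2 * N\<close> is at most \<open>11/12 * sqrt N\<close>.
Contraction bounds the absolute value by \<open>R(F) + b / sqrt N\<close>, and the terms in \<open>\<mu>\<close> cost
\<open>2 * R(F) + b / (4 * sqrt N)\<close>; since \<open>1 + 1/4 + 3 * 11/12 = 4\<close>, the expected uniform deviation is at most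
\<open>4 * R(F) + 4 * b / sqrt N\<close>, and McDiarmid's inequality adds the last term.

Since \<open>F\<close> may be uncountable, the suprema of the losses need not be measurable, although those of the signed sums are.
Outer integrals are therefore bounded through measurable majorants: symmetrization with contraction
transforms a majorant of the signed sums into one of the deviations, and a majorant of minimal integral
satisfies the bounded-difference condition of McDiarmid's inequality almost everywhere.
\<close>

section \<open>Maxima of walks and chains\<close>

text \<open>The level chosen by the bi-level problem depends on the data, so the deviation must be
  controlled uniformly over \<open>T \<times> F\<close>. R(F) accounts for the hypotheses only; the
  quantile functions need a bound of their own that does not grow with \<open>T\<close>.
  Monotonicity in the level supplies it: as for empirical distribution functions, a chain of sets is
  governed by one walk. Quantile functions may be unbounded, hence the truncation; the weights
  \<tau> and 1 - \<tau> let the loss bound control what is cut off. The absolute value is singled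
  out because contraction works with one 1-Lipschitz function for the whole family; the level then
  survives only as a scalar weight of modulus at most 1/2, and the factor 1/2 of the absolute value
  cancels the factor 2 of symmetrization. The constant 11/12 is what the sum to 4 leaves for each of
  three chain terms: \<open>p\<close>, \<open>n\<close>, and the two-sided deviation of
  \<open>c\<close> with weight 1/2. It is within reach because the mean maximum of a balanced walk
  of length 2 N is asymptotically sqrt(pi) / 2, about 0.886, times \<open>sqrt N\<close>.\<close>

fun walk_max :: "int list \<Rightarrow> int" where
  "walk_max [] = 0"
| "walk_max (x # xs) = max 0 (x + walk_max xs)"

text \<open>Sign vectors are encoded by their set of positive positions: \<open>Pow\<close> is then
  the cube of signs, and the cardinality of a pattern fixes the endpoint of its walk.\<close>

definition sgn_of :: "'a set \<Rightarrow> 'a \<Rightarrow> int" where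
  "sgn_of I i = (if i \<in> I then 1 else -1)"

lemma walk_max_nonneg: "0 \<le> walk_max xs"
  by (induction xs) auto

lemma sum_list_take_le_walk_max: "sum_list (take k xs) \<le> walk_max xs"
proof (induction xs arbitrary: k)
  case (Cons x xs)
  show ?case
  proof (cases k)
    case (Suc m)
    then show ?thesis using Cons[of m] by simp
  qed simp
qed simp

lemma walk_max_le_length: "(\<And>x. x \<in> set xs \<Longrightarrow> x \<le> 1) \<Longrightarrow> walk_max xs \<le> int (length xs)"
proof (induction xs)
  case (Cons x xs)
  then have "x \<le> 1" "walk_max xs \<le> int (length xs)" by simp_all
  then show ?case by simp
qed simp

lemma map_sgn_of_insert: "x \<notin> set xs \<Longrightarrow> map (sgn_of (insert x I)) xs = map (sgn_of I) xs"
  by (auto simp: sgn_of_def)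

lemma sum_Pow_insert:
  fixes f :: "'a set \<Rightarrow> 'b :: comm_monoid_add"
  assumes "finite A" "x \<notin> A"
  shows "(\<Sum>I\<in>Pow (insert x A). f I) = (\<Sum>I\<in>Pow A. f I + f (insert x I))"
proof -
  have "inj_on (insert x) (Pow A)"
    using assms(2) by (auto simp: inj_on_def)
  moreover have "Pow A \<inter> insert x ` Pow A = {}"
    using assms(2) by auto
  ultimately show ?thesis
    using assms(1) by (simp add: Pow_insert sum.union_disjoint sum.reindex sum.distrib)
qed

text \<open>A step prepended to a walk with maximum m gives max 0 (m + 1) or max 0 (m - 1). The
  squares are at most (m + 1)^2 and (m - 1)^2, with average m^2 + 1, so the mean square grows by at
  most one per step.\<close>

lemma sum_walk_max_square_le:
  "distinct xs \<Longrightarrow> (\<Sum>I\<in>Pow (set xs). (walk_max (map (sgn_of I) xs))\<^sup>2) \<le> int (length xs) * 2 ^ length xs"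
proof (induction xs)
  case (Cons x xs)
  let ?m = "\<lambda>I. walk_max (map (sgn_of I) xs)"
  have sq: "(max 0 (a + m))\<^sup>2 \<le> (a + m)\<^sup>2" for a m :: int
    by (auto simp: max_def)
  have "(\<Sum>I\<in>Pow (set (x # xs)). (walk_max (map (sgn_of I) (x # xs)))\<^sup>2)
      = (\<Sum>I\<in>Pow (set xs). (max 0 (- 1 + ?m I))\<^sup>2 + (max 0 (1 + ?m I))\<^sup>2)"
    unfolding list.set(2) using Cons.prems
    by (subst sum_Pow_insert) (auto intro!: sum.cong simp: map_sgn_of_insert,
       (auto simp: sgn_of_def)[1])
  also have "\<dots> \<le> (\<Sum>I\<in>Pow (set xs). (- 1 + ?m I)\<^sup>2 + (1 + ?m I)\<^sup>2)"
    by (intro sum_mono add_mono sq)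
  also have "\<dots> = (\<Sum>I\<in>Pow (set xs). 2 + 2 * (?m I)\<^sup>2)"
    by (intro sum.cong) (auto simp: power2_eq_square algebra_simps)
  also have "\<dots> = 2 * 2 ^ length xs + 2 * (\<Sum>I\<in>Pow (set xs). (?m I)\<^sup>2)"
    using Cons.prems by (simp add: sum.distrib sum_distrib_left card_Pow distinct_card)
  also have "\<dots> \<le> int (length (x # xs)) * 2 ^ length (x # xs)"
    using Cons by (simp add: algebra_simps)
  finally show ?case .
qed simp

text \<open>Cauchy-Schwarz applied to the second moment. This is the estimate for independent signs;
  balanced patterns get a sharper one below.\<close>

lemma sum_walk_max_le:
  assumes "distinct xs"
  shows "(\<Sum>I\<in>Pow (set xs). real_of_int (walk_max (map (sgn_of I) xs))) \<le> 2 ^ length xs * sqrt (length xs)"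
proof -
  let ?m = "\<lambda>I. real_of_int (walk_max (map (sgn_of I) xs))"
  have c: "real (card (Pow (set xs))) = 2 ^ length xs"
    using assms by (simp add: card_Pow distinct_card)
  have "(\<Sum>I\<in>Pow (set xs). ?m I)\<^sup>2 \<le> real (card (Pow (set xs))) * (\<Sum>I\<in>Pow (set xs). (?m I)\<^sup>2)"
    using sum_squared_le_sum_of_squares[of ?m "Pow (set xs)"] by (simp add: mult.commute)
  also have "(\<Sum>I\<in>Pow (set xs). (?m I)\<^sup>2) = real_of_int (\<Sum>I\<in>Pow (set xs). (walk_max (map (sgn_of I) xs))\<^sup>2)"
    by simp
  also have "\<dots> \<le> real_of_int (int (length xs) * 2 ^ length xs)"
    by (subst of_int_le_iff) (rule sum_walk_max_square_le[OF assms])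
  finally have "(\<Sum>I\<in>Pow (set xs). ?m I)\<^sup>2 \<le> (2 ^ length xs * sqrt (length xs))\<^sup>2"
    unfolding c power_mult_distrib by (simp add: power2_eq_square mult_ac)
  then show ?thesis
    by (rule power2_le_imp_le) simp
qed

text \<open>Reflection principle: the hypothesis \<open>2 * p \<le> length xs + k\<close> places the
  endpoint of the walk below the level \<open>k\<close>.\<close>

lemma card_walk_max_ge_le:
  assumes "distinct xs" "2 * p \<le> length xs + k"
  shows "card {I \<in> Pow (set xs :: 'b set). card I = p \<and> int k \<le> walk_max (map (sgn_of I) xs)}
         \<le> (if k \<le> p then length xs choose (p - k) else 0)"
  using assms
proof (induction xs arbitrary: p k)
  case Nil
  have "card {I \<in> Pow (set ([] :: 'b list)). card I = p \<and> int k \<le> walk_max (map (sgn_of I) ([] :: 'b list))} \<le> card {{} :: 'b set}"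
    by (rule card_mono) auto
  then show ?case using Nil by (auto simp: card_eq_0_iff)
next
  case (Cons x xs)
  let ?S = "\<lambda>xs p k. {I \<in> Pow (set xs). card I = p \<and> int k \<le> walk_max (map (sgn_of I) xs)}"
  show ?case
  proof (cases k)
    case 0
    have "card (?S (x # xs) p k) \<le> card {I. I \<subseteq> set (x # xs) \<and> card I = p}"
      by (intro card_mono) auto
    also have "\<dots> = length (x # xs) choose p"
      using Cons.prems(1) by (subst n_subsets) (simp_all add: distinct_card)
    finally show ?thesis using 0 by simp
  next
    case (Suc k')
    have x: "x \<notin> set xs" and d: "distinct xs"
      using Cons.prems by auto
    have fin: "finite I" if "I \<subseteq> set xs" for I
      using that by (rule finite_subset) simp
    have wx: "walk_max (map (sgn_of I) (x # xs)) = max 0 ((if x \<in> I then 1 else - 1) + walk_max (map (sgn_of (I - {x})) xs))" for I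
    proof -
      have "map (sgn_of I) xs = map (sgn_of (I - {x})) xs"
        using x by (auto simp: sgn_of_def)
      then show ?thesis by (simp only: list.map walk_max.simps sgn_of_def[of I x])
    qed
    \<comment> \<open>After a step down, the rest must reach \<open>k + 1\<close> with all
      \<open>p\<close> up-steps; after a step up, it must reach \<open>k - 1\<close> with
      \<open>p - 1\<close> of them. Both cases inherit the endpoint condition.\<close>
    have "?S (x # xs) p k \<subseteq> ?S xs p (Suc k) \<union> (if p = 0 then {} else insert x ` ?S xs (p - 1) k')"
    proof
      fix I assume I: "I \<in> ?S (x # xs) p k"
      show "I \<in> ?S xs p (Suc k) \<union> (if p = 0 then {} else insert x ` ?S xs (p - 1) k')"
      proof (cases "x \<in> I")
        case True
        then have "I = insert x (I - {x})" "card I = Suc (card (I - {x}))" "I - {x} \<subseteq> set xs"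
          using I finite_subset[of I "set (x # xs)"] card_Suc_Diff1[of I x] by auto
        then show ?thesis
          using I wx[of I] True Suc by (auto intro!: image_eqI[of _ _ "I - {x}"])
      next
        case False
        then have "I \<subseteq> set xs" "I - {x} = I" using I by auto
        then show ?thesis using I wx[of I] False Suc by auto
      qed
    qed
    then have "card (?S (x # xs) p k) \<le> card (?S xs p (Suc k) \<union> (if p = 0 then {} else insert x ` ?S xs (p - 1) k'))"
      by (intro card_mono) auto
    also have "\<dots> \<le> card (?S xs p (Suc k)) + (if p = 0 then 0 else card (?S xs (p - 1) k'))"
      by (auto intro!: order.trans[OF card_Un_le] card_image_le add_left_mono)
    also have "\<dots> \<le> (if Suc k \<le> p then length xs choose (p - Suc k) else 0)
        + (if p = 0 then 0 else if k' \<le> p - 1 then length xs choose (p - 1 - k') else 0)"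
    proof (rule add_mono)
      show "card (?S xs p (Suc k)) \<le> (if Suc k \<le> p then length xs choose (p - Suc k) else 0)"
        using Cons.prems d by (intro Cons.IH) auto
      show "(if p = 0 then 0 else card (?S xs (p - 1) k')) \<le>
          (if p = 0 then 0 else if k' \<le> p - 1 then length xs choose (p - 1 - k') else 0)"
        using Cons.prems d Suc Cons.IH[of "p - 1" k'] by auto
    qed
    \<comment> \<open>Pascal's rule. The guards matter: for \<open>p < k\<close> the truncated
      difference would be 0 and the binomial coefficient 1 instead of 0.\<close>
    also have "\<dots> \<le> (if k \<le> p then length (x # xs) choose (p - k) else 0)"
    proof (cases "Suc k \<le> p")
      case True
      then obtain r where "p = k + Suc r" by (metis add_Suc_right less_eq_Suc_le less_natE)
      then show ?thesis using Suc by simp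
    qed (use Suc in \<open>auto simp: le_Suc_eq\<close>)
    finally show ?thesis .
  qed
qed

section \<open>Binomial estimates for balanced walks\<close>

lemma sum_binomial_below_middle: "2 * (\<Sum>j<n. (2 * n) choose j) + ((2 * n) choose n) = 4 ^ n"
proof -
  have "(\<Sum>j\<in>{n<..2*n}. (2 * n) choose j) = (\<Sum>j<n. (2 * n) choose j)"
    by (rule sum.reindex_bij_witness[of _ "\<lambda>j. 2 * n - j" "\<lambda>j. 2 * n - j"])
       (auto simp: binomial_symmetric[symmetric])
  moreover have "(\<Sum>j\<le>2*n. (2 * n) choose j) = (\<Sum>j<n. (2 * n) choose j) + ((2 * n) choose n) + (\<Sum>j\<in>{n<..2*n}. (2 * n) choose j)"
  proof -
    have "{..2*n} = insert n {..<n} \<union> {n<..2*n}" by auto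
    then show ?thesis by (simp add: sum.union_disjoint disjoint_iff)
  qed
  ultimately show ?thesis
    using choose_row_sum[of "2 * n"] by (simp add: power_mult)
qed

text \<open>As 4^n / C(2n, n) is asymptotic to sqrt(pi n), the slope under the root cannot be below
  pi, and 16/5 is a rational substitute. Both constants are forced by asking for equality at n = 1
  and for a vanishing linear term in the induction step, where only the constant 16/5 then
  remains.\<close>

lemma central_binomial_bound:
  assumes "n \<ge> 1"
  shows "4 ^ n \<le> real ((2 * n) choose n) * sqrt (16 / 5 * n + 4 / 5)"
proof -
  have "(4 ^ n)\<^sup>2 \<le> (real ((2 * n) choose n))\<^sup>2 * (16 / 5 * n + 4 / 5)"
    using assms
  proof (induction n rule: nat_induct_at_least)
    case base
    then show ?case by (simp add: numeral_2_eq_2)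
  next
    case (Suc n)
    let ?c = "real ((2 * n) choose n)" and ?d = "real ((2 * Suc n) choose Suc n)"
    have "Suc n * ((2 * Suc n) choose Suc n) = 2 * (2 * n + 1) * ((2 * n) choose n)"
    proof -
      have e: "Suc n * ((2 * Suc n) choose Suc n) = (2 * Suc n) * ((2 * n + 1) choose n)"
        using Suc_times_binomial_eq[of "2 * n + 1" n] by (simp del: binomial_Suc_Suc)
      have "(2 * n + 1) choose n = (2 * n + 1) choose Suc n"
        using binomial_symmetric[of n "2 * n + 1"] by simp
      then have f: "Suc n * ((2 * n + 1) choose n) = (2 * n + 1) * ((2 * n) choose n)"
        using Suc_times_binomial_eq[of "2 * n" n] by (simp del: binomial_Suc_Suc)
      show ?thesis unfolding e using f by (simp del: binomial_Suc_Suc add: algebra_simps)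
    qed
    then have "real (Suc n * ((2 * Suc n) choose Suc n)) = real (2 * (2 * n + 1) * ((2 * n) choose n))"
      by (rule arg_cong)
    then have d: "(real n + 1) * ?d = 2 * (2 * n + 1) * ?c"
      by (simp del: binomial_Suc_Suc add: algebra_simps)
    have "(real n + 1)\<^sup>2 * (4 ^ Suc n)\<^sup>2 = 16 * (real n + 1)\<^sup>2 * (4 ^ n)\<^sup>2"
      by (simp add: power_mult_distrib)
    also have "\<dots> \<le> 16 * (real n + 1)\<^sup>2 * (?c\<^sup>2 * (16 / 5 * n + 4 / 5))"
      by (intro mult_left_mono Suc) auto
    also have "\<dots> = ?c\<^sup>2 * (16 * ((real n + 1)\<^sup>2 * (16 / 5 * n + 4 / 5)))"
      by (simp add: algebra_simps)
    also have "\<dots> \<le> ?c\<^sup>2 * (4 * ((2 * real n + 1)\<^sup>2 * (16 / 5 * Suc n + 4 / 5)))"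
    proof (intro mult_left_mono)
      have "4 * ((2 * real n + 1)\<^sup>2 * (16 / 5 * Suc n + 4 / 5)) - 16 * ((real n + 1)\<^sup>2 * (16 / 5 * n + 4 / 5)) = 16 / 5"
        by (simp add: power2_eq_square field_simps)
      then show "16 * ((real n + 1)\<^sup>2 * (16 / 5 * n + 4 / 5)) \<le> 4 * ((2 * real n + 1)\<^sup>2 * (16 / 5 * Suc n + 4 / 5))"
        by linarith
    qed simp
    also have "\<dots> = (2 * (2 * n + 1) * ?c)\<^sup>2 * (16 / 5 * Suc n + 4 / 5)"
    proof -
      have "(real (2 * (2 * n + 1)) * ?c)\<^sup>2 = ?c\<^sup>2 * (4 * (2 * real n + 1)\<^sup>2)"
        by (simp add: power2_eq_square algebra_simps)
      then show ?thesis by (simp only: mult.assoc)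
    qed
    also have "\<dots> = (real n + 1)\<^sup>2 * (?d\<^sup>2 * (16 / 5 * Suc n + 4 / 5))"
      by (simp only: d[symmetric] power_mult_distrib of_nat_add of_nat_power of_nat_1 mult.assoc)
    finally have "(real n + 1)\<^sup>2 * (4 ^ Suc n)\<^sup>2 \<le> (real n + 1)\<^sup>2 * (?d\<^sup>2 * (16 / 5 * Suc n + 4 / 5))" .
    then show ?case
      by (rule mult_left_le_imp_le) simp
  qed
  then have "sqrt ((4 ^ n)\<^sup>2) \<le> sqrt ((real ((2 * n) choose n))\<^sup>2 * (16 / 5 * n + 4 / 5))"
    by (rule real_sqrt_le_mono)
  then show ?thesis by (simp add: real_sqrt_mult)
qed

text \<open>The maximum is the number of levels k \<ge> 1 that the walk reaches. By reflection, at
  most C(2n, n - k) balanced patterns reach level k, and these coefficients add up to half of 4^n -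
  C(2n, n).\<close>

lemma sum_balanced_walk_max_le:
  assumes "distinct xs" "length xs = 2 * n" "n \<ge> 1"
  shows "(\<Sum>I | I \<subseteq> set xs \<and> card I = n. real_of_int (walk_max (map (sgn_of I) xs)))
         \<le> 11 / 12 * sqrt n * real ((2 * n) choose n)"
proof -
  let ?S = "{I. I \<subseteq> set xs \<and> card I = n}"
  let ?m = "\<lambda>I. walk_max (map (sgn_of I) xs)"
  have m: "?m I = int (\<Sum>k\<in>{1..2*n}. if int k \<le> ?m I then 1 else 0)" for I
  proof -
    have "?m I \<le> 2 * int n"
    proof -
      have "x \<le> 1" if "x \<in> set (map (sgn_of I) xs)" for x
        using that by (auto simp: sgn_of_def)
      then show ?thesis
        using walk_max_le_length[of "map (sgn_of I) xs"] assms(2) by simp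
    qed
    then have "{k \<in> {1..2*n}. int k \<le> ?m I} = {1..nat (?m I)}"
      using walk_max_nonneg[of "map (sgn_of I) xs"] by auto
    then show ?thesis
      using walk_max_nonneg[of "map (sgn_of I) xs"] by (simp add: sum.If_cases Int_def)
  qed
  have "(\<Sum>I\<in>?S. ?m I) = int (\<Sum>I\<in>?S. \<Sum>k\<in>{1..2*n}. if int k \<le> ?m I then 1 else 0)"
    unfolding of_nat_sum[of _ ?S] by (intro sum.cong refl m)
  also have "(\<Sum>I\<in>?S. \<Sum>k\<in>{1..2*n}. if int k \<le> ?m I then 1 else 0)
      = (\<Sum>k\<in>{1..2*n}. card {I \<in> Pow (set xs). card I = n \<and> int k \<le> ?m I})"
    by (subst sum.swap) (auto intro!: sum.cong arg_cong[where f = card] simp: sum.If_cases)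
  also have "\<dots> \<le> (\<Sum>k\<in>{1..2*n}. if k \<le> n then (2 * n) choose (n - k) else 0)"
    using card_walk_max_ge_le[OF assms(1), of n, unfolded assms(2)] by (intro sum_mono) simp
  also have "\<dots> = (\<Sum>k\<in>{1..n}. (2 * n) choose (n - k))"
    by (rule sum.mono_neutral_cong_right) auto
  also have "\<dots> = (\<Sum>j<n. (2 * n) choose j)"
    by (rule sum.reindex_bij_witness[of _ "\<lambda>j. n - j" "\<lambda>j. n - j"]) auto
  finally have "(\<Sum>I\<in>?S. ?m I) \<le> int (\<Sum>j<n. (2 * n) choose j)" by simp
  then have "real_of_int (\<Sum>I\<in>?S. ?m I) \<le> real (\<Sum>j<n. (2 * n) choose j)"
    by (metis of_int_le_iff of_int_of_nat_eq)
  moreover have "2 * real (\<Sum>j<n. (2 * n) choose j) + real ((2 * n) choose n) = 4 ^ n"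
    using arg_cong[OF sum_binomial_below_middle[of n], of real] by (simp del: of_nat_sum)
  moreover have "4 ^ n \<le> real ((2 * n) choose n) * sqrt (16 / 5 * n + 4 / 5)"
    by (rule central_binomial_bound[OF assms(3)])
  \<comment> \<open>The summand 1 is compensated by the central coefficient subtracted from 4^n;
    half of 11/6 is the constant 11/12.\<close>
  moreover have "sqrt (16 / 5 * n + 4 / 5) \<le> 11 / 6 * sqrt n + 1"
  proof (rule real_le_lsqrt)
    have "(11 / 6 * sqrt n + 1)\<^sup>2 = 121 / 36 * (sqrt n)\<^sup>2 + 11 / 3 * sqrt n + 1"
      by (simp add: power2_eq_square algebra_simps)
    also have "(sqrt n)\<^sup>2 = n" by simp
    finally show "16 / 5 * real n + 4 / 5 \<le> (11 / 6 * sqrt n + 1)\<^sup>2"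
      using real_sqrt_ge_zero[of "real n"] by linarith
  qed simp
  then have "real ((2 * n) choose n) * sqrt (16 / 5 * n + 4 / 5) \<le> real ((2 * n) choose n) * (11 / 6 * sqrt n + 1)"
    by (rule mult_left_mono) simp
  ultimately show ?thesis by (simp add: algebra_simps)
qed

text \<open>Points are sorted by how many members of the chain omit them. A point omitted no more
  often than some element of \<open>A\<close> lies in \<open>A\<close> itself, so every member is an
  initial segment of this order.\<close>

lemma chain_prefix_list:
  fixes \<A> :: "'a set set"
  assumes "finite X" "finite \<A>" "\<And>A. A \<in> \<A> \<Longrightarrow> A \<subseteq> X"
    and chain: "\<And>A B. A \<in> \<A> \<Longrightarrow> B \<in> \<A> \<Longrightarrow> A \<subseteq> B \<or> B \<subseteq> A"
  shows "\<exists>xs. distinct xs \<and> set xs = X \<and> (\<forall>A\<in>\<A>. \<exists>k. A = set (take k xs))"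
proof -
  define r where "r i = card {A \<in> \<A>. i \<notin> A}" for i
  obtain ys where ys: "set ys = X" "distinct ys"
    using finite_distinct_list[OF assms(1)] by blast
  define xs where "xs = sort_key r ys"
  have xs: "distinct xs" "set xs = X" "sorted (map r xs)"
    using ys by (simp_all add: xs_def)
  have down: "j \<in> A" if "A \<in> \<A>" "i \<in> A" "r j \<le> r i" for A i j
  proof (rule ccontr)
    assume "j \<notin> A"
    then have "{A \<in> \<A>. i \<notin> A} \<subset> {A \<in> \<A>. j \<notin> A}"
      using chain that by blast
    then have "r i < r j"
      unfolding r_def by (rule psubset_card_mono[rotated]) (use assms in simp)
    then show False using that by simp
  qed
  have "\<exists>k. A = set (take k xs)" if A: "A \<in> \<A>" for A
  proof -
    define k where "k = length (takeWhile (\<lambda>i. i \<in> A) xs)"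
    have t: "take k xs = takeWhile (\<lambda>i. i \<in> A) xs"
      unfolding k_def by (rule takeWhile_eq_take[symmetric])
    have "A \<subseteq> set (take k xs)"
    proof
      fix i assume i: "i \<in> A"
      then obtain m where m: "m < length xs" "xs ! m = i"
        using assms(3)[OF A] xs(2) by (metis in_set_conv_nth subsetD)
      have "m < k"
      proof (rule ccontr)
        assume "\<not> m < k"
        then have km: "k \<le> m" "k < length xs" using m by auto
        then have "xs ! k \<notin> A" unfolding k_def by (metis nth_length_takeWhile)
        moreover have "r (xs ! k) \<le> r (xs ! m)"
          using sorted_nth_mono[OF xs(3) km(1)] m km by simp
        ultimately show False using down[OF A i] m by blast
      qed
      then show "i \<in> set (take k xs)" using m by (auto simp: in_set_conv_nth)
    qed
    moreover have "set (take k xs) \<subseteq> A"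
      unfolding t by (auto dest: set_takeWhileD)
    ultimately show ?thesis by blast
  qed
  then show ?thesis using xs by blast
qed

text \<open>Layer-cake decomposition: the superlevel sets of the members of a chain of
  functions form, at each level, a chain of sets, that is, prefixes of one enumeration.\<close>

lemma sum_chain_le_walk_max:
  fixes s :: "'j \<Rightarrow> 'a \<Rightarrow> int" and a :: "'t \<Rightarrow> 'a \<Rightarrow> real"
  assumes "finite X" "finite J"
    and walk: "\<And>xs. distinct xs \<Longrightarrow> set xs = X \<Longrightarrow> (\<Sum>j\<in>J. real_of_int (walk_max (map (s j) xs))) \<le> C"
    and range: "\<And>j i. j \<in> J \<Longrightarrow> i \<in> X \<Longrightarrow> a (sel j) i \<in> {0..b}"
    and chain: "\<And>j j'. j \<in> J \<Longrightarrow> j' \<in> J \<Longrightarrow>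
      (\<forall>i\<in>X. a (sel j) i \<le> a (sel j') i) \<or> (\<forall>i\<in>X. a (sel j') i \<le> a (sel j) i)"
    and b: "0 \<le> b"
  shows "(\<Sum>j\<in>J. \<Sum>i\<in>X. s j i * a (sel j) i) \<le> b * C"
proof -
  define L where "L t j = {i \<in> X. t < a (sel j) i}" for t j
  have level: "(\<Sum>j\<in>J. \<Sum>i\<in>L t j. real_of_int (s j i)) \<le> C" for t
  proof -
    \<comment> \<open>The enumeration depends on the level \<open>t\<close> alone. It serves all
      \<open>j\<close> at once, and this is what allows \<open>walk\<close> to be applied to the
      whole sum over \<open>J\<close>.\<close>
    have "\<exists>xs. distinct xs \<and> set xs = X \<and> (\<forall>A\<in>L t ` J. \<exists>k. A = set (take k xs))"
    proof (rule chain_prefix_list)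
      fix A B assume "A \<in> L t ` J" "B \<in> L t ` J"
      then obtain j j' where j: "j \<in> J" "A = L t j" "j' \<in> J" "B = L t j'" by blast
      show "A \<subseteq> B \<or> B \<subseteq> A"
        using chain[OF j(1) j(3)] unfolding j L_def by fastforce
    qed (use assms in \<open>auto simp: L_def\<close>)
    then obtain xs where xs: "distinct xs" "set xs = X" "\<forall>A\<in>L t ` J. \<exists>k. A = set (take k xs)"
      by blast
    have "(\<Sum>i\<in>L t j. s j i) \<le> walk_max (map (s j) xs)" if j: "j \<in> J" for j
    proof -
      obtain k where k: "L t j = set (take k xs)"
        using bspec[OF xs(3) imageI[OF j]] by blast
      have "(\<Sum>i\<in>L t j. s j i) = sum_list (take k (map (s j) xs))"
        unfolding k take_map by (rule sum_list_distinct_conv_sum_set[symmetric]) (simp add: xs(1))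
      then show ?thesis by (simp add: sum_list_take_le_walk_max)
    qed
    then have "(\<Sum>j\<in>J. real_of_int (\<Sum>i\<in>L t j. s j i)) \<le> (\<Sum>j\<in>J. real_of_int (walk_max (map (s j) xs)))"
      by (intro sum_mono) (simp only: of_int_le_iff)
    also have "\<dots> \<le> C" by (rule walk[OF xs(1,2)])
    finally show ?thesis by simp
  qed
  let ?g = "\<lambda>t. \<Sum>j\<in>J. \<Sum>i\<in>X. real_of_int (s j i) * indicator {0..<a (sel j) i} t"
  have int: "integrable lborel (\<lambda>t. indicator {0..<c} t :: real)" "integral\<^sup>L lborel (\<lambda>t. indicator {0..<c} t :: real) = c"
    if "0 \<le> c" for c :: real
    using that by (auto intro!: integrable_real_indicator simp: measure_def)
  have "(\<Sum>j\<in>J. \<Sum>i\<in>X. s j i * a (sel j) i) = (\<Sum>j\<in>J. \<Sum>i\<in>X. s j i * integral\<^sup>L lborel (\<lambda>t. indicator {0..<a (sel j) i} t))"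
    using range by (auto intro!: sum.cong simp: int)
  also have "\<dots> = integral\<^sup>L lborel ?g"
    using range by (simp add: Bochner_Integration.integral_sum Bochner_Integration.integrable_sum int)
  also have "\<dots> \<le> integral\<^sup>L lborel (\<lambda>t. C * indicator {0..<b} t)"
  proof (rule integral_mono)
    show "integrable lborel ?g"
      using range by (force intro!: Bochner_Integration.integrable_sum int)
    show "integrable lborel (\<lambda>t. C * indicator {0..<b} t :: real)"
      using b by (auto intro!: int)
    fix t :: real
    show "?g t \<le> C * indicator {0..<b} t"
    proof (cases "t \<in> {0..<b}")
      case True
      have "?g t = (\<Sum>j\<in>J. \<Sum>i\<in>L t j. real_of_int (s j i))"
        unfolding L_def sum.inter_filter[OF assms(1)] using True
        by (intro sum.cong) (auto simp: indicator_def)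
      then show ?thesis using level[of t] True by simp
    next
      case False
      then have "t \<notin> {0..<a (sel j) i}" if "j \<in> J" "i \<in> X" for i j
        using range[OF that] by auto
      then show ?thesis using False by simp
    qed
  qed
  also have "\<dots> = b * C" using b by (simp add: int)
  finally show ?thesis .
qed

section \<open>Majorants, symmetrization and contraction\<close>

definition bounded_measurable :: "'a measure \<Rightarrow> ('a \<Rightarrow> real) \<Rightarrow> bool" where
  "bounded_measurable M h \<longleftrightarrow> h \<in> borel_measurable M \<and> (\<exists>B. \<forall>v\<in>space M. \<bar>h v\<bar> \<le> B)"

lemma bounded_measurableI:
  "h \<in> borel_measurable M \<Longrightarrow> (\<And>v. v \<in> space M \<Longrightarrow> \<bar>h v\<bar> \<le> B) \<Longrightarrow> bounded_measurable M h"
  by (auto simp: bounded_measurable_def)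

lemma bounded_measurableD: "bounded_measurable M h \<Longrightarrow> h \<in> borel_measurable M"
  by (simp add: bounded_measurable_def)

lemma bounded_measurable_bound:
  assumes "bounded_measurable M h"
  shows "\<exists>B\<ge>0. \<forall>v\<in>space M. \<bar>h v\<bar> \<le> B"
proof -
  obtain B where "\<forall>v\<in>space M. \<bar>h v\<bar> \<le> B"
    using assms unfolding bounded_measurable_def by blast
  then have "\<forall>v\<in>space M. \<bar>h v\<bar> \<le> \<bar>B\<bar>"
    by (meson abs_ge_self order_trans)
  then show ?thesis by (intro exI[of _ "\<bar>B\<bar>"]) simp
qed

lemma bounded_measurable_const [simp, intro]: "bounded_measurable M (\<lambda>_. c)"
  by (rule bounded_measurableI[of _ _ "\<bar>c\<bar>"]) auto

lemma bounded_measurable_add [intro]: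
  assumes "bounded_measurable M f" "bounded_measurable M g"
  shows "bounded_measurable M (\<lambda>v. f v + g v)"
proof -
  obtain A where A: "\<And>v. v \<in> space M \<Longrightarrow> \<bar>f v\<bar> \<le> A" using bounded_measurable_bound[OF assms(1)] by blast
  obtain B where B: "\<And>v. v \<in> space M \<Longrightarrow> \<bar>g v\<bar> \<le> B" using bounded_measurable_bound[OF assms(2)] by blast
  have "\<bar>f v + g v\<bar> \<le> A + B" if "v \<in> space M" for v
    using A[OF that] B[OF that] by linarith
  then show ?thesis
    using assms by (intro bounded_measurableI) (auto dest!: bounded_measurableD)
qed

lemma bounded_measurable_cmult [intro]:
  assumes "bounded_measurable M f"
  shows "bounded_measurable M (\<lambda>v. c * f v)"
proof -
  obtain A where "\<And>v. v \<in> space M \<Longrightarrow> \<bar>f v\<bar> \<le> A" using bounded_measurable_bound[OF assms] by blast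
  then have "\<bar>c * f v\<bar> \<le> \<bar>c\<bar> * A" if "v \<in> space M" for v
    using that by (simp add: abs_mult mult_left_mono)
  then show ?thesis
    using assms by (intro bounded_measurableI) (auto dest!: bounded_measurableD)
qed

lemma bounded_measurable_minus [intro]:
  "bounded_measurable M f \<Longrightarrow> bounded_measurable M (\<lambda>v. - f v)"
  using bounded_measurable_cmult[of M f "- 1"] by simp

lemma bounded_measurable_diff [intro]:
  "bounded_measurable M f \<Longrightarrow> bounded_measurable M g \<Longrightarrow> bounded_measurable M (\<lambda>v. f v - g v)"
  using bounded_measurable_add[OF _ bounded_measurable_minus, of M f g] by simp

lemma bounded_measurable_sum [intro]:
  assumes "\<And>i. i \<in> A \<Longrightarrow> bounded_measurable M (f i)"
  shows "bounded_measurable M (\<lambda>v. \<Sum>i\<in>A. f i v)"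
  using assms by (induction A rule: infinite_finite_induct) auto

lemma bounded_measurable_comp:
  assumes "bounded_measurable M h" "f \<in> measurable M' M"
  shows "bounded_measurable M' (\<lambda>v. h (f v))"
proof -
  obtain B where "\<And>v. v \<in> space M \<Longrightarrow> \<bar>h v\<bar> \<le> B" using bounded_measurable_bound[OF assms(1)] by blast
  then show ?thesis
    using assms measurable_space[OF assms(2)]
    by (intro bounded_measurableI[of _ _ B]) (auto dest!: bounded_measurableD intro: measurable_compose)
qed

lemma bounded_measurable_lipschitz_comp:
  fixes \<phi> :: "real \<Rightarrow> real"
  assumes h: "bounded_measurable M h" and lip: "\<And>s t. \<bar>\<phi> s - \<phi> t\<bar> \<le> \<bar>s - t\<bar>"
  shows "bounded_measurable M (\<lambda>v. \<phi> (h v))"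
proof -
  have [measurable]: "\<phi> \<in> borel_measurable borel"
  proof (intro borel_measurable_continuous_onI continuous_onI)
    fix x e :: real assume e: "e > 0"
    have "dist (\<phi> x') (\<phi> x) \<le> e" if "dist x' x < e" for x'
      using lip[of x' x] that by (simp add: dist_real_def)
    then show "\<exists>d>0. \<forall>x'\<in>UNIV. dist x' x < d \<longrightarrow> dist (\<phi> x') (\<phi> x) \<le> e"
      using e by blast
  qed
  obtain B where B: "\<And>v. v \<in> space M \<Longrightarrow> \<bar>h v\<bar> \<le> B" using bounded_measurable_bound[OF h] by blast
  have "\<bar>\<phi> (h v)\<bar> \<le> \<bar>\<phi> 0\<bar> + B" if "v \<in> space M" for v
    using lip[of "h v" 0] B[OF that] by linarith
  then show ?thesis
    using h by (intro bounded_measurableI) (auto dest!: bounded_measurableD)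
qed

lemma (in prob_space) integrable_bounded_measurable [intro]:
  assumes "bounded_measurable M h" shows "integrable M h"
proof -
  obtain B where "\<And>v. v \<in> space M \<Longrightarrow> \<bar>h v\<bar> \<le> B" using bounded_measurable_bound[OF assms] by blast
  then show ?thesis
    using assms by (intro integrable_const_bound[of _ B]) (auto dest!: bounded_measurableD)
qed

text \<open>Domination of a possibly non-measurable supremum: \<open>r\<close> bounds the outer integral of
  \<open>v \<mapsto> SUP \<theta>\<in>\<Theta>. f \<theta> v\<close>.\<close>

definition majorized :: "'a measure \<Rightarrow> 'i set \<Rightarrow> ('i \<Rightarrow> 'a \<Rightarrow> real) \<Rightarrow> real \<Rightarrow> bool" where
  "majorized M \<Theta> f r \<longleftrightarrow> (\<exists>H. bounded_measurable M H \<and>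
     (\<forall>\<theta>\<in>\<Theta>. \<forall>v\<in>space M. f \<theta> v \<le> H v) \<and> integral\<^sup>L M H \<le> r)"

lemma majorizedI:
  "bounded_measurable M H \<Longrightarrow> (\<And>\<theta> v. \<theta> \<in> \<Theta> \<Longrightarrow> v \<in> space M \<Longrightarrow> f \<theta> v \<le> H v) \<Longrightarrow> integral\<^sup>L M H \<le> r
    \<Longrightarrow> majorized M \<Theta> f r"
  by (auto simp: majorized_def)

text \<open>The dominating index may depend on the point \<open>v\<close>, since pointwise suprema
  are compared. Positive parts and absolute values are treated this way below, with a different
  index in each case.\<close>

lemma majorized_mono:
  assumes "majorized M \<Theta>' g r" "r \<le> s"
    and "\<And>\<theta> v. \<theta> \<in> \<Theta> \<Longrightarrow> v \<in> space M \<Longrightarrow> \<exists>\<theta>'\<in>\<Theta>'. f \<theta> v \<le> g \<theta>' v"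
  shows "majorized M \<Theta> f s"
proof -
  obtain H where H: "bounded_measurable M H" "\<And>\<theta> v. \<theta> \<in> \<Theta>' \<Longrightarrow> v \<in> space M \<Longrightarrow> g \<theta> v \<le> H v" "integral\<^sup>L M H \<le> r"
    using assms(1) unfolding majorized_def by blast
  show ?thesis
  proof (rule majorizedI[OF H(1)])
    fix \<theta> v assume *: "\<theta> \<in> \<Theta>" "v \<in> space M"
    show "f \<theta> v \<le> H v" using assms(3)[OF *] H(2)[OF _ *(2)] by (meson order_trans)
  qed (use H(3) assms(2) in simp)
qed

text \<open>The supremum of a sum is at most the sum of the suprema. Indexing by pairs decouples the
  two families, and majorants can be added even where the suprema are not measurable.\<close>

lemma (in prob_space) majorized_add:
  assumes "majorized M \<Theta> f r" "majorized M \<Theta>' g s"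
  shows "majorized M (\<Theta> \<times> \<Theta>') (\<lambda>(\<theta>, \<theta>') v. f \<theta> v + g \<theta>' v) (r + s)"
proof -
  obtain H where H: "bounded_measurable M H" "\<And>\<theta> v. \<theta> \<in> \<Theta> \<Longrightarrow> v \<in> space M \<Longrightarrow> f \<theta> v \<le> H v" "integral\<^sup>L M H \<le> r"
    using assms(1) unfolding majorized_def by blast
  obtain G where G: "bounded_measurable M G" "\<And>\<theta> v. \<theta> \<in> \<Theta>' \<Longrightarrow> v \<in> space M \<Longrightarrow> g \<theta> v \<le> G v" "integral\<^sup>L M G \<le> s"
    using assms(2) unfolding majorized_def by blast
  show ?thesis
  proof (rule majorizedI[of _ "\<lambda>v. H v + G v"])
    show "(\<integral>v. H v + G v \<partial>M) \<le> r + s"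
      using H G by (subst Bochner_Integration.integral_add) (auto intro: add_mono)
  qed (use H G in \<open>auto intro: add_mono\<close>)
qed

lemma majorized_cmult:
  assumes "majorized M \<Theta> f r" "0 \<le> c"
  shows "majorized M \<Theta> (\<lambda>\<theta> v. c * f \<theta> v) (c * r)"
proof -
  obtain H where H: "bounded_measurable M H" "\<And>\<theta> v. \<theta> \<in> \<Theta> \<Longrightarrow> v \<in> space M \<Longrightarrow> f \<theta> v \<le> H v" "integral\<^sup>L M H \<le> r"
    using assms(1) unfolding majorized_def by blast
  show ?thesis
    by (rule majorizedI[of _ "\<lambda>v. c * H v"]) (use H assms(2) in \<open>auto intro: mult_left_mono\<close>)
qed

lemma (in prob_space) integral_le_of_majorized:
  assumes "majorized M \<Theta> f r" "\<theta> \<in> \<Theta>" "bounded_measurable M (f \<theta>)"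
  shows "integral\<^sup>L M (f \<theta>) \<le> r"
proof -
  obtain H where H: "bounded_measurable M H" "\<And>\<theta> v. \<theta> \<in> \<Theta> \<Longrightarrow> v \<in> space M \<Longrightarrow> f \<theta> v \<le> H v" "integral\<^sup>L M H \<le> r"
    using assms(1) unfolding majorized_def by blast
  have "integral\<^sup>L M (f \<theta>) \<le> integral\<^sup>L M H"
    using H assms by (intro integral_mono) auto
  then show ?thesis using H(3) by simp
qed

section \<open>Product law of the sample and resampling of a coordinate\<close>

locale iid_product = prob_space D for D :: "'v measure" +
  fixes N :: nat
begin

abbreviation W :: "(nat \<Rightarrow> 'v) measure" where "W \<equiv> PiM {..<N} (\<lambda>_. D)"

sublocale W: prob_space W
  by (rule prob_space_PiM) (rule prob_space_axioms)

sublocale PS: product_sigma_finite "\<lambda>_ :: nat. D"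
  by (rule product_sigma_finite.intro) (rule sigma_finite_measure_axioms)

sublocale WD: pair_prob_space W D ..

lemma upd_space: "v \<in> space W \<Longrightarrow> u \<in> space D \<Longrightarrow> k < N \<Longrightarrow> v(k := u) \<in> space W"
  by (auto simp: space_PiM PiE_def extensional_def)

lemma component_space: "v \<in> space W \<Longrightarrow> k < N \<Longrightarrow> v k \<in> space D"
  by (auto simp: space_PiM)

lemma measurable_upd:
  assumes "k < N" "f \<in> measurable L W" "g \<in> measurable L D"
  shows "(\<lambda>p. (f p)(k := g p)) \<in> measurable L W"
  using assms by (intro measurable_fun_upd) auto

text \<open>Replacing one coordinate by an independent copy preserves the product law. A coordinate
  can thus be integrated out on \<open>W\<close> itself, without splitting the index set.\<close>

lemma distr_upd:
  assumes k: "k < N"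
  shows "distr (W \<Otimes>\<^sub>M D) W (\<lambda>p. (fst p)(k := snd p)) = W"
proof (rule PS.PiM_eqI)
  have m: "(\<lambda>p. (fst p)(k := snd p)) \<in> measurable (W \<Otimes>\<^sub>M D) W"
    using k by (intro measurable_upd) auto
  fix A assume A: "\<And>i. i \<in> {..<N} \<Longrightarrow> A i \<in> sets D"
  have "(\<lambda>p. (fst p)(k := snd p)) -` (\<Pi>\<^sub>E i\<in>{..<N}. A i) \<inter> space (W \<Otimes>\<^sub>M D)
      = (\<Pi>\<^sub>E i\<in>{..<N}. if i = k then space D else A i) \<times> A k"
  proof (intro equalityI subsetI)
    fix p assume p: "p \<in> (\<lambda>p. (fst p)(k := snd p)) -` (\<Pi>\<^sub>E i\<in>{..<N}. A i) \<inter> space (W \<Otimes>\<^sub>M D)"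
    obtain v u where [simp]: "p = (v, u)" by force
    have *: "v(k := u) \<in> (\<Pi>\<^sub>E i\<in>{..<N}. A i)" "v \<in> space W"
      using p by (auto simp: space_pair_measure)
    have "v i \<in> (if i = k then space D else A i)" if "i < N" for i
      using PiE_mem[OF *(1), of i] component_space[OF *(2), of i] that by (auto split: if_splits)
    then show "p \<in> (\<Pi>\<^sub>E i\<in>{..<N}. if i = k then space D else A i) \<times> A k"
      using *(2) PiE_mem[OF *(1), of k] k by (auto simp: space_PiM PiE_iff)
  next
    fix p assume p: "p \<in> (\<Pi>\<^sub>E i\<in>{..<N}. if i = k then space D else A i) \<times> A k"
    obtain v u where [simp]: "p = (v, u)" by force
    have pv: "v \<in> (\<Pi>\<^sub>E i\<in>{..<N}. if i = k then space D else A i)" "u \<in> A k"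
      using p by simp_all
    have v: "v i \<in> (if i = k then space D else A i)" if "i < N" for i
      using PiE_mem[OF pv(1), of i] that by simp
    have sub: "A i \<subseteq> space D" if "i < N" for i using A[of i] that by (auto dest: sets.sets_into_space)
    have "v i \<in> space D" if "i < N" for i
      using v[OF that] sub[OF that] by (cases "i = k") auto
    moreover have "v \<in> extensional {..<N}"
      using pv(1) by (simp add: PiE_iff)
    ultimately have "v \<in> space W" by (simp add: space_PiM PiE_iff)
    moreover have "(v(k := u)) i \<in> A i" if "i < N" for i
      using v[OF that] pv(2) by (cases "i = k") auto
    then have "v(k := u) \<in> (\<Pi>\<^sub>E i\<in>{..<N}. A i)"
      using \<open>v \<in> extensional {..<N}\<close> k by (simp add: PiE_iff extensional_def)
    ultimately show "p \<in> (\<lambda>p. (fst p)(k := snd p)) -` (\<Pi>\<^sub>E i\<in>{..<N}. A i) \<inter> space (W \<Otimes>\<^sub>M D)"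
      using pv(2) sub[OF k] by (auto simp: space_pair_measure)
  qed
  moreover have "(\<Pi>\<^sub>E i\<in>{..<N}. A i) \<in> sets W"
    using A by (intro sets_PiM_I_finite) auto
  ultimately have "emeasure (distr (W \<Otimes>\<^sub>M D) W (\<lambda>p. (fst p)(k := snd p))) (\<Pi>\<^sub>E i\<in>{..<N}. A i)
      = emeasure (W \<Otimes>\<^sub>M D) ((\<Pi>\<^sub>E i\<in>{..<N}. if i = k then space D else A i) \<times> A k)"
    using m by (simp add: emeasure_distr)
  also have "\<dots> = emeasure W (\<Pi>\<^sub>E i\<in>{..<N}. if i = k then space D else A i) * emeasure D (A k)"
    using A k by (intro emeasure_pair_measure_Times sets_PiM_I_finite) auto
  also have "emeasure W (\<Pi>\<^sub>E i\<in>{..<N}. if i = k then space D else A i) = (\<Prod>i<N. emeasure D (if i = k then space D else A i))"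
    using A by (intro PS.emeasure_PiM) auto
  also have "\<dots> = (\<Prod>i\<in>{..<N} - {k}. emeasure D (A i))"
    using k by (subst prod.remove[of _ k]) (auto simp: emeasure_space_1 intro!: prod.cong)
  also have "(\<Prod>i\<in>{..<N} - {k}. emeasure D (A i)) * emeasure D (A k) = (\<Prod>i<N. emeasure D (A i))"
    using k by (simp add: prod.remove[of "{..<N}" k] mult.commute)
  finally show "emeasure (distr (W \<Otimes>\<^sub>M D) W (\<lambda>p. (fst p)(k := snd p))) (\<Pi>\<^sub>E i\<in>{..<N}. A i)
      = (\<Prod>i<N. emeasure D (A i))" .
qed auto

lemma bounded_measurable_upd_pair:
  assumes "k < N" "bounded_measurable W h"
  shows "bounded_measurable (W \<Otimes>\<^sub>M D) (\<lambda>p. h ((fst p)(k := snd p)))"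
  using assms by (intro bounded_measurable_comp[OF assms(2)] measurable_upd) auto

lemma bounded_measurable_upd_snd:
  assumes "k < N" "bounded_measurable W h" "v \<in> space W"
  shows "bounded_measurable D (\<lambda>u. h (v(k := u)))"
  using assms by (intro bounded_measurable_comp[OF assms(2)] measurable_upd) auto

lemma bounded_measurable_component:
  assumes "k < N" "bounded_measurable D h"
  shows "bounded_measurable W (\<lambda>v. h (v k))"
  using assms by (intro bounded_measurable_comp[OF assms(2)]) auto

lemma bounded_measurable_resample:
  assumes k: "k < N" and h: "bounded_measurable W h"
  shows "bounded_measurable W (\<lambda>v. \<integral>u. h (v(k := u)) \<partial>D)"
proof -
  obtain B where B: "0 \<le> B" "\<And>v. v \<in> space W \<Longrightarrow> \<bar>h v\<bar> \<le> B" using bounded_measurable_bound[OF h] by blast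
  show ?thesis
  proof (rule bounded_measurableI[of _ _ B])
    have "(\<lambda>p. h ((fst p)(k := snd p))) \<in> borel_measurable (W \<Otimes>\<^sub>M D)"
      using bounded_measurable_upd_pair[OF k h] by (rule bounded_measurableD)
    then have "case_prod (\<lambda>v u. h (v(k := u))) \<in> borel_measurable (W \<Otimes>\<^sub>M D)"
      by (simp add: case_prod_beta')
    then show "(\<lambda>v. \<integral>u. h (v(k := u)) \<partial>D) \<in> borel_measurable W"
      by (rule borel_measurable_lebesgue_integral)
    fix v assume v: "v \<in> space W"
    have "\<bar>\<integral>u. h (v(k := u)) \<partial>D\<bar> \<le> (\<integral>u. \<bar>h (v(k := u))\<bar> \<partial>D)"
      by (rule integral_abs_bound)
    also have "\<dots> \<le> (\<integral>u. B \<partial>D)"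
    proof (rule integral_mono)
      show "integrable D (\<lambda>u. \<bar>h (v(k := u))\<bar>)"
        using bounded_measurable_upd_snd[OF k h v] by (intro integrable_abs integrable_bounded_measurable)
    qed (use B upd_space[OF v] k in auto)
    finally show "\<bar>\<integral>u. h (v(k := u)) \<partial>D\<bar> \<le> B" by (simp add: prob_space)
  qed
qed

lemma integral_resample:
  assumes k: "k < N" and h: "bounded_measurable W h"
  shows "(\<integral>v. (\<integral>u. h (v(k := u)) \<partial>D) \<partial>W) = integral\<^sup>L W h"
proof -
  have "(\<integral>v. (\<integral>u. h (v(k := u)) \<partial>D) \<partial>W) = (\<integral>p. h ((fst p)(k := snd p)) \<partial>(W \<Otimes>\<^sub>M D))"
    using WD.integral_fst'[OF WD.integrable_bounded_measurable[OF bounded_measurable_upd_pair[OF k h]]] by simp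
  also have "\<dots> = integral\<^sup>L (distr (W \<Otimes>\<^sub>M D) W (\<lambda>p. (fst p)(k := snd p))) h"
    using k h by (intro integral_distr[symmetric] measurable_upd) (auto dest: bounded_measurableD)
  finally show ?thesis by (simp add: distr_upd[OF k])
qed

lemma AE_resample:
  assumes k: "k < N" and "AE v in W. P v"
  shows "AE v in W. AE u in D. P (v(k := u))"
proof -
  have "(\<lambda>p. (fst p)(k := snd p)) \<in> measurable (W \<Otimes>\<^sub>M D) W"
    using k by (intro measurable_upd) auto
  moreover have "AE v in distr (W \<Otimes>\<^sub>M D) W (\<lambda>p. (fst p)(k := snd p)). P v"
    unfolding distr_upd[OF k] by (rule assms(2))
  ultimately have "AE p in W \<Otimes>\<^sub>M D. P ((fst p)(k := snd p))"
    by (rule AE_distrD)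
  from WD.AE_pair[OF this] show ?thesis by simp
qed

text \<open>One step of symmetrization and contraction at once. Pointwise, the supremum of
  \<open>a / 2 - \<phi> s\<close> subject to \<open>a \<plusminus> 2 * s \<le> H\<^sub>\<plusminus>\<close> is attained at \<open>s = (H\<^sub>+ - H\<^sub>-) / 4\<close>, which
  yields an explicit measurable majorant even when the suprema themselves are not measurable.\<close>

lemma contraction_step:
  fixes \<phi> :: "real \<Rightarrow> real" and s :: "'i \<Rightarrow> 'v \<Rightarrow> real" and A :: "'i \<Rightarrow> (nat \<Rightarrow> 'v) \<Rightarrow> real"
  assumes k: "k < N" and lip: "\<And>s t. \<bar>\<phi> s - \<phi> t\<bar> \<le> \<bar>s - t\<bar>"
    and s: "\<And>\<theta>. \<theta> \<in> \<Theta> \<Longrightarrow> bounded_measurable D (s \<theta>)"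
    and A: "\<And>\<theta> v u. \<theta> \<in> \<Theta> \<Longrightarrow> A \<theta> (v(k := u)) = A \<theta> v"
    and plus: "majorized W \<Theta> (\<lambda>\<theta> v. A \<theta> v + 2 * s \<theta> (v k)) r\<^sub>1"
    and minus: "majorized W \<Theta> (\<lambda>\<theta> v. A \<theta> v - 2 * s \<theta> (v k)) r\<^sub>2"
  shows "majorized W \<Theta> (\<lambda>\<theta> v. A \<theta> v + ((\<integral>u. \<phi> (s \<theta> u) \<partial>D) - \<phi> (s \<theta> (v k)))) ((r\<^sub>1 + r\<^sub>2) / 2)"
proof -
  obtain P where P: "bounded_measurable W P" "integral\<^sup>L W P \<le> r\<^sub>1"
    "\<And>\<theta> v. \<theta> \<in> \<Theta> \<Longrightarrow> v \<in> space W \<Longrightarrow> A \<theta> v + 2 * s \<theta> (v k) \<le> P v"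
    using plus unfolding majorized_def by blast
  obtain Q where Q: "bounded_measurable W Q" "integral\<^sup>L W Q \<le> r\<^sub>2"
    "\<And>\<theta> v. \<theta> \<in> \<Theta> \<Longrightarrow> v \<in> space W \<Longrightarrow> A \<theta> v - 2 * s \<theta> (v k) \<le> Q v"
    using minus unfolding majorized_def by blast
  define h where "h v = (1 / 4) * (P v - Q v)" for v
  define m where "m v = (1 / 4) * (P v + Q v)" for v
  define U where "U v = m v + \<phi> (h v)" for v
  have "bounded_measurable W h"
    unfolding h_def by (intro bounded_measurable_cmult bounded_measurable_diff P Q)
  moreover have "bounded_measurable W m"
    unfolding m_def by (intro bounded_measurable_cmult bounded_measurable_add P Q)
  ultimately have bm: "bounded_measurable W m" "bounded_measurable W (\<lambda>v. \<phi> (h v))"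
    using bounded_measurable_lipschitz_comp[OF _ lip] by blast+
  have bU: "bounded_measurable W U" unfolding U_def by (intro bounded_measurable_add bm)
  note bR = bounded_measurable_resample[OF k bU]
  \<comment> \<open>The constraints read A / 2 + s \<le> m + h and A / 2 - s \<le> m - h. The
    distance term covers the replacement of \<phi> s by \<phi> h, at the sample point with one half
    of \<open>A\<close> and at the resampled point with the other.\<close>
  have key: "A \<theta> v / 2 + \<bar>s \<theta> (v k) - h v\<bar> \<le> m v" if "\<theta> \<in> \<Theta>" "v \<in> space W" for \<theta> v
    using P(3)[OF that] Q(3)[OF that] unfolding m_def h_def by (auto simp: abs_if field_simps)
  show ?thesis
  proof (rule majorizedI[of _ "\<lambda>v. (m v - \<phi> (h v)) + (\<integral>u. U (v(k := u)) \<partial>D)"])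
    show "bounded_measurable W (\<lambda>v. (m v - \<phi> (h v)) + (\<integral>u. U (v(k := u)) \<partial>D))"
      by (intro bounded_measurable_add bounded_measurable_diff bm bR)
    have "(\<integral>v. (m v - \<phi> (h v)) + (\<integral>u. U (v(k := u)) \<partial>D) \<partial>W)
        = (\<integral>v. m v - \<phi> (h v) \<partial>W) + integral\<^sup>L W U"
      using W.integrable_bounded_measurable[OF bounded_measurable_diff[OF bm]] W.integrable_bounded_measurable[OF bR]
      by (simp add: integral_resample[OF k bU] Bochner_Integration.integral_add del: Bochner_Integration.integral_diff)
    \<comment> \<open>Resampling preserves the integral of \<open>U\<close>, so the two occurrences
      of \<phi> h cancel and twice the integral of \<open>m\<close> remains.\<close>
    also have "\<dots> = (\<integral>v. (1 / 2) * (P v + Q v) \<partial>W)"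
      using W.integrable_bounded_measurable[OF bounded_measurable_diff[OF bm]] W.integrable_bounded_measurable[OF bU]
      by (subst Bochner_Integration.integral_add[symmetric])
         (simp_all add: U_def m_def)
    also have "\<dots> = (1 / 2) * (integral\<^sup>L W P + integral\<^sup>L W Q)"
      using P(1) Q(1) by (simp add: W.integrable_bounded_measurable)
    finally show "(\<integral>v. (m v - \<phi> (h v)) + (\<integral>u. U (v(k := u)) \<partial>D) \<partial>W) \<le> (r\<^sub>1 + r\<^sub>2) / 2"
      using P(2) Q(2) by simp
    fix \<theta> v assume \<theta>: "\<theta> \<in> \<Theta>" and v: "v \<in> space W"
    have "A \<theta> v / 2 + (\<integral>u. \<phi> (s \<theta> u) \<partial>D) = (\<integral>u. A \<theta> v / 2 + \<phi> (s \<theta> u) \<partial>D)"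
      using integrable_bounded_measurable[OF bounded_measurable_lipschitz_comp[OF s[OF \<theta>] lip]]
      by (simp add: Bochner_Integration.integral_add prob_space)
    also have "\<dots> \<le> (\<integral>u. U (v(k := u)) \<partial>D)"
    proof (rule integral_mono)
      show "integrable D (\<lambda>u. A \<theta> v / 2 + \<phi> (s \<theta> u))"
        using integrable_bounded_measurable[OF bounded_measurable_lipschitz_comp[OF s[OF \<theta>] lip]]
        by (intro Bochner_Integration.integrable_add) auto
      show "integrable D (\<lambda>u. U (v(k := u)))"
        using bounded_measurable_upd_snd[OF k bU v] by (rule integrable_bounded_measurable)
      fix u assume "u \<in> space D"
      then show "A \<theta> v / 2 + \<phi> (s \<theta> u) \<le> U (v(k := u))"
        using key[OF \<theta> upd_space[OF v _ k], of u] lip[of "s \<theta> u" "h (v(k := u))"]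
        by (simp add: U_def A[OF \<theta>])
    qed
    finally have "A \<theta> v / 2 + (\<integral>u. \<phi> (s \<theta> u) \<partial>D) \<le> (\<integral>u. U (v(k := u)) \<partial>D)" .
    then show "A \<theta> v + ((\<integral>u. \<phi> (s \<theta> u) \<partial>D) - \<phi> (s \<theta> (v k))) \<le> (m v - \<phi> (h v)) + (\<integral>u. U (v(k := u)) \<partial>D)"
      using key[OF \<theta> v] lip[of "s \<theta> (v k)" "h v"] by linarith
  qed
qed

text \<open>Coordinates are treated one at a time: those below \<open>k\<close> carry centred terms,
  the others still carry signs. Each sign pattern keeps its own bound, because different patterns
  have different majorants. A step averages the bounds of two patterns that differ at
  \<open>k\<close> only, which preserves the sum over all patterns.\<close>

lemma symmetrization_contraction:
  fixes \<phi> :: "real \<Rightarrow> real" and s :: "'i \<Rightarrow> 'v \<Rightarrow> real"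
  assumes lip: "\<And>s t. \<bar>\<phi> s - \<phi> t\<bar> \<le> \<bar>s - t\<bar>"
    and s: "\<And>\<theta>. \<theta> \<in> \<Theta> \<Longrightarrow> bounded_measurable D (s \<theta>)"
    and \<rho>: "\<And>I. I \<subseteq> {..<N} \<Longrightarrow>
      majorized W \<Theta> (\<lambda>\<theta> v. 2 * (\<Sum>i<N. sgn_of I i * s \<theta> (v i))) (\<rho> I)"
  shows "majorized W \<Theta> (\<lambda>\<theta> v. \<Sum>i<N. (\<integral>u. \<phi> (s \<theta> u) \<partial>D) - \<phi> (s \<theta> (v i)))
    ((\<Sum>I\<in>Pow {..<N}. \<rho> I) / 2 ^ N)"
proof -
  let ?d = "\<lambda>\<theta> v i. (\<integral>u. \<phi> (s \<theta> u) \<partial>D) - \<phi> (s \<theta> (v i))"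
  have "\<exists>r. (\<forall>I\<in>Pow {..<N}. majorized W \<Theta>
        (\<lambda>\<theta> v. (\<Sum>i<k. ?d \<theta> v i) + 2 * (\<Sum>i\<in>{k..<N}. sgn_of I i * s \<theta> (v i))) (r I)) \<and>
      (\<Sum>I\<in>Pow {..<N}. r I) = (\<Sum>I\<in>Pow {..<N}. \<rho> I)" if "k \<le> N" for k
    using that
  proof (induction k)
    case 0
    then show ?case using \<rho> by (intro exI[of _ \<rho>]) (auto simp: lessThan_atLeast0)
  next
    case (Suc k)
    then have k: "k < N" by simp
    from Suc obtain r where r: "\<And>I. I \<subseteq> {..<N} \<Longrightarrow> majorized W \<Theta>
        (\<lambda>\<theta> v. (\<Sum>i<k. ?d \<theta> v i) + 2 * (\<Sum>i\<in>{k..<N}. sgn_of I i * s \<theta> (v i))) (r I)"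
      "(\<Sum>I\<in>Pow {..<N}. r I) = (\<Sum>I\<in>Pow {..<N}. \<rho> I)"
      by auto
    define r' where "r' I = (r (insert k I) + r (I - {k})) / 2" for I
    have "majorized W \<Theta> (\<lambda>\<theta> v. (\<Sum>i<Suc k. ?d \<theta> v i) + 2 * (\<Sum>i\<in>{Suc k..<N}. sgn_of I i * s \<theta> (v i))) (r' I)"
      if I: "I \<subseteq> {..<N}" for I
    proof -
      let ?A = "\<lambda>\<theta> v. (\<Sum>i<k. ?d \<theta> v i) + 2 * (\<Sum>i\<in>{Suc k..<N}. sgn_of I i * s \<theta> (v i))"
      have split: "{k..<N} = insert k {Suc k..<N}" using k by auto
      have Ik: "insert k I \<subseteq> {..<N}" "I - {k} \<subseteq> {..<N}" using k I by auto
      have plus: "majorized W \<Theta> (\<lambda>\<theta> v. ?A \<theta> v + 2 * s \<theta> (v k)) (r (insert k I))"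
        using r(1)[OF Ik(1)] by (simp add: split sgn_of_def algebra_simps)
      have minus: "majorized W \<Theta> (\<lambda>\<theta> v. ?A \<theta> v - 2 * s \<theta> (v k)) (r (I - {k}))"
        using r(1)[OF Ik(2)] by (simp add: split sgn_of_def algebra_simps)
      have "?A \<theta> (v(k := u)) = ?A \<theta> v" for \<theta> v u
        by (auto intro!: arg_cong2[where f = "(+)"] sum.cong)
      then have "majorized W \<Theta> (\<lambda>\<theta> v. ?A \<theta> v + ?d \<theta> v k) ((r (insert k I) + r (I - {k})) / 2)"
        by (intro contraction_step[where A = ?A and s = s, OF k lip s _ plus minus])
      then show ?thesis by (simp add: r'_def algebra_simps)
    qed
    moreover have "(\<Sum>I\<in>Pow {..<N}. r' I) = (\<Sum>I\<in>Pow {..<N}. r I)"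
    proof -
      have e: "{..<N} = insert k ({..<N} - {k})" using k by auto
      have "k \<notin> {..<N} - {k}" "finite ({..<N} - {k})" by auto
      note S = sum_Pow_insert[OF this(2,1)]
      have "I - {k} = I" if "I \<in> Pow ({..<N} - {k})" for I using that by auto
      then have "(\<Sum>I\<in>Pow ({..<N} - {k}). r' I + r' (insert k I)) = (\<Sum>I\<in>Pow ({..<N} - {k}). r I + r (insert k I))"
        by (intro sum.cong) (auto simp: r'_def)
      then show ?thesis by (subst (1 2) e) (simp only: S)
    qed
    ultimately show ?case using r(2) by (intro exI[of _ r']) auto
  qed
  from this[OF order.refl] obtain r where
    r: "\<And>I. I \<subseteq> {..<N} \<Longrightarrow> majorized W \<Theta> (\<lambda>\<theta> v. \<Sum>i<N. ?d \<theta> v i) (r I)"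
       "(\<Sum>I\<in>Pow {..<N}. r I) = (\<Sum>I\<in>Pow {..<N}. \<rho> I)"
    by auto
  define R where "R = (\<Sum>I\<in>Pow {..<N}. \<rho> I) / 2 ^ N"
  \<comment> \<open>After \<open>N\<close> steps the family no longer depends on \<open>I\<close>,
    so any of the bounds applies; one of them is at most the average.\<close>
  have "\<exists>I\<in>Pow {..<N}. r I \<le> R"
  proof (rule ccontr)
    assume "\<not> ?thesis"
    then have "(\<Sum>I\<in>Pow {..<N}. R) < (\<Sum>I\<in>Pow {..<N}. r I)"
      by (intro sum_strict_mono) (auto simp: not_le)
    then show False by (simp add: r(2) R_def card_Pow)
  qed
  then obtain I where I: "I \<subseteq> {..<N}" "r I \<le> R" by auto
  show ?thesis unfolding R_def[symmetric]
    by (rule majorized_mono[OF r(1)[OF I(1)] I(2)]) auto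
qed

text \<open>Integrating out coordinate \<open>k\<close> removes the cross term with the partial sum,
  because \<open>g\<close> has mean zero.\<close>

lemma second_moment_sum:
  assumes g: "bounded_measurable D g" and "integral\<^sup>L D g = 0" and "k \<le> N"
  shows "(\<integral>v. (\<Sum>i<k. g (v i))\<^sup>2 \<partial>W) = k * (\<integral>u. (g u)\<^sup>2 \<partial>D)"
  using assms(3)
proof (induction k)
  case (Suc k)
  then have k: "k < N" by simp
  let ?S = "\<lambda>v. \<Sum>i<k. g (v i)"
  have sq: "bounded_measurable M (\<lambda>v. (f v)\<^sup>2)" if bf: "bounded_measurable M f" for M :: "'z measure" and f
  proof -
    obtain B where B: "0 \<le> B" "\<And>v. v \<in> space M \<Longrightarrow> \<bar>f v\<bar> \<le> B" using bounded_measurable_bound[OF bf] by blast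
    then have "(f v)\<^sup>2 \<le> B\<^sup>2" if "v \<in> space M" for v
      using that by (simp add: abs_le_square_iff[symmetric])
    then show ?thesis using bf by (intro bounded_measurableI[of _ _ "B\<^sup>2"]) (auto dest!: bounded_measurableD)
  qed
  have bS: "bounded_measurable W ?S"
    using k g by (intro bounded_measurable_sum bounded_measurable_component) auto
  have bS': "bounded_measurable W (\<lambda>v. (\<Sum>i<Suc k. g (v i)))"
    using k g by (intro bounded_measurable_sum bounded_measurable_component) auto
  have "(\<integral>v. (\<Sum>i<Suc k. g (v i))\<^sup>2 \<partial>W) = (\<integral>v. (\<integral>u. (?S v + g u)\<^sup>2 \<partial>D) \<partial>W)"
    by (subst integral_resample[OF k sq[OF bS'], symmetric]) simp
  also have "\<dots> = (\<integral>v. (?S v)\<^sup>2 + (\<integral>u. (g u)\<^sup>2 \<partial>D) \<partial>W)"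
  proof (rule Bochner_Integration.integral_cong[OF refl])
    fix v
    have "(\<integral>u. (?S v + g u)\<^sup>2 \<partial>D) = (\<integral>u. (?S v)\<^sup>2 + ((2 * ?S v) * g u + (g u)\<^sup>2) \<partial>D)"
      by (simp add: power2_eq_square algebra_simps)
    also have "\<dots> = (?S v)\<^sup>2 + ((2 * ?S v) * integral\<^sup>L D g + (\<integral>u. (g u)\<^sup>2 \<partial>D))"
      using integrable_bounded_measurable[OF g] integrable_bounded_measurable[OF sq[OF g]]
      by (simp add: prob_space)
    finally show "(\<integral>u. (?S v + g u)\<^sup>2 \<partial>D) = (?S v)\<^sup>2 + (\<integral>u. (g u)\<^sup>2 \<partial>D)"
      using assms(2) by simp
  qed
  also have "\<dots> = (\<integral>v. (?S v)\<^sup>2 \<partial>W) + (\<integral>u. (g u)\<^sup>2 \<partial>D)"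
    using W.integrable_bounded_measurable[OF sq[OF bS]] by (simp add: W.prob_space)
  finally show ?case using Suc by (simp add: algebra_simps)
qed simp

lemma expectation_abs_sum_le:
  assumes g: "bounded_measurable D g" and "integral\<^sup>L D g = 0"
  shows "(\<integral>v. \<bar>\<Sum>i<N. g (v i)\<bar> \<partial>W) \<le> sqrt (N * (\<integral>u. (g u)\<^sup>2 \<partial>D))"
proof (rule real_le_rsqrt)
  let ?S = "\<lambda>v. \<Sum>i<N. g (v i)"
  have bS: "bounded_measurable W ?S"
    using g by (intro bounded_measurable_sum bounded_measurable_component) auto
  obtain B where B: "0 \<le> B" "\<And>v. v \<in> space W \<Longrightarrow> \<bar>?S v\<bar> \<le> B" using bounded_measurable_bound[OF bS] by blast
  have i1: "integrable W (\<lambda>v. \<bar>?S v\<bar>)"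
    using bS by (intro integrable_abs W.integrable_bounded_measurable)
  have i2: "integrable W (\<lambda>v. \<bar>?S v\<bar>\<^sup>2)"
    using bS B by (intro W.integrable_const_bound[of _ "B\<^sup>2"] AE_I2)
      (auto simp: abs_le_square_iff[symmetric] dest!: bounded_measurableD)
  have "(\<integral>v. \<bar>?S v\<bar> \<partial>W)\<^sup>2 \<le> (\<integral>v. \<bar>?S v\<bar>\<^sup>2 \<partial>W)"
    using W.variance_eq[OF i1 i2] W.variance_positive[of "\<lambda>v. \<bar>?S v\<bar>"] by simp
  also have "\<dots> = N * (\<integral>u. (g u)\<^sup>2 \<partial>D)"
    using second_moment_sum[OF assms order.refl] by simp
  finally show "(\<integral>v. \<bar>?S v\<bar> \<partial>W)\<^sup>2 \<le> N * (\<integral>u. (g u)\<^sup>2 \<partial>D)" .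
qed

end

section \<open>McDiarmid's inequality\<close>

text \<open>Hoeffding's lemma asks for an interval, whereas the oscillation is bounded only almost
  everywhere. The left endpoint is the essential infimum, taken as the supremum of the almost sure
  lower bounds.\<close>

lemma (in prob_space) essentially_bounded_interval:
  fixes f :: "'a \<Rightarrow> real"
  assumes f: "bounded_measurable M f" and osc: "AE x in M. AE y in M. f x \<le> f y + c"
  shows "\<exists>a. AE x in M. f x \<in> {a..a + c}"
proof -
  have [measurable]: "f \<in> borel_measurable M" using f by (rule bounded_measurableD)
  obtain B where B: "0 \<le> B" "\<And>x. x \<in> space M \<Longrightarrow> \<bar>f x\<bar> \<le> B"
    using bounded_measurable_bound[OF f] by blast
  define L where "L = {t. AE x in M. t \<le> f x}"
  have ne: "L \<noteq> {}"
  proof -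
    have "- B \<le> f x" if "x \<in> space M" for x using B(2)[OF that] by linarith
    then have "AE x in M. - B \<le> f x" by (rule AE_I2)
    then show ?thesis by (auto simp: L_def)
  qed
  have ub: "t \<le> B" if "t \<in> L" for t
  proof -
    have "AE x in M. t \<le> f x" using that by (simp add: L_def)
    moreover have "AE x in M. \<bar>f x\<bar> \<le> B" using B(2) by (rule AE_I2)
    ultimately have "AE x in M. t \<le> B" by eventually_elim linarith
    then show ?thesis by simp
  qed
  define a where "a = Sup L"
  have bdd: "bdd_above L" using ub by (auto simp: bdd_above_def)
  have low: "AE x in M. t \<le> f x" if t: "t < a" for t
  proof -
    obtain t' where t': "t' \<in> L" "t < t'"
      using t unfolding a_def less_cSup_iff[OF ne bdd] by blast
    then have "AE x in M. t' \<le> f x" by (simp add: L_def)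
    then show ?thesis by eventually_elim (use t'(2) in linarith)
  qed
  have "AE x in M. \<forall>n::nat. a - 1 / Suc n \<le> f x"
    unfolding AE_all_countable by (intro allI low) simp
  then have lower: "AE x in M. a \<le> f x"
  proof eventually_elim
    case (elim x)
    show ?case
    proof (rule field_le_epsilon)
      fix e :: real assume "0 < e"
      then obtain n where "1 / Suc n < e" using nat_approx_posE by blast
      then show "a \<le> f x + e" using elim[rule_format, of n] by linarith
    qed
  qed
  have upper: "AE x in M. f x \<le> a + c"
    using osc
  proof eventually_elim
    case (elim x)
    then have "AE y in M. f x - c \<le> f y" by eventually_elim linarith
    then have "f x - c \<in> L" by (simp add: L_def)
    then have "f x - c \<le> a" unfolding a_def using bdd by (rule cSup_upper)
    then show ?case by simp
  qed
  show ?thesis using lower upper by (intro exI[of _ a]) auto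
qed

lemma bounded_measurable_exp:
  assumes "bounded_measurable M f"
  shows "bounded_measurable M (\<lambda>x. exp (f x))"
proof -
  obtain B where B: "0 \<le> B" "\<And>x. x \<in> space M \<Longrightarrow> \<bar>f x\<bar> \<le> B"
    using bounded_measurable_bound[OF assms] by blast
  show ?thesis
    using B(2) bounded_measurableD[OF assms]
    by (intro bounded_measurableI[of _ _ "exp B"]) (auto simp: abs_le_iff)
qed

lemma (in prob_space) exp_moment_le:
  fixes f :: "'a \<Rightarrow> real"
  assumes f: "bounded_measurable M f" and osc: "AE x in M. AE y in M. f x \<le> f y + c" and l: "0 < l"
  shows "(\<integral>x. exp (l * f x) \<partial>M) \<le> exp (l * integral\<^sup>L M f + l\<^sup>2 * c\<^sup>2 / 8)"
proof -
  obtain a where a: "AE x in M. f x \<in> {a..a + c}"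
    using essentially_bounded_interval[OF f osc] by blast
  interpret interval_bounded_random_variable M f a "a + c"
    by unfold_locales (fact bounded_measurableD[OF f], fact a)
  let ?\<mu> = "integral\<^sup>L M f"
  have b: "bounded_measurable M (\<lambda>x. exp (l * (f x - ?\<mu>)))"
    using f by (intro bounded_measurable_exp bounded_measurable_cmult bounded_measurable_diff) auto
  have "ennreal (\<integral>x. exp (l * (f x - ?\<mu>)) \<partial>M) = (\<integral>\<^sup>+x. exp (l * (f x - ?\<mu>)) \<partial>M)"
    using integrable_bounded_measurable[OF b] by (intro nn_integral_eq_integral[symmetric]) auto
  also have "\<dots> \<le> ennreal (exp (l\<^sup>2 * (a + c - a)\<^sup>2 / 8))"
    by (rule Hoeffdings_lemma_nn_integral[OF l])
  finally have *: "(\<integral>x. exp (l * (f x - ?\<mu>)) \<partial>M) \<le> exp (l\<^sup>2 * c\<^sup>2 / 8)"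
    by (simp add: ennreal_le_iff)
  have "(\<integral>x. exp (l * f x) \<partial>M) = (\<integral>x. exp (l * ?\<mu>) * exp (l * (f x - ?\<mu>)) \<partial>M)"
    by (simp add: exp_add[symmetric] algebra_simps)
  also have "\<dots> \<le> exp (l * ?\<mu>) * exp (l\<^sup>2 * c\<^sup>2 / 8)"
    using * by (simp add: mult_left_mono)
  finally show ?thesis by (simp add: exp_add)
qed

text \<open>Majorants whose integrals approach the infimum are merged into their pointwise infimum,
  again a majorant. Cutting it off by another majorant cannot lower the integral, hence changes it
  on a null set at most.\<close>

lemma (in prob_space) minimal_majorant:
  fixes f :: "'i \<Rightarrow> 'a \<Rightarrow> real"
  assumes "majorized M \<Theta> f r" and "\<Theta> \<noteq> {}"
    and bdd: "\<And>\<theta> v. \<theta> \<in> \<Theta> \<Longrightarrow> v \<in> space M \<Longrightarrow> \<bar>f \<theta> v\<bar> \<le> B"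
  shows "\<exists>g. bounded_measurable M g \<and> (\<forall>\<theta>\<in>\<Theta>. \<forall>v\<in>space M. f \<theta> v \<le> g v) \<and> integral\<^sup>L M g \<le> r \<and>
    (\<forall>h\<in>borel_measurable M. (\<forall>\<theta>\<in>\<Theta>. \<forall>v\<in>space M. f \<theta> v \<le> h v) \<longrightarrow> (AE v in M. g v \<le> h v))"
proof -
  obtain H where H: "bounded_measurable M H" "\<And>\<theta> v. \<theta> \<in> \<Theta> \<Longrightarrow> v \<in> space M \<Longrightarrow> f \<theta> v \<le> H v" "integral\<^sup>L M H \<le> r"
    using assms(1) unfolding majorized_def by blast
  obtain \<theta>\<^sub>0 where \<theta>\<^sub>0: "\<theta>\<^sub>0 \<in> \<Theta>" using assms(2) by blast
  \<comment> \<open>Competitors are kept below \<open>H\<close>, so that all of them are bounded;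
    the comparison with arbitrary majorants is recovered by taking minima.\<close>
  define \<H> where "\<H> = {h \<in> borel_measurable M. (\<forall>\<theta>\<in>\<Theta>. \<forall>v\<in>space M. f \<theta> v \<le> h v) \<and> (\<forall>v\<in>space M. h v \<le> H v)}"
  have lower: "- B \<le> h v" if "h \<in> \<H>" "v \<in> space M" for h v
  proof -
    have "f \<theta>\<^sub>0 v \<le> h v" using that \<theta>\<^sub>0 by (auto simp: \<H>_def)
    then show ?thesis using bdd[OF \<theta>\<^sub>0 that(2)] by linarith
  qed
  obtain C where C: "0 \<le> C" "\<And>v. v \<in> space M \<Longrightarrow> \<bar>H v\<bar> \<le> C"
    using bounded_measurable_bound[OF H(1)] by blast
  have bm: "bounded_measurable M h" if "h \<in> \<H>" for h
  proof (rule bounded_measurableI[of _ _ "max B C"])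
    fix v assume v: "v \<in> space M"
    have "h v \<le> H v" using that v by (auto simp: \<H>_def)
    then show "\<bar>h v\<bar> \<le> max B C" using lower[OF that v] C(2)[OF v] by linarith
  qed (use that in \<open>auto simp: \<H>_def\<close>)
  define \<alpha> where "\<alpha> = (INF h\<in>\<H>. integral\<^sup>L M h)"
  have "H \<in> \<H>" using H bounded_measurableD[OF H(1)] by (auto simp: \<H>_def)
  then have ne: "\<H> \<noteq> {}" by blast
  have "- B \<le> integral\<^sup>L M h" if "h \<in> \<H>" for h
  proof -
    have "(\<integral>v. - B \<partial>M) \<le> integral\<^sup>L M h"
      using lower[OF that] bm[OF that] by (intro integral_mono) auto
    then show ?thesis by (simp add: prob_space)
  qed
  then have bdd_int: "bdd_below (integral\<^sup>L M ` \<H>)" by (auto simp: bdd_below_def)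
  have "\<exists>h\<in>\<H>. integral\<^sup>L M h < \<alpha> + 1 / Suc n" for n
    using cINF_less_iff[OF ne bdd_int, of "\<alpha> + 1 / Suc n"] unfolding \<alpha>_def by simp
  then obtain hs where hs: "\<And>n. hs n \<in> \<H>" "\<And>n. integral\<^sup>L M (hs n) < \<alpha> + 1 / Suc n"
    by metis
  define g where "g v = (INF n. hs n v)" for v
  have bddn: "bdd_below (range (\<lambda>n. hs n v))" if "v \<in> space M" for v
    using lower[OF hs(1) that] by (auto simp: bdd_below_def)
  have g: "g \<in> \<H>"
    unfolding \<H>_def
  proof (intro CollectI conjI ballI)
    have "hs n \<in> borel_measurable M" for n using hs(1)[of n] by (simp add: \<H>_def)
    then show "g \<in> borel_measurable M"
      unfolding g_def by (intro borel_measurable_cINF_real) auto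
    show "f \<theta> v \<le> g v" if "\<theta> \<in> \<Theta>" "v \<in> space M" for \<theta> v
      unfolding g_def using that hs(1) by (intro cINF_greatest) (auto simp: \<H>_def)
    show "g v \<le> H v" if "v \<in> space M" for v
      using cINF_lower[OF bddn[OF that], of 0] hs(1)[of 0] that by (auto simp: g_def \<H>_def intro: order.trans)
  qed
  have g_int: "integral\<^sup>L M g \<le> \<alpha>"
  proof (rule field_le_epsilon)
    fix e :: real assume "0 < e"
    then obtain n where n: "1 / Suc n < e" using nat_approx_posE by blast
    have "integral\<^sup>L M g \<le> integral\<^sup>L M (hs n)"
      using bm[OF g] bm[OF hs(1)[of n]] bddn by (intro integral_mono) (auto simp: g_def intro!: cINF_lower)
    then show "integral\<^sup>L M g \<le> \<alpha> + e" using hs(2)[of n] n by linarith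
  qed
  have "AE v in M. g v \<le> h v" if h: "h \<in> borel_measurable M" "\<forall>\<theta>\<in>\<Theta>. \<forall>v\<in>space M. f \<theta> v \<le> h v" for h
  proof -
    define k where "k v = min (g v) (h v)" for v
    have k: "k \<in> \<H>" using g h unfolding \<H>_def k_def by (auto intro: borel_measurable_min)
    have "integral\<^sup>L M g \<le> integral\<^sup>L M k"
      using g_int cINF_lower[OF bdd_int k] unfolding \<alpha>_def by linarith
    moreover have i: "integrable M (\<lambda>v. g v - k v)"
      using bm[OF g] bm[OF k] by (intro integrable_bounded_measurable bounded_measurable_diff)
    moreover have "(\<integral>v. g v - k v \<partial>M) = integral\<^sup>L M g - integral\<^sup>L M k"
      using bm[OF g] bm[OF k] by (intro Bochner_Integration.integral_diff integrable_bounded_measurable)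
    moreover have nn: "AE v in M. 0 \<le> g v - k v" by (simp add: k_def)
    ultimately have "(\<integral>v. g v - k v \<partial>M) = 0"
      using integral_nonneg_AE[OF nn] by linarith
    then have "AE v in M. g v - k v = 0"
      using integral_nonneg_eq_0_iff_AE[OF i nn] by simp
    then show ?thesis by eventually_elim (simp add: k_def min_def split: if_splits)
  qed
  moreover have "integral\<^sup>L M g \<le> r"
    using g_int cINF_lower[OF bdd_int \<open>H \<in> \<H>\<close>] H(3) unfolding \<alpha>_def by linarith
  ultimately show ?thesis using g bm[OF g] by (intro exI[of _ g]) (auto simp: \<H>_def)
qed

context iid_product
begin

text \<open>Almost everywhere, since a minimal majorant is determined only up to null sets. One
  direction is enough: resampling coordinate \<open>i\<close> of \<open>v\<close> as well yields the
  oscillation bound that \<open>exp_moment_le\<close> takes.\<close>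

definition essential_bounded_difference :: "real \<Rightarrow> nat \<Rightarrow> ((nat \<Rightarrow> 'v) \<Rightarrow> real) \<Rightarrow> bool" where
  "essential_bounded_difference c i h \<longleftrightarrow> (AE v in W. AE u in D. h v \<le> h (v(i := u)) + c)"

text \<open>If \<open>g\<close> exceeded its resampled values by more than \<open>c\<close> too
  often, it could be lowered there and would still majorize every \<open>f \<theta>\<close>, against
  minimality. Rational thresholds keep the number of exceptional null sets countable.\<close>

lemma minimal_majorant_bounded_difference:
  assumes i: "i < N" and g: "bounded_measurable W g" and "\<Theta> \<noteq> {}"
    and maj: "\<And>\<theta> v. \<theta> \<in> \<Theta> \<Longrightarrow> v \<in> space W \<Longrightarrow> f \<theta> v \<le> g v"
    and diff: "\<And>\<theta> v u. \<theta> \<in> \<Theta> \<Longrightarrow> v \<in> space W \<Longrightarrow> u \<in> space D \<Longrightarrow> f \<theta> v \<le> f \<theta> (v(i := u)) + c"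
    and min: "\<And>h. h \<in> borel_measurable W \<Longrightarrow> (\<And>\<theta> v. \<theta> \<in> \<Theta> \<Longrightarrow> v \<in> space W \<Longrightarrow> f \<theta> v \<le> h v) \<Longrightarrow> AE v in W. g v \<le> h v"
  shows "essential_bounded_difference c i g"
proof -
  have [measurable]: "g \<in> borel_measurable W" using g by (rule bounded_measurableD)
  have gm: "(\<lambda>p. g ((fst p)(i := snd p))) \<in> borel_measurable (W \<Otimes>\<^sub>M D)"
    using bounded_measurable_upd_pair[OF i g] by (rule bounded_measurableD)
  have gs: "(\<lambda>u. g (v(i := u))) \<in> borel_measurable D" if "v \<in> space W" for v
    using bounded_measurable_upd_snd[OF i g that] by (rule bounded_measurableD)
  \<comment> \<open>On \<open>E q\<close> the resampled value of \<open>g\<close> is below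
    \<open>q\<close> with positive probability, hence for some \<open>u\<close>, and then f v \<le>
    f (v(i := u)) + c < q + c. The integral in the definition makes the set measurable.\<close>
  define E where "E q = {v \<in> space W. (\<integral>u. indicat_real {..<real_of_rat q} (g (v(i := u))) \<partial>D) > 0}" for q :: rat
  have bi: "bounded_measurable W (\<lambda>v. indicat_real {..<real_of_rat q} (g v))" for q
    by (rule bounded_measurableI[of _ _ 1]) (auto simp: indicator_def)
  have E [measurable]: "E q \<in> sets W" for q
  proof -
    have "(\<lambda>v. \<integral>u. indicat_real {..<real_of_rat q} (g (v(i := u))) \<partial>D) \<in> borel_measurable W"
      by (rule bounded_measurableD[OF bounded_measurable_resample[OF i bi]])
    then show ?thesis unfolding E_def by (intro borel_measurable_less borel_measurable_const)
  qed
  have notE: "AE u in D. real_of_rat q \<le> g (v(i := u))" if v: "v \<in> space W" "v \<notin> E q" for v q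
  proof -
    have b: "bounded_measurable D (\<lambda>u. indicat_real {..<real_of_rat q} (g (v(i := u))))"
      using bounded_measurable_upd_snd[OF i bi v(1)] .
    have "(\<integral>u. indicat_real {..<real_of_rat q} (g (v(i := u))) \<partial>D) = 0"
      using v by (auto simp: E_def intro!: antisym Bochner_Integration.integral_nonneg)
    then have "AE u in D. indicat_real {..<real_of_rat q} (g (v(i := u))) = (0 :: real)"
      using integral_nonneg_eq_0_iff_AE[OF integrable_bounded_measurable[OF b]] by simp
    then show ?thesis by eventually_elim (auto simp: indicator_def split: if_splits)
  qed
  have "AE v in W. v \<in> E q \<longrightarrow> g v \<le> real_of_rat q + c" for q
  proof -
    \<comment> \<open>The function on the right is \<open>g\<close> lowered on \<open>E q\<close>.
      It is still a majorant, so minimality bounds \<open>g\<close> by it.\<close>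
    have "AE v in W. g v \<le> (if v \<in> E q then min (g v) (real_of_rat q + c) else g v)"
    proof (rule min)
      show "(\<lambda>v. if v \<in> E q then min (g v) (real_of_rat q + c) else g v) \<in> borel_measurable W"
        by measurable
      fix \<theta> v assume \<theta>: "\<theta> \<in> \<Theta>" and v: "v \<in> space W"
      have "f \<theta> v \<le> real_of_rat q + c" if "v \<in> E q"
      proof -
        have "\<exists>u\<in>space D. g (v(i := u)) < real_of_rat q"
        proof (rule ccontr)
          assume "\<not> ?thesis"
          then have "(\<integral>u. indicat_real {..<real_of_rat q} (g (v(i := u))) \<partial>D) = (\<integral>u. 0 \<partial>D)"
            by (intro Bochner_Integration.integral_cong) auto
          then show False using that by (simp add: E_def)
        qed
        then obtain u where "u \<in> space D" "g (v(i := u)) < real_of_rat q" by blast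
        then show ?thesis
          using diff[OF \<theta> v, of u] maj[OF \<theta> upd_space[OF v _ i], of u] by linarith
      qed
      then show "f \<theta> v \<le> (if v \<in> E q then min (g v) (real_of_rat q + c) else g v)"
        using maj[OF \<theta> v] by simp
    qed
    then show ?thesis by eventually_elim (auto split: if_splits)
  qed
  then have "AE v in W. \<forall>q. v \<in> E q \<longrightarrow> g v \<le> real_of_rat q + c"
    by (simp add: AE_all_countable)
  with AE_space show ?thesis
    unfolding essential_bounded_difference_def
  proof eventually_elim
    case (elim v)
    then have v: "v \<in> space W" and *: "\<forall>q. v \<in> E q \<longrightarrow> g v \<le> real_of_rat q + c"
      by auto
    have "AE u in D. real_of_rat q + c < g v \<longrightarrow> real_of_rat q \<le> g (v(i := u))" for q
    proof (cases "real_of_rat q + c < g v")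
      case True
      then have "v \<notin> E q" using * by (auto simp: not_le[symmetric])
      then show ?thesis using notE[OF v] by simp
    qed simp
    then have "AE u in D. \<forall>q. real_of_rat q + c < g v \<longrightarrow> real_of_rat q \<le> g (v(i := u))"
      by (simp add: AE_all_countable)
    then show ?case
    proof eventually_elim
      case (elim u)
      show "g v \<le> g (v(i := u)) + c"
      proof (rule ccontr)
        assume "\<not> g v \<le> g (v(i := u)) + c"
        then have "g (v(i := u)) < g v - c" by simp
        then obtain q where "g (v(i := u)) < real_of_rat q" "real_of_rat q < g v - c"
          using of_rat_dense by blast
        then show False using elim[rule_format, of q] by linarith
      qed
    qed
  qed
qed

text \<open>The inequality is integrated over coordinate \<open>k\<close>. This needs the null set
  in \<open>k\<close> to be innermost, which Fubini for null sets provides.\<close>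

lemma essential_bounded_difference_resample:
  assumes i: "i < N" and k: "k < N" and "i \<noteq> k" and h: "bounded_measurable W h"
    and bd: "essential_bounded_difference c i h"
  shows "essential_bounded_difference c i (\<lambda>v. \<integral>x. h (v(k := x)) \<partial>D)"
proof -
  interpret DD: pair_prob_space D D ..
  have "AE v in W. AE x in D. AE u in D. h (v(k := x)) \<le> h (v(k := x, i := u)) + c"
    using AE_resample[OF k bd[unfolded essential_bounded_difference_def]] .
  with AE_space show ?thesis
    unfolding essential_bounded_difference_def
  proof eventually_elim
    case (elim v)
    then have v: "v \<in> space W" and *: "AE x in D. AE u in D. h (v(k := x)) \<le> h (v(k := x, i := u)) + c"
      by auto
    have "(\<lambda>p. v(k := fst p)) \<in> measurable (D \<Otimes>\<^sub>M D) W"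
      by (intro measurable_upd[OF k] measurable_fst measurable_const v)
    moreover from this have "(\<lambda>p. v(k := fst p, i := snd p)) \<in> measurable (D \<Otimes>\<^sub>M D) W"
      by (intro measurable_upd[OF i] measurable_snd)
    ultimately have m: "(\<lambda>p. h (v(k := fst p))) \<in> borel_measurable (D \<Otimes>\<^sub>M D)"
      "(\<lambda>p. h (v(k := fst p, i := snd p))) \<in> borel_measurable (D \<Otimes>\<^sub>M D)"
      using bounded_measurableD[OF h] by (auto intro: measurable_compose)
    have "{p \<in> space (D \<Otimes>\<^sub>M D). h (v(k := fst p)) \<le> h (v(k := fst p, i := snd p)) + c} \<in> sets (D \<Otimes>\<^sub>M D)"
      using m by measurable
    from iffD1[OF DD.AE_commute[where P = "\<lambda>x u. h (v(k := x)) \<le> h (v(k := x, i := u)) + c", OF this] *]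
    have "AE u in D. AE x in D. h (v(k := x)) \<le> h (v(k := x, i := u)) + c" .
    with AE_space show ?case
    proof eventually_elim
      case (elim u)
      then have u: "u \<in> space D" and **: "AE x in D. h (v(k := x)) \<le> h (v(k := x, i := u)) + c"
        by auto
      have b: "bounded_measurable D (\<lambda>x. h (v(k := x)))" "bounded_measurable D (\<lambda>x. h ((v(i := u))(k := x)))"
        using v u i by (auto intro!: bounded_measurable_upd_snd[OF k h] upd_space)
      have "(\<integral>x. h (v(k := x)) \<partial>D) \<le> (\<integral>x. h ((v(i := u))(k := x)) + c \<partial>D)"
        using ** \<open>i \<noteq> k\<close> b
        by (intro integral_mono_AE integrable_bounded_measurable bounded_measurable_add)
           (auto simp: fun_upd_twist[of i k])
      also have "\<dots> = (\<integral>x. h ((v(i := u))(k := x)) \<partial>D) + c"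
        using integrable_bounded_measurable[OF b(2)] by (simp add: prob_space)
      finally show "(\<integral>x. h (v(k := x)) \<partial>D) \<le> (\<integral>x. h ((v(i := u))(k := x)) \<partial>D) + c" .
    qed
  qed
qed

text \<open>Coordinates are integrated out one after another. Hoeffding's lemma in one coordinate
  costs a factor exp (l^2 c^2 / 8); after \<open>N\<close> steps the function is constant on the
  space and equals its mean.\<close>

lemma exp_moment_bounded_difference:
  assumes g: "bounded_measurable W g" and bd: "\<And>i. i < N \<Longrightarrow> essential_bounded_difference c i g" and l: "0 < l"
  shows "(\<integral>v. exp (l * g v) \<partial>W) \<le> exp (l * integral\<^sup>L W g + N * (l\<^sup>2 * c\<^sup>2 / 8))"
proof -
  have "\<exists>h. bounded_measurable W h \<and> (\<forall>i\<in>{k..<N}. essential_bounded_difference c i h) \<and>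
      (\<forall>i<k. \<forall>v\<in>space W. \<forall>u\<in>space D. h (v(i := u)) = h v) \<and> integral\<^sup>L W h = integral\<^sup>L W g \<and>
      (\<integral>v. exp (l * g v) \<partial>W) \<le> exp (k * (l\<^sup>2 * c\<^sup>2 / 8)) * (\<integral>v. exp (l * h v) \<partial>W)" if "k \<le> N" for k
    using that
  proof (induction k)
    case 0
    then show ?case using g bd by (intro exI[of _ g]) auto
  next
    case (Suc k)
    then have k: "k < N" by simp
    from Suc.IH[OF less_imp_le[OF k]] obtain h where h: "bounded_measurable W h"
      "\<forall>i\<in>{k..<N}. essential_bounded_difference c i h"
      "\<forall>i<k. \<forall>v\<in>space W. \<forall>u\<in>space D. h (v(i := u)) = h v" "integral\<^sup>L W h = integral\<^sup>L W g"
      "(\<integral>v. exp (l * g v) \<partial>W) \<le> exp (k * (l\<^sup>2 * c\<^sup>2 / 8)) * (\<integral>v. exp (l * h v) \<partial>W)"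
      by blast
    define h' where "h' v = (\<integral>x. h (v(k := x)) \<partial>D)" for v
    have h': "bounded_measurable W h'"
      unfolding h'_def by (rule bounded_measurable_resample[OF k h(1)])
    have e: "bounded_measurable W (\<lambda>v. exp (l * f v))" if "bounded_measurable W f" for f
      using that by (intro bounded_measurable_exp bounded_measurable_cmult)
    have "(\<integral>v. exp (l * h v) \<partial>W) = (\<integral>v. (\<integral>x. exp (l * h (v(k := x))) \<partial>D) \<partial>W)"
      using integral_resample[OF k e[OF h(1)]] by simp
    also have "\<dots> \<le> (\<integral>v. exp (l\<^sup>2 * c\<^sup>2 / 8) * exp (l * h' v) \<partial>W)"
    proof (rule integral_mono_AE)
      show "integrable W (\<lambda>v. \<integral>x. exp (l * h (v(k := x))) \<partial>D)"
        by (rule W.integrable_bounded_measurable[OF bounded_measurable_resample[OF k e[OF h(1)]]])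
      show "integrable W (\<lambda>v. exp (l\<^sup>2 * c\<^sup>2 / 8) * exp (l * h' v))"
        by (intro W.integrable_bounded_measurable bounded_measurable_cmult e h')
      have "AE v in W. AE x in D. AE u in D. h (v(k := x)) \<le> h (v(k := u)) + c"
        using AE_resample[OF k bspec[OF h(2), of k, unfolded essential_bounded_difference_def]] k by simp
      then show "AE v in W. (\<integral>x. exp (l * h (v(k := x))) \<partial>D) \<le> exp (l\<^sup>2 * c\<^sup>2 / 8) * exp (l * h' v)"
      proof (rule AE_mp, intro AE_I2 impI)
        fix v assume v: "v \<in> space W" and "AE x in D. AE u in D. h (v(k := x)) \<le> h (v(k := u)) + c"
        from exp_moment_le[OF bounded_measurable_upd_snd[OF k h(1) v] this(2) l]
        show "(\<integral>x. exp (l * h (v(k := x))) \<partial>D) \<le> exp (l\<^sup>2 * c\<^sup>2 / 8) * exp (l * h' v)"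
          by (simp add: h'_def exp_add mult.commute)
      qed
    qed
    also have "\<dots> = exp (l\<^sup>2 * c\<^sup>2 / 8) * (\<integral>v. exp (l * h' v) \<partial>W)" by simp
    finally have "exp (k * (l\<^sup>2 * c\<^sup>2 / 8)) * (\<integral>v. exp (l * h v) \<partial>W)
        \<le> exp (k * (l\<^sup>2 * c\<^sup>2 / 8)) * (exp (l\<^sup>2 * c\<^sup>2 / 8) * (\<integral>v. exp (l * h' v) \<partial>W))"
      by (rule mult_left_mono) simp
    also have "\<dots> = exp (Suc k * (l\<^sup>2 * c\<^sup>2 / 8)) * (\<integral>v. exp (l * h' v) \<partial>W)"
    proof -
      have "exp (Suc k * (l\<^sup>2 * c\<^sup>2 / 8)) = exp (k * (l\<^sup>2 * c\<^sup>2 / 8)) * exp (l\<^sup>2 * c\<^sup>2 / 8)"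
        unfolding exp_add[symmetric] by (simp add: field_simps)
      then show ?thesis by simp
    qed
    finally have mgf: "(\<integral>v. exp (l * g v) \<partial>W) \<le> exp (Suc k * (l\<^sup>2 * c\<^sup>2 / 8)) * (\<integral>v. exp (l * h' v) \<partial>W)"
      using h(5) by linarith
    have "essential_bounded_difference c i h'" if "i \<in> {Suc k..<N}" for i
      unfolding h'_def using that h(2) by (intro essential_bounded_difference_resample[OF _ k _ h(1)]) auto
    moreover have "h' (v(i := u)) = h' v" if "i < Suc k" "v \<in> space W" "u \<in> space D" for i v u
    proof (cases "i = k")
      case False
      then have i: "i < k" using that by simp
      have "(\<integral>x. h (v(i := u, k := x)) \<partial>D) = (\<integral>x. h (v(k := x)) \<partial>D)"
      proof (rule Bochner_Integration.integral_cong[OF refl])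
        fix x assume "x \<in> space D"
        then show "h (v(i := u, k := x)) = h (v(k := x))"
          using h(3)[rule_format, OF i upd_space[OF that(2) _ k] that(3), of x] False by (simp add: fun_upd_twist)
      qed
      then show ?thesis by (simp add: h'_def)
    qed (simp add: h'_def)
    moreover have "integral\<^sup>L W h' = integral\<^sup>L W g"
      unfolding h'_def integral_resample[OF k h(1)] by (rule h(4))
    ultimately show ?case
      by (intro exI[of _ h'] conjI ballI allI impI h' mgf)
  qed
  from this[OF order.refl] obtain h where h: "bounded_measurable W h"
    "\<forall>i<N. \<forall>v\<in>space W. \<forall>u\<in>space D. h (v(i := u)) = h v" "integral\<^sup>L W h = integral\<^sup>L W g"
    "(\<integral>v. exp (l * g v) \<partial>W) \<le> exp (N * (l\<^sup>2 * c\<^sup>2 / 8)) * (\<integral>v. exp (l * h v) \<partial>W)"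
    by (elim exE conjE) (rule that)
  have const: "h v = h w" if v: "v \<in> space W" and w: "w \<in> space W" for v w
  proof -
    \<comment> \<open>\<open>v\<close> is turned into \<open>w\<close> coordinate by coordinate. At
      \<open>m = N\<close> this is exactly \<open>w\<close>, because members of the product space
      agree outside \<open>{..<N}\<close>.\<close>
    have "(\<lambda>i. if i < m then w i else v i) \<in> space W \<and> h (\<lambda>i. if i < m then w i else v i) = h v" if "m \<le> N" for m
      using that
    proof (induction m)
      case (Suc m)
      have "(\<lambda>i. if i < Suc m then w i else v i) = (\<lambda>i. if i < m then w i else v i)(m := w m)"
        by (auto simp: fun_eq_iff less_Suc_eq)
      then show ?case
        using Suc h(2)[rule_format, of m _ "w m"] component_space[OF w, of m] upd_space[of _ "w m" m]
        by (simp del: fun_upd_apply)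
    qed (use v in simp)
    from this[of N] have "h (\<lambda>i. if i < N then w i else v i) = h v" by simp
    moreover have "(\<lambda>i. if i < N then w i else v i) = w"
      using v w by (auto simp: fun_eq_iff space_PiM PiE_iff extensional_def)
    ultimately show ?thesis by simp
  qed
  have hc: "h v = integral\<^sup>L W h" if v: "v \<in> space W" for v
  proof -
    have "integral\<^sup>L W h = (\<integral>w. h v \<partial>W)"
      using const[OF v] by (intro Bochner_Integration.integral_cong) auto
    then show ?thesis by (simp add: W.prob_space)
  qed
  have "(\<integral>v. exp (l * h v) \<partial>W) = (\<integral>v. exp (l * integral\<^sup>L W g) \<partial>W)"
  proof (rule Bochner_Integration.integral_cong[OF refl])
    fix v assume "v \<in> space W"
    from hc[OF this] show "exp (l * h v) = exp (l * integral\<^sup>L W g)" by (simp only: h(3))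
  qed
  then show ?thesis
    using h(4) by (simp add: W.prob_space exp_add mult.commute)
qed

text \<open>McDiarmid's inequality for the outer probability of a supremum that need not be measurable:
  a measurable majorant of minimal integral inherits the bounded differences almost everywhere.\<close>

theorem McDiarmid_majorized:
  fixes f :: "'i \<Rightarrow> (nat \<Rightarrow> 'v) \<Rightarrow> real" and c t :: real
  assumes maj: "majorized W \<Theta> f r" and ne: "\<Theta> \<noteq> {}" and "0 < N" "0 < c" "0 \<le> t"
    and bdd: "\<And>\<theta> v. \<theta> \<in> \<Theta> \<Longrightarrow> v \<in> space W \<Longrightarrow> \<bar>f \<theta> v\<bar> \<le> B"
    and diff: "\<And>\<theta> v i u. \<theta> \<in> \<Theta> \<Longrightarrow> v \<in> space W \<Longrightarrow> i < N \<Longrightarrow> u \<in> space D \<Longrightarrow> f \<theta> v \<le> f \<theta> (v(i := u)) + c"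
  shows "\<exists>A\<in>sets W. measure W A \<ge> 1 - exp (- 2 * t\<^sup>2 / (N * c\<^sup>2)) \<and> (\<forall>v\<in>A. \<forall>\<theta>\<in>\<Theta>. f \<theta> v \<le> r + t)"
proof (cases "t = 0")
  case True
  \<comment> \<open>The exponential is 1, so the empty event is admissible; the exponent
    \<open>l\<close> chosen below would be 0.\<close>
  then show ?thesis by (intro bexI[of _ "{}"]) auto
next
  case False
  with assms have t: "0 < t" by simp
  have "\<exists>g. bounded_measurable W g \<and> (\<forall>\<theta>\<in>\<Theta>. \<forall>v\<in>space W. f \<theta> v \<le> g v) \<and> integral\<^sup>L W g \<le> r \<and>
    (\<forall>h\<in>borel_measurable W. (\<forall>\<theta>\<in>\<Theta>. \<forall>v\<in>space W. f \<theta> v \<le> h v) \<longrightarrow> (AE v in W. g v \<le> h v))"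
    by (rule W.minimal_majorant[OF maj ne bdd])
  then obtain g where g: "bounded_measurable W g" "\<forall>\<theta>\<in>\<Theta>. \<forall>v\<in>space W. f \<theta> v \<le> g v" "integral\<^sup>L W g \<le> r"
    "\<forall>h\<in>borel_measurable W. (\<forall>\<theta>\<in>\<Theta>. \<forall>v\<in>space W. f \<theta> v \<le> h v) \<longrightarrow> (AE v in W. g v \<le> h v)"
    by (elim exE conjE) (rule that)
  have [measurable]: "g \<in> borel_measurable W" using g(1) by (rule bounded_measurableD)
  have bd: "essential_bounded_difference c i g" if "i < N" for i
  proof (rule minimal_majorant_bounded_difference[OF that g(1) ne g(2)[rule_format]])
    show "f \<theta> v \<le> f \<theta> (v(i := u)) + c" if "\<theta> \<in> \<Theta>" "v \<in> space W" "u \<in> space D" for \<theta> v u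
      using diff[OF that(1,2) \<open>i < N\<close> that(3)] .
    show "AE v in W. g v \<le> h v" if "h \<in> borel_measurable W" "\<And>\<theta> v. \<theta> \<in> \<Theta> \<Longrightarrow> v \<in> space W \<Longrightarrow> f \<theta> v \<le> h v" for h
      using bspec[OF g(4) that(1)] that(2) by blast
  qed
  \<comment> \<open>This value minimizes N l^2 c^2 / 8 - l t, with minimum -2 t^2 / (N c^2).\<close>
  define l where "l = 4 * t / (N * c\<^sup>2)"
  have l: "0 < l" using t \<open>0 < N\<close> \<open>0 < c\<close> by (simp add: l_def)
  have int: "integrable W (\<lambda>v. exp (l * g v))"
    by (intro W.integrable_bounded_measurable bounded_measurable_exp bounded_measurable_cmult g)
  have "measure W {v \<in> space W. g v > r + t} \<le> measure W {v \<in> space W. exp (l * g v) \<ge> exp (l * (r + t))}"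
    using l by (intro W.finite_measure_mono) auto
  also have "\<dots> \<le> (\<integral>v. exp (l * g v) \<partial>W) / exp (l * (r + t))"
    using int by (intro integral_Markov_inequality_measure[where A = "{}"]) auto
  also have "\<dots> \<le> exp (l * integral\<^sup>L W g + N * (l\<^sup>2 * c\<^sup>2 / 8)) / exp (l * (r + t))"
    using exp_moment_bounded_difference[OF g(1) bd l] by (intro divide_right_mono) auto
  also have "\<dots> = exp (l * integral\<^sup>L W g + N * (l\<^sup>2 * c\<^sup>2 / 8) - l * (r + t))"
    by (simp add: exp_diff)
  also have "\<dots> \<le> exp (N * (l\<^sup>2 * c\<^sup>2 / 8) - l * t)"
    using mult_left_mono[OF g(3), of l] l by (simp add: algebra_simps)
  also have "N * (l\<^sup>2 * c\<^sup>2 / 8) - l * t = - 2 * t\<^sup>2 / (N * c\<^sup>2)"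
    using \<open>0 < N\<close> \<open>0 < c\<close> by (simp add: l_def field_simps power2_eq_square)
  finally have p: "measure W {v \<in> space W. g v > r + t} \<le> exp (- 2 * t\<^sup>2 / (N * c\<^sup>2))" .
  have "measure W (space W - {v \<in> space W. g v > r + t}) = 1 - measure W {v \<in> space W. g v > r + t}"
    by (rule W.prob_compl) measurable
  moreover have "f \<theta> v \<le> r + t" if "v \<in> space W - {v \<in> space W. g v > r + t}" "\<theta> \<in> \<Theta>" for v \<theta>
    using g(2)[rule_format, of \<theta> v] that by auto
  ultimately show ?thesis
    using p by (intro bexI[of _ "space W - {v \<in> space W. g v > r + t}"]) auto
qed

end

section \<open>Uniform deviations of chains\<close>

text \<open>Suprema need not be attained, so near-maximizers are selected, one for each
  \<open>j\<close>, with total error at most \<open>e\<close>. This leads from bounds for every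
  selection, as in \<open>sum_chain_le_walk_max\<close>, to bounds for suprema.\<close>

lemma sum_SUP_le:
  fixes f :: "'j \<Rightarrow> 't \<Rightarrow> real"
  assumes "finite J" "T \<noteq> {}" and bdd: "\<And>j. j \<in> J \<Longrightarrow> bdd_above (f j ` T)"
    and sel: "\<And>g. (\<And>j. j \<in> J \<Longrightarrow> g j \<in> T) \<Longrightarrow> (\<Sum>j\<in>J. f j (g j)) \<le> C"
  shows "(\<Sum>j\<in>J. SUP \<tau>\<in>T. f j \<tau>) \<le> C"
proof (rule field_le_epsilon)
  fix e :: real assume e: "0 < e"
  define d where "d = e / (card J + 1)"
  have d: "0 < d" using e by (simp add: d_def)
  have "\<exists>\<tau>\<in>T. (SUP \<tau>\<in>T. f j \<tau>) - d < f j \<tau>" if "j \<in> J" for j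
    using less_cSUP_iff[OF assms(2) bdd[OF that], of "(SUP \<tau>\<in>T. f j \<tau>) - d"] d by simp
  then obtain g where g: "\<And>j. j \<in> J \<Longrightarrow> g j \<in> T" "\<And>j. j \<in> J \<Longrightarrow> (SUP \<tau>\<in>T. f j \<tau>) - d < f j (g j)"
    by metis
  have "(\<Sum>j\<in>J. SUP \<tau>\<in>T. f j \<tau>) \<le> (\<Sum>j\<in>J. f j (g j) + d)"
    using g(2) by (intro sum_mono) (simp add: less_eq_real_def algebra_simps)
  also have "\<dots> = (\<Sum>j\<in>J. f j (g j)) + card J * d" by (simp add: sum.distrib)
  also have "\<dots> \<le> C + e"
  proof (rule add_mono)
    show "card J * d \<le> e" using e by (simp add: d_def field_simps)
  qed (rule sel[OF g(1)])
  finally show "(\<Sum>j\<in>J. SUP \<tau>\<in>T. f j \<tau>) \<le> C + e" .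
qed

lemma bounded_measurable_SUP:
  fixes f :: "'t \<Rightarrow> 'a \<Rightarrow> real"
  assumes "countable T" "T \<noteq> {}" and m: "\<And>\<tau>. \<tau> \<in> T \<Longrightarrow> f \<tau> \<in> borel_measurable M"
    and b: "\<And>\<tau> v. \<tau> \<in> T \<Longrightarrow> v \<in> space M \<Longrightarrow> \<bar>f \<tau> v\<bar> \<le> B"
  shows "bounded_measurable M (\<lambda>v. SUP \<tau>\<in>T. f \<tau> v)"
    and "\<And>\<tau> v. \<tau> \<in> T \<Longrightarrow> v \<in> space M \<Longrightarrow> f \<tau> v \<le> (SUP \<tau>\<in>T. f \<tau> v)"
    and "\<And>v. v \<in> space M \<Longrightarrow> bdd_above ((\<lambda>\<tau>. f \<tau> v) ` T)"
proof -
  show bdd: "bdd_above ((\<lambda>\<tau>. f \<tau> v) ` T)" if "v \<in> space M" for v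
    using b[OF _ that] by (intro bdd_aboveI2[of _ _ B]) (auto simp: abs_le_iff)
  show le: "f \<tau> v \<le> (SUP \<tau>\<in>T. f \<tau> v)" if "\<tau> \<in> T" "v \<in> space M" for \<tau> v
    using bdd[OF that(2)] that(1) by (rule cSUP_upper2[OF _ _ order.refl])
  obtain \<tau>\<^sub>0 where \<tau>\<^sub>0: "\<tau>\<^sub>0 \<in> T" using assms(2) by blast
  show "bounded_measurable M (\<lambda>v. SUP \<tau>\<in>T. f \<tau> v)"
  proof (rule bounded_measurableI[of _ _ B])
    show "(\<lambda>v. SUP \<tau>\<in>T. f \<tau> v) \<in> borel_measurable M"
      by (rule borel_measurable_cSUP[OF assms(1) m bdd])
    fix v assume v: "v \<in> space M"
    have "(SUP \<tau>\<in>T. f \<tau> v) \<le> B"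
      using b[OF _ v] assms(2) by (intro cSUP_least) (auto simp: abs_le_iff)
    then show "\<bar>SUP \<tau>\<in>T. f \<tau> v\<bar> \<le> B"
      using le[OF \<tau>\<^sub>0 v] b[OF \<tau>\<^sub>0 v] by linarith
  qed
qed

lemma exists_bij_betw_image:
  assumes "finite X" "I \<subseteq> X" "I' \<subseteq> X" "card I = card I'"
  shows "\<exists>p. bij_betw p X X \<and> (\<forall>i\<in>X. p i \<in> I' \<longleftrightarrow> i \<in> I)"
proof -
  have fin: "finite I" "finite I'" "finite (X - I)" "finite (X - I')"
    using assms finite_subset by auto
  have "card (X - I) = card (X - I')"
    using assms fin by (simp add: card_Diff_subset)
  then obtain f g where fg: "bij_betw f I I'" "bij_betw g (X - I) (X - I')"
    using finite_same_card_bij fin assms(4) by metis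
  let ?p = "\<lambda>i. if i \<in> I then f i else g i"
  have "bij_betw ?p I I'" "bij_betw ?p (X - I) (X - I')"
    using fg by (auto simp: bij_betw_def inj_on_def)
  then have "bij_betw ?p (I \<union> (X - I)) (I' \<union> (X - I'))"
    by (rule bij_betw_combine) auto
  moreover have "I \<union> (X - I) = X" "I' \<union> (X - I') = X" using assms by auto
  moreover have "f i \<in> I'" if "i \<in> I" for i using fg(1) that by (auto simp: bij_betw_def)
  moreover have "g i \<notin> I'" if "i \<in> X - I" for i using fg(2) that by (auto simp: bij_betw_def)
  ultimately show ?thesis by (intro exI[of _ ?p]) auto
qed

section \<open>Signed sums over the sample and their exchangeability\<close>

context iid_product
begin

lemma signed_sum_bound:
  fixes a :: "'v \<Rightarrow> real" and b :: real
  assumes "v \<in> space W" "\<And>u. u \<in> space D \<Longrightarrow> \<bar>a u\<bar> \<le> b"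
  shows "\<bar>\<Sum>i<N. sgn_of I i * a (v i)\<bar> \<le> N * b"
proof -
  have "\<bar>\<Sum>i<N. sgn_of I i * a (v i)\<bar> \<le> (\<Sum>i<N. b)"
    using assms component_space[OF assms(1)]
    by (intro order.trans[OF sum_abs] sum_mono) (simp add: sgn_of_def abs_mult)
  then show ?thesis by simp
qed

lemma measurable_signed_sum:
  fixes a :: "'v \<Rightarrow> real"
  assumes "a \<in> borel_measurable D"
  shows "(\<lambda>v. \<Sum>i<N. sgn_of I i * a (v i)) \<in> borel_measurable W"
  using assms by (intro borel_measurable_sum borel_measurable_times borel_measurable_const
      measurable_compose[OF measurable_component_singleton]) auto

text \<open>A permutation of the coordinates preserves the product law and can carry
  \<open>I\<close> to any set of the same size. Hence the average over balanced patterns is the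
  value for a single one.\<close>

lemma integral_signed_SUP_cong_card:
  fixes a :: "'t \<Rightarrow> 'v \<Rightarrow> real"
  assumes "I \<subseteq> {..<N}" "I' \<subseteq> {..<N}" "card I = card I'"
    and meas: "(\<lambda>v. SUP \<tau>\<in>T. \<Sum>i<N. sgn_of I i * a \<tau> (v i)) \<in> borel_measurable W"
  shows "(\<integral>v. (SUP \<tau>\<in>T. \<Sum>i<N. sgn_of I i * a \<tau> (v i)) \<partial>W)
    = (\<integral>v. (SUP \<tau>\<in>T. \<Sum>i<N. sgn_of I' i * a \<tau> (v i)) \<partial>W)"
proof -
  obtain p where p: "bij_betw p {..<N} {..<N}" "\<And>i. i < N \<Longrightarrow> p i \<in> I' \<longleftrightarrow> i \<in> I"
    using exists_bij_betw_image[OF _ assms(1-3)] by auto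
  have pN: "p i < N" if "i < N" for i using p(1) that by (auto simp: bij_betw_def)
  let ?r = "\<lambda>v. \<lambda>n\<in>{..<N}. v (p n)"
  have r: "?r \<in> measurable W W"
    using pN by (intro measurable_restrict measurable_component_singleton) auto
  have "distr W W ?r = W"
    using distr_PiM_reindex[of "{..<N}" "\<lambda>_. D" p "{..<N}"] prob_space_axioms p(1) pN
    by (auto simp: bij_betw_def)
  then have "(\<integral>v. (SUP \<tau>\<in>T. \<Sum>i<N. sgn_of I i * a \<tau> (v i)) \<partial>W)
      = (\<integral>v. (SUP \<tau>\<in>T. \<Sum>i<N. sgn_of I i * a \<tau> (?r v i)) \<partial>W)"
    using integral_distr[OF r meas] by simp
  also have "(\<lambda>v. SUP \<tau>\<in>T. \<Sum>i<N. sgn_of I i * a \<tau> (?r v i)) = (\<lambda>v. SUP \<tau>\<in>T. \<Sum>i<N. sgn_of I' i * a \<tau> (v i))"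
  proof (intro ext arg_cong[where f = Sup] image_cong refl)
    fix v \<tau>
    have "(\<Sum>i<N. sgn_of I i * a \<tau> (?r v i)) = (\<Sum>i<N. sgn_of I' (p i) * a \<tau> (v (p i)))"
      using p(2) by (intro sum.cong) (auto simp: sgn_of_def)
    also have "\<dots> = (\<Sum>i<N. sgn_of I' i * a \<tau> (v i))"
      by (rule sum.reindex_bij_betw[OF p(1)])
    finally show "(\<Sum>i<N. sgn_of I i * a \<tau> (?r v i)) = (\<Sum>i<N. sgn_of I' i * a \<tau> (v i))" .
  qed
  finally show ?thesis .
qed

end

text \<open>Comparability of any two members is asked instead of monotonicity in an ordered index.
  Increasing, decreasing and reflected families, and families with an adjoined zero, are then all
  instances.\<close>

locale chain_class = iid_product D N for D :: "'v measure" and N +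
  fixes T :: "'t set" and a :: "'t \<Rightarrow> 'v \<Rightarrow> real" and b :: real
  assumes countable_T: "countable T" and T_nonempty: "T \<noteq> {}" and b_nonneg: "0 \<le> b"
    and measurable_a: "\<And>\<tau>. \<tau> \<in> T \<Longrightarrow> a \<tau> \<in> borel_measurable D"
    and range_a: "\<And>\<tau> u. \<tau> \<in> T \<Longrightarrow> u \<in> space D \<Longrightarrow> a \<tau> u \<in> {0..b}"
    and chain_a: "\<And>\<tau> \<tau>'. \<tau> \<in> T \<Longrightarrow> \<tau>' \<in> T \<Longrightarrow>
      (\<forall>u\<in>space D. a \<tau> u \<le> a \<tau>' u) \<or> (\<forall>u\<in>space D. a \<tau>' u \<le> a \<tau> u)"
begin

definition signed_SUP :: "nat set \<Rightarrow> (nat \<Rightarrow> 'v) \<Rightarrow> real" where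
  "signed_SUP I v = (SUP \<tau>\<in>T. \<Sum>i<N. sgn_of I i * a \<tau> (v i))"

lemma chain_signed_sum_bound:
  assumes "\<tau> \<in> T" "v \<in> space W"
  shows "\<bar>\<Sum>i<N. sgn_of I i * a \<tau> (v i)\<bar> \<le> N * b"
  using range_a[OF assms(1)] by (intro signed_sum_bound[OF assms(2)]) auto

lemma bounded_measurable_a: "\<tau> \<in> T \<Longrightarrow> bounded_measurable D (a \<tau>)"
  using range_a measurable_a by (intro bounded_measurableI[of _ _ b]) auto

lemma signed_SUP:
  shows "bounded_measurable W (signed_SUP I)"
    and "\<And>\<tau> v. \<tau> \<in> T \<Longrightarrow> v \<in> space W \<Longrightarrow> (\<Sum>i<N. sgn_of I i * a \<tau> (v i)) \<le> signed_SUP I v"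
    and "\<And>v. v \<in> space W \<Longrightarrow> bdd_above ((\<lambda>\<tau>. \<Sum>i<N. sgn_of I i * a \<tau> (v i)) ` T)"
proof -
  have m: "(\<lambda>v. \<Sum>i<N. sgn_of I i * a \<tau> (v i)) \<in> borel_measurable W" if "\<tau> \<in> T" for \<tau>
    using that by (intro measurable_signed_sum measurable_a)
  note S = bounded_measurable_SUP[where B = "N * b", OF countable_T T_nonempty m chain_signed_sum_bound]
  show "bounded_measurable W (signed_SUP I)"
    unfolding signed_SUP_def[abs_def] by (rule S(1))
  show "(\<Sum>i<N. sgn_of I i * a \<tau> (v i)) \<le> signed_SUP I v" if "\<tau> \<in> T" "v \<in> space W" for \<tau> v
    unfolding signed_SUP_def by (rule S(2)) (use that in simp_all)
  show "bdd_above ((\<lambda>\<tau>. \<Sum>i<N. sgn_of I i * a \<tau> (v i)) ` T)" if "v \<in> space W" for v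
    by (rule S(3)) (use that in simp_all)
qed

text \<open>An estimate for each fixed sample, before any integration. It is used for the full cube
  of signs and for the balanced patterns.\<close>

lemma sum_signed_SUP_le:
  assumes v: "v \<in> space W" and "finite J"
    and walk: "\<And>xs. distinct xs \<Longrightarrow> set xs = {..<N} \<Longrightarrow> (\<Sum>I\<in>J. real_of_int (walk_max (map (sgn_of I) xs))) \<le> C"
  shows "(\<Sum>I\<in>J. signed_SUP I v) \<le> b * C"
  unfolding signed_SUP_def
proof (rule sum_SUP_le[OF assms(2) T_nonempty signed_SUP(3)[OF v]])
  fix g :: "nat set \<Rightarrow> 't" assume g: "\<And>I. I \<in> J \<Longrightarrow> g I \<in> T"
  show "(\<Sum>I\<in>J. \<Sum>i<N. sgn_of I i * a (g I) (v i)) \<le> b * C"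
  proof (rule sum_chain_le_walk_max[where a = "\<lambda>\<tau> i. a \<tau> (v i)"])
    fix I I' assume "I \<in> J" "I' \<in> J"
    then show "(\<forall>i\<in>{..<N}. a (g I) (v i) \<le> a (g I') (v i)) \<or> (\<forall>i\<in>{..<N}. a (g I') (v i) \<le> a (g I) (v i))"
      using chain_a[OF g g, of I I'] component_space[OF v] by blast
  qed (use assms g range_a component_space[OF v] b_nonneg in \<open>auto simp del: atLeastAtMost_iff\<close>)
qed

lemma sum_integral_signed_SUP_le:
  "(\<Sum>I\<in>Pow {..<N}. integral\<^sup>L W (signed_SUP I)) \<le> 2 ^ N * (b * sqrt N)"
proof -
  have "(\<Sum>I\<in>Pow {..<N}. integral\<^sup>L W (signed_SUP I)) = (\<integral>v. (\<Sum>I\<in>Pow {..<N}. signed_SUP I v) \<partial>W)"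
    using signed_SUP(1) by (intro Bochner_Integration.integral_sum[symmetric] W.integrable_bounded_measurable) auto
  also have "\<dots> \<le> (\<integral>v. b * (2 ^ N * sqrt N) \<partial>W)"
  proof (rule integral_mono)
    show "integrable W (\<lambda>v. \<Sum>I\<in>Pow {..<N}. signed_SUP I v)"
      using signed_SUP(1) by (intro Bochner_Integration.integrable_sum W.integrable_bounded_measurable) auto
    fix v assume v: "v \<in> space W"
    show "(\<Sum>I\<in>Pow {..<N}. signed_SUP I v) \<le> b * (2 ^ N * sqrt N)"
    proof (rule sum_signed_SUP_le[OF v])
      fix xs :: "nat list" assume xs: "distinct xs" "set xs = {..<N}"
      then have "length xs = N" using distinct_card[OF xs(1)] by simp
      then show "(\<Sum>I\<in>Pow {..<N}. real_of_int (walk_max (map (sgn_of I) xs))) \<le> 2 ^ N * sqrt N"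
        using sum_walk_max_le[OF xs(1)] xs(2) by simp
    qed simp
  qed simp
  finally show ?thesis by (simp add: W.prob_space mult_ac)
qed

lemma integral_balanced_signed_SUP_le:
  assumes "N = 2 * n" "n \<ge> 1" "I \<subseteq> {..<N}" "card I = n"
  shows "integral\<^sup>L W (signed_SUP I) \<le> 11 / 12 * b * sqrt n"
proof -
  let ?J = "{I. I \<subseteq> {..<N} \<and> card I = n}" and ?c = "real (N choose n)"
  have J: "finite ?J" "card ?J = N choose n" using n_subsets[of "{..<N}" n] by simp_all
  have m: "(\<lambda>v. SUP \<tau>\<in>T. \<Sum>i<N. sgn_of I i * a \<tau> (v i)) \<in> borel_measurable W"
    using bounded_measurableD[OF signed_SUP(1)[of I]] by (simp add: signed_SUP_def[abs_def])
  have "?c * integral\<^sup>L W (signed_SUP I) = (\<Sum>I'\<in>?J. integral\<^sup>L W (signed_SUP I))"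
    using J by simp
  also have "\<dots> = (\<Sum>I'\<in>?J. integral\<^sup>L W (signed_SUP I'))"
  proof (rule sum.cong[OF refl])
    fix I' assume "I' \<in> ?J"
    then show "integral\<^sup>L W (signed_SUP I) = integral\<^sup>L W (signed_SUP I')"
      unfolding signed_SUP_def using assms(3,4)
      by (intro integral_signed_SUP_cong_card[OF _ _ _ m]) simp_all
  qed
  also have "\<dots> = (\<integral>v. (\<Sum>I'\<in>?J. signed_SUP I' v) \<partial>W)"
    using signed_SUP(1) by (intro Bochner_Integration.integral_sum[symmetric] W.integrable_bounded_measurable) auto
  also have "\<dots> \<le> (\<integral>v. b * (11 / 12 * sqrt n * ?c) \<partial>W)"
  proof (rule integral_mono)
    show "integrable W (\<lambda>v. \<Sum>I\<in>?J. signed_SUP I v)"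
      using signed_SUP(1) by (intro Bochner_Integration.integrable_sum W.integrable_bounded_measurable) auto
    fix v assume v: "v \<in> space W"
    show "(\<Sum>I\<in>?J. signed_SUP I v) \<le> b * (11 / 12 * sqrt n * ?c)"
    proof (rule sum_signed_SUP_le[OF v J(1)])
      fix xs :: "nat list" assume xs: "distinct xs" "set xs = {..<N}"
      then have "length xs = 2 * n" using distinct_card[OF xs(1)] assms(1) by simp
      then show "(\<Sum>I\<in>?J. real_of_int (walk_max (map (sgn_of I) xs))) \<le> 11 / 12 * sqrt n * ?c"
        using sum_balanced_walk_max_le[OF xs(1) _ assms(2)] xs(2) assms(1) by simp
    qed
  qed simp
  also have "\<dots> = ?c * (11 / 12 * b * sqrt n)" by (simp add: W.prob_space mult_ac)
  finally have "?c * integral\<^sup>L W (signed_SUP I) \<le> ?c * (11 / 12 * b * sqrt n)" .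
  moreover have "0 < ?c" using assms(1) by simp
  ultimately show ?thesis by (rule mult_left_le_imp_le)
qed

text \<open>Averaging over all balanced sign patterns of the pooled sample of size \<open>2 * N\<close>, instead of
  over independent signs, gives a constant below 1.\<close>

lemma chain_deviation_aux:
  assumes "N \<ge> 1"
  shows "majorized W T (\<lambda>\<tau> v. \<Sum>i<N. (\<integral>u. a \<tau> u \<partial>D) - a \<tau> (v i)) (11 / 12 * b * sqrt N)"
proof -
  interpret P: chain_class D "2 * N" T a b
    by unfold_locales (fact countable_T T_nonempty b_nonneg measurable_a range_a chain_a)+
  \<comment> \<open>The second half of the pooled sample is a ghost sample. With plus signs exactly
    there, the signed sum is the ghost sum minus the sample sum.\<close>
  let ?J = "{N..<2 * N}"
  let ?WJ = "PiM ?J (\<lambda>_. D)"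
  interpret WJ: prob_space ?WJ
    by (rule prob_space_PiM) (rule prob_space_axioms)
  interpret PP: product_prob_space "\<lambda>_ :: nat. D" ?J ..
  interpret WWJ: pair_prob_space W ?WJ ..
  have un: "{..<N} \<union> ?J = {..<2 * N}" by auto
  \<comment> \<open>Only the ghost sample is averaged out. The average of a supremum dominates the
    average of each member, and averaging the ghost sum turns it into \<open>N\<close> times the
    mean.\<close>
  define H where "H x = (\<integral>y. P.signed_SUP ?J (merge {..<N} ?J (x, y)) \<partial>?WJ)" for x
  have mg: "merge {..<N} ?J \<in> measurable (W \<Otimes>\<^sub>M ?WJ) P.W"
    using measurable_merge[of "{..<N}" ?J "\<lambda>_. D"] unfolding un .
  have bG: "bounded_measurable (W \<Otimes>\<^sub>M ?WJ) (\<lambda>p. P.signed_SUP ?J (merge {..<N} ?J p))"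
    by (rule bounded_measurable_comp[OF P.signed_SUP(1) mg])
  obtain B where B: "0 \<le> B" "\<And>p. p \<in> space (W \<Otimes>\<^sub>M ?WJ) \<Longrightarrow> \<bar>P.signed_SUP ?J (merge {..<N} ?J p)\<bar> \<le> B"
    using bounded_measurable_bound[OF bG] by blast
  have bGx: "bounded_measurable ?WJ (\<lambda>y. P.signed_SUP ?J (merge {..<N} ?J (x, y)))" if "x \<in> space W" for x
    using that by (intro bounded_measurable_comp[OF bG] measurable_Pair1')
  show ?thesis
  proof (rule majorizedI[of _ H])
    show "bounded_measurable W H"
    proof (rule bounded_measurableI[of _ _ B])
      show "H \<in> borel_measurable W"
        unfolding H_def using bounded_measurableD[OF bG]
        by (intro WJ.borel_measurable_lebesgue_integral) (simp add: case_prod_beta')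
      fix x assume x: "x \<in> space W"
      have "\<bar>H x\<bar> \<le> (\<integral>y. \<bar>P.signed_SUP ?J (merge {..<N} ?J (x, y))\<bar> \<partial>?WJ)"
        unfolding H_def by (rule integral_abs_bound)
      also have "\<dots> \<le> (\<integral>y. B \<partial>?WJ)"
        using B(2) x WJ.integrable_bounded_measurable[OF bGx[OF x]]
        by (intro integral_mono integrable_abs) (auto simp: space_pair_measure)
      finally show "\<bar>H x\<bar> \<le> B" by (simp add: WJ.prob_space)
    qed
    have "integral\<^sup>L W H = integral\<^sup>L P.W (P.signed_SUP ?J)"
      unfolding H_def un[symmetric]
      by (subst PS.product_integral_fold) (auto simp: un intro: P.W.integrable_bounded_measurable P.signed_SUP(1))
    also have "\<dots> \<le> 11 / 12 * b * sqrt N"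
      using assms by (intro P.integral_balanced_signed_SUP_le) auto
    finally show "integral\<^sup>L W H \<le> 11 / 12 * b * sqrt N" .
    fix \<tau> x assume \<tau>: "\<tau> \<in> T" and x: "x \<in> space W"
    have comp: "bounded_measurable ?WJ (\<lambda>y. a \<tau> (y i))" if "i \<in> ?J" for i
      using that by (intro bounded_measurable_comp[OF bounded_measurable_a[OF \<tau>]]) auto
    have "(\<integral>y. a \<tau> (y i) \<partial>?WJ) = (\<integral>u. a \<tau> u \<partial>D)" if "i \<in> ?J" for i
      using integral_distr[of "\<lambda>y. y i" ?WJ D "a \<tau>"] PP.PiM_component[OF that] measurable_a[OF \<tau>] that by simp
    then have "(\<integral>y. (\<Sum>i\<in>?J. a \<tau> (y i)) \<partial>?WJ) = N * (\<integral>u. a \<tau> u \<partial>D)"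
      using comp by (subst Bochner_Integration.integral_sum) (auto intro: WJ.integrable_bounded_measurable)
    moreover have "integrable ?WJ (\<lambda>y. \<Sum>i\<in>?J. a \<tau> (y i))"
      using comp by (intro Bochner_Integration.integrable_sum WJ.integrable_bounded_measurable)
    ultimately have "(\<Sum>i<N. (\<integral>u. a \<tau> u \<partial>D) - a \<tau> (x i))
        = (\<integral>y. (\<Sum>i\<in>?J. a \<tau> (y i)) - (\<Sum>i<N. a \<tau> (x i)) \<partial>?WJ)"
      by (simp add: sum_subtractf WJ.prob_space)
    also have "\<dots> \<le> H x"
      unfolding H_def
    proof (rule integral_mono)
      show "integrable ?WJ (\<lambda>y. (\<Sum>i\<in>?J. a \<tau> (y i)) - (\<Sum>i<N. a \<tau> (x i)))"
        using comp by (intro WJ.integrable_bounded_measurable bounded_measurable_diff bounded_measurable_sum) auto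
      show "integrable ?WJ (\<lambda>y. P.signed_SUP ?J (merge {..<N} ?J (x, y)))"
        by (rule WJ.integrable_bounded_measurable[OF bGx[OF x]])
      fix y assume y: "y \<in> space ?WJ"
      let ?m = "merge {..<N} ?J (x, y)"
      have "?m \<in> space P.W"
        using measurable_space[OF mg, of "(x, y)"] x y by (simp add: space_pair_measure)
      then have "(\<Sum>i<2 * N. sgn_of ?J i * a \<tau> (?m i)) \<le> P.signed_SUP ?J ?m"
        by (rule P.signed_SUP(2)[OF \<tau>])
      moreover have "(\<Sum>i<2 * N. sgn_of ?J i * a \<tau> (?m i)) = (\<Sum>i\<in>?J. a \<tau> (y i)) - (\<Sum>i<N. a \<tau> (x i))"
        unfolding un[symmetric] by (subst sum.union_disjoint) (auto simp: sgn_of_def merge_def sum_negf)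
      ultimately show "(\<Sum>i\<in>?J. a \<tau> (y i)) - (\<Sum>i<N. a \<tau> (x i)) \<le> P.signed_SUP ?J ?m" by simp
    qed
    finally show "(\<Sum>i<N. (\<integral>u. a \<tau> u \<partial>D) - a \<tau> (x i)) \<le> H x" .
  qed
qed

text \<open>The zero function lies below every member, so adjoining it as index \<open>None\<close>
  keeps a chain. Its deviation is 0, which gives the positive part at no extra cost.\<close>

lemma chain_deviation:
  assumes "N \<ge> 1"
  shows "majorized W T (\<lambda>\<tau> v. max 0 (\<Sum>i<N. (\<integral>u. a \<tau> u \<partial>D) - a \<tau> (v i))) (11 / 12 * b * sqrt N)"
proof -
  define a' where "a' = case_option (\<lambda>_. 0) a"
  interpret O: chain_class D N "insert None (Some ` T)" a' b
  proof unfold_locales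
    fix \<tau> \<tau>' assume "\<tau> \<in> insert None (Some ` T)" "\<tau>' \<in> insert None (Some ` T)"
    then consider "\<tau> = None" | "\<tau>' = None" | t t' where "\<tau> = Some t" "\<tau>' = Some t'" "t \<in> T" "t' \<in> T"
      by blast
    then show "(\<forall>u\<in>space D. a' \<tau> u \<le> a' \<tau>' u) \<or> (\<forall>u\<in>space D. a' \<tau>' u \<le> a' \<tau> u)"
    proof cases
      case 3
      then show ?thesis using chain_a[of t t'] by (simp add: a'_def)
    qed (use range_a \<open>\<tau> \<in> _\<close> \<open>\<tau>' \<in> _\<close> in \<open>auto simp: a'_def\<close>)
  qed (use countable_T b_nonneg measurable_a range_a in \<open>auto simp: a'_def\<close>)
  show ?thesis
  proof (rule majorized_mono[OF O.chain_deviation_aux[OF assms] order.refl])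
    fix \<tau> v assume \<tau>: "\<tau> \<in> T"
    show "\<exists>\<theta>'\<in>insert None (Some ` T). max 0 (\<Sum>i<N. (\<integral>u. a \<tau> u \<partial>D) - a \<tau> (v i))
        \<le> (\<Sum>i<N. (\<integral>u. a' \<theta>' u \<partial>D) - a' \<theta>' (v i))"
    proof (cases "0 \<le> (\<Sum>i<N. (\<integral>u. a \<tau> u \<partial>D) - a \<tau> (v i))")
      case True
      then show ?thesis using \<tau> by (intro bexI[of _ "Some \<tau>"]) (simp_all add: a'_def)
    next
      case False
      then show ?thesis by (intro bexI[of _ None]) (simp_all add: a'_def)
    qed
  qed
qed

text \<open>Passing from \<open>a\<close> to \<open>b - a\<close> reverses the chain, keeps the
  range and changes the sign of every deviation. Positive and negative parts cost 11/12
  each.\<close>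

lemma chain_deviation_abs:
  assumes "N \<ge> 1"
  shows "majorized W T (\<lambda>\<tau> v. \<bar>\<Sum>i<N. (\<integral>u. a \<tau> u \<partial>D) - a \<tau> (v i)\<bar>) (11 / 6 * b * sqrt N)"
proof -
  interpret R: chain_class D N T "\<lambda>\<tau> u. b - a \<tau> u" b
  proof unfold_locales
    fix \<tau> \<tau>' assume "\<tau> \<in> T" "\<tau>' \<in> T"
    from chain_a[OF this] show "(\<forall>u\<in>space D. b - a \<tau> u \<le> b - a \<tau>' u) \<or> (\<forall>u\<in>space D. b - a \<tau>' u \<le> b - a \<tau> u)"
      by auto
  qed (use countable_T T_nonempty b_nonneg measurable_a range_a in auto)
  have eq: "(\<integral>u. b - a \<tau> u \<partial>D) = b - (\<integral>u. a \<tau> u \<partial>D)" if "\<tau> \<in> T" for \<tau>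
    using integrable_bounded_measurable[OF bounded_measurable_a[OF that]] by (simp add: prob_space)
  show ?thesis
  proof (rule majorized_mono[OF W.majorized_add[OF chain_deviation[OF assms] R.chain_deviation[OF assms]]])
    fix \<tau> v assume \<tau>: "\<tau> \<in> T"
    have "\<bar>\<Sum>i<N. (\<integral>u. a \<tau> u \<partial>D) - a \<tau> (v i)\<bar>
        \<le> max 0 (\<Sum>i<N. (\<integral>u. a \<tau> u \<partial>D) - a \<tau> (v i)) + max 0 (\<Sum>i<N. (\<integral>u. b - a \<tau> u \<partial>D) - (b - a \<tau> (v i)))"
      by (simp add: eq[OF \<tau>] sum_subtractf max_def)
    then show "\<exists>\<theta>'\<in>T \<times> T. \<bar>\<Sum>i<N. (\<integral>u. a \<tau> u \<partial>D) - a \<tau> (v i)\<bar> \<le> (case \<theta>' of (\<theta>, \<theta>') \<Rightarrow> \<lambda>v.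
        max 0 (\<Sum>i<N. (\<integral>u. a \<theta> u \<partial>D) - a \<theta> (v i)) + max 0 (\<Sum>i<N. (\<integral>u. b - a \<theta>' u \<partial>D) - (b - a \<theta>' (v i)))) v"
      using \<tau> by (intro bexI[of _ "(\<tau>, \<tau>)"]) auto
  qed simp
qed

end

section \<open>Uniform deviations and Rademacher complexity\<close>

lemma sum_compl_Pow:
  assumes "finite X"
  shows "(\<Sum>I\<in>Pow X. f (X - I)) = (\<Sum>I\<in>Pow X. f I)"
  by (rule sum.reindex_bij_witness[of _ "\<lambda>I. X - I" "\<lambda>I. X - I"]) auto

text \<open>Turns the expectation over signs in R(F) into a finite average, to be matched with sums
  over sign patterns.\<close>

lemma PiM_uniform_count_measure:
  fixes B :: "real set"
  assumes "finite B" "B \<noteq> {}" "finite I"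
  shows "PiM I (\<lambda>_. uniform_count_measure B) = uniform_count_measure (I \<rightarrow>\<^sub>E B)"
proof -
  interpret U: prob_space "uniform_count_measure B"
    using assms by (intro prob_space_uniform_count_measure)
  interpret PU: product_sigma_finite "\<lambda>_. uniform_count_measure B"
    by (rule product_sigma_finite.intro) unfold_locales
  have fin: "finite (I \<rightarrow>\<^sub>E B)" using assms by (intro finite_PiE)
  have "uniform_count_measure (I \<rightarrow>\<^sub>E B) = PiM I (\<lambda>_. uniform_count_measure B)"
  proof (rule PU.PiM_eqI[OF assms(3)])
    have "sets (PiM I (\<lambda>_. uniform_count_measure B)) = sets (PiM I (\<lambda>_. count_space B))"
      by (intro sets_PiM_cong) (simp_all add: sets_uniform_count_measure)
    also have "\<dots> = sets (count_space (I \<rightarrow>\<^sub>E B))"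
      using assms by (subst count_space_PiM_finite) (auto intro: countable_finite)
    finally show "sets (uniform_count_measure (I \<rightarrow>\<^sub>E B)) = sets (PiM I (\<lambda>_. uniform_count_measure B))"
      by (simp add: sets_uniform_count_measure)
    fix A assume "\<And>i. i \<in> I \<Longrightarrow> A i \<in> sets (uniform_count_measure B)"
    then have A: "A i \<subseteq> B" if "i \<in> I" for i using that by (simp add: sets_uniform_count_measure)
    have "emeasure (uniform_count_measure (I \<rightarrow>\<^sub>E B)) (Pi\<^sub>E I A) = ennreal (card (Pi\<^sub>E I A) / card (I \<rightarrow>\<^sub>E B))"
      using fin A by (intro emeasure_uniform_count_measure PiE_mono)
    also have "card (Pi\<^sub>E I A) / card (I \<rightarrow>\<^sub>E B) = (\<Prod>i\<in>I. card (A i) / card B)"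
      using assms(3) by (simp add: card_PiE prod_dividef)
    also have "ennreal \<dots> = (\<Prod>i\<in>I. ennreal (card (A i) / card B))"
      by (rule prod_ennreal[symmetric]) simp
    also have "\<dots> = (\<Prod>i\<in>I. emeasure (uniform_count_measure B) (A i))"
      using assms(1) A by (intro prod.cong) (simp_all add: emeasure_uniform_count_measure)
    finally show "emeasure (uniform_count_measure (I \<rightarrow>\<^sub>E B)) (Pi\<^sub>E I A) = \<dots>" .
  qed
  then show ?thesis by (rule sym)
qed

lemma sum_signs_eq_sum_Pow:
  assumes "finite X"
  shows "(\<Sum>\<sigma>\<in>X \<rightarrow>\<^sub>E {-1, 1 :: real}. g \<sigma>) = (\<Sum>I\<in>Pow X. g (\<lambda>i\<in>X. of_int (sgn_of I i)))"
proof (rule sum.reindex_bij_witness[of _ "\<lambda>I. \<lambda>i\<in>X. of_int (sgn_of I i)" "\<lambda>\<sigma>. {i \<in> X. \<sigma> i = 1}"])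
  fix \<sigma> assume \<sigma>: "\<sigma> \<in> X \<rightarrow>\<^sub>E {-1, 1 :: real}"
  show "(\<lambda>i\<in>X. of_int (sgn_of {i \<in> X. \<sigma> i = 1} i)) = \<sigma>"
  proof
    fix i
    show "(\<lambda>i\<in>X. of_int (sgn_of {i \<in> X. \<sigma> i = 1} i)) i = \<sigma> i"
      using PiE_mem[OF \<sigma>, of i] PiE_arb[OF \<sigma>, of i] by (cases "i \<in> X") (auto simp: sgn_of_def)
  qed
  then show "g (\<lambda>i\<in>X. of_int (sgn_of {i \<in> X. \<sigma> i = 1} i)) = g \<sigma>" by simp
qed (auto simp: sgn_of_def)

locale rademacher_class = iid_product D N for D :: "'v measure" and N +
  fixes F :: "('v \<Rightarrow> real) set" and b :: real
  assumes N_pos: "0 < N" and F_nonempty: "F \<noteq> {}" and b_nonneg: "0 \<le> b"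
    and measurable_F: "\<And>\<mu>. \<mu> \<in> F \<Longrightarrow> \<mu> \<in> borel_measurable D"
    and range_F: "\<And>\<mu> u. \<mu> \<in> F \<Longrightarrow> u \<in> space D \<Longrightarrow> \<mu> u \<in> {0..b}"
    and integrable_sup: "integrable (rademacher_space N D) (rademacher_sup N F)"
begin

lemma bounded_measurable_F: "\<mu> \<in> F \<Longrightarrow> bounded_measurable D \<mu>"
  using range_F measurable_F by (intro bounded_measurableI[of _ _ b]) auto

definition signed_sup :: "nat set \<Rightarrow> (nat \<Rightarrow> 'v) \<Rightarrow> real" where
  "signed_sup I v = rademacher_sup N F (v, \<lambda>i\<in>{..<N}. of_int (sgn_of I i))"

lemma signed_sup_eq: "signed_sup I v = (SUP \<mu>\<in>F. (1 / N) * (\<Sum>i<N. sgn_of I i * \<mu> (v i)))"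
  by (simp add: signed_sup_def rademacher_sup_def)

lemma average_bound:
  fixes \<mu> :: "'v \<Rightarrow> real"
  assumes "\<mu> \<in> F" "v \<in> space W"
  shows "\<bar>(1 / N) * (\<Sum>i<N. sgn_of I i * \<mu> (v i))\<bar> \<le> b"
proof -
  have "\<bar>\<Sum>i<N. sgn_of I i * \<mu> (v i)\<bar> \<le> N * b"
    using range_F[OF assms(1)] by (intro signed_sum_bound[OF assms(2)]) auto
  then show ?thesis using N_pos by (simp add: abs_mult field_simps)
qed

lemma signed_sum_le:
  fixes \<mu> :: "'v \<Rightarrow> real"
  assumes "\<mu> \<in> F" "v \<in> space W"
  shows "(\<Sum>i<N. sgn_of I i * \<mu> (v i)) \<le> N * signed_sup I v"
proof -
  have "(1 / N) * (\<Sum>i<N. sgn_of I i * \<nu> (v i)) \<le> b" if "\<nu> \<in> F" for \<nu> :: "'v \<Rightarrow> real"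
    using average_bound[OF that assms(2), of I] by linarith
  then have "bdd_above ((\<lambda>\<mu>. (1 / N) * (\<Sum>i<N. sgn_of I i * \<mu> (v i))) ` F)"
    by (rule bdd_aboveI2)
  then have "(1 / N) * (\<Sum>i<N. sgn_of I i * \<mu> (v i)) \<le> signed_sup I v"
    unfolding signed_sup_eq using assms(1) by (rule cSUP_upper2[OF _ _ order.refl])
  then show ?thesis using N_pos by (simp add: field_simps)
qed

text \<open>Integrability of \<open>rademacher_sup\<close> includes measurability on the product
  space, and \<open>signed_sup I\<close> is its section at one sign vector. Thus a measurable
  supremum is available even if \<open>F\<close> is uncountable.\<close>

lemma bounded_measurable_signed_sup: "bounded_measurable W (signed_sup I)"
proof (rule bounded_measurableI[of _ _ b])
  have "(\<lambda>i\<in>{..<N}. of_int (sgn_of I i)) \<in> space (PiM {..<N} (\<lambda>_. uniform_count_measure {-1, 1 :: real}))"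
    by (auto simp: space_PiM space_uniform_count_measure sgn_of_def)
  then have "(\<lambda>v. (v, \<lambda>i\<in>{..<N}. of_int (sgn_of I i))) \<in> measurable W (rademacher_space N D)"
    unfolding rademacher_space_def by (rule measurable_Pair2')
  then show "signed_sup I \<in> borel_measurable W"
    unfolding signed_sup_def[abs_def] using borel_measurable_integrable[OF integrable_sup]
    by (rule measurable_compose)
  obtain \<mu>\<^sub>0 where \<mu>\<^sub>0: "\<mu>\<^sub>0 \<in> F" using F_nonempty by blast
  fix v assume v: "v \<in> space W"
  have "(1 / N) * (\<Sum>i<N. sgn_of I i * \<mu> (v i)) \<le> b" if "\<mu> \<in> F" for \<mu> :: "'v \<Rightarrow> real"
    using average_bound[OF that v, of I] by linarith
  then have "signed_sup I v \<le> b"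
    unfolding signed_sup_eq by (rule cSUP_least[OF F_nonempty])
  moreover have "- b \<le> signed_sup I v"
  proof -
    have "(1 / N) * (\<Sum>i<N. sgn_of I i * \<mu>\<^sub>0 (v i)) \<le> signed_sup I v"
      using signed_sum_le[OF \<mu>\<^sub>0 v, of I] N_pos by (simp add: field_simps)
    then show ?thesis using average_bound[OF \<mu>\<^sub>0 v, of I] by linarith
  qed
  ultimately show "\<bar>signed_sup I v\<bar> \<le> b" by simp
qed

lemma sum_integral_signed_sup:
  "(\<Sum>I\<in>Pow {..<N}. integral\<^sup>L W (signed_sup I)) = 2 ^ N * rademacher_complexity N D F"
proof -
  let ?U = "PiM {..<N} (\<lambda>_. uniform_count_measure {-1, 1 :: real})"
  interpret U: prob_space ?U
    by (intro prob_space_PiM prob_space_uniform_count_measure) auto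
  interpret WU: pair_prob_space W ?U ..
  have U: "(\<integral>\<sigma>. g \<sigma> \<partial>?U) = (\<Sum>I\<in>Pow {..<N}. g (\<lambda>i\<in>{..<N}. of_int (sgn_of I i))) / 2 ^ N" for g :: "(nat \<Rightarrow> real) \<Rightarrow> real"
  proof -
    have "card {-1, 1 :: real} = 2" by simp
    then have "card ({..<N} \<rightarrow>\<^sub>E {-1, 1 :: real}) = 2 ^ N" by (simp only: card_PiE finite_lessThan prod_constant card_lessThan)
    then show ?thesis
      by (simp add: PiM_uniform_count_measure integral_uniform_count_measure finite_PiE sum_signs_eq_sum_Pow)
  qed
  have "rademacher_complexity N D F = (\<integral>v. (\<integral>\<sigma>. rademacher_sup N F (v, \<sigma>) \<partial>?U) \<partial>W)"
    unfolding rademacher_complexity_def using integrable_sup unfolding rademacher_space_def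
    by (rule WU.integral_fst'[symmetric])
  also have "\<dots> = (\<integral>v. (\<Sum>I\<in>Pow {..<N}. signed_sup I v) / 2 ^ N \<partial>W)"
    by (simp add: U signed_sup_def)
  also have "\<dots> = (\<Sum>I\<in>Pow {..<N}. integral\<^sup>L W (signed_sup I)) / 2 ^ N"
    using W.integrable_bounded_measurable[OF bounded_measurable_signed_sup]
    by (simp add: Bochner_Integration.integral_sum)
  finally show ?thesis by simp
qed

text \<open>Contraction with a linear function is plain symmetrization. The sign sits in the
  contracting function, so both directions are bounded by the same R(F).\<close>

lemma deviation_F:
  assumes c: "c = 1 \<or> c = - 1"
  shows "majorized W F (\<lambda>\<mu> v. c * (\<Sum>i<N. (\<integral>u. \<mu> u \<partial>D) - \<mu> (v i))) (2 * N * rademacher_complexity N D F)"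
proof -
  have "majorized W F (\<lambda>\<mu> v. \<Sum>i<N. (\<integral>u. c * \<mu> u \<partial>D) - c * \<mu> (v i))
      ((\<Sum>I\<in>Pow {..<N}. 2 * N * integral\<^sup>L W (signed_sup I)) / 2 ^ N)"
  proof (rule symmetrization_contraction[where s = "\<lambda>\<mu>. \<mu>" and \<phi> = "\<lambda>t. c * t"])
    show "\<bar>c * s - c * t\<bar> \<le> \<bar>s - t\<bar>" for s t using c by auto
    show "majorized W F (\<lambda>\<mu> v. 2 * (\<Sum>i<N. sgn_of I i * \<mu> (v i))) (2 * N * integral\<^sup>L W (signed_sup I))" for I
    proof (rule majorizedI[of _ "\<lambda>v. (2 * N) * signed_sup I v"])
      show "2 * (\<Sum>i<N. sgn_of I i * \<mu> (v i)) \<le> (2 * N) * signed_sup I v" if "\<mu> \<in> F" "v \<in> space W" for \<mu> :: "'v \<Rightarrow> real" and v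
        using signed_sum_le[OF that, of I] by simp
    qed (auto intro: bounded_measurable_signed_sup)
  qed (fact bounded_measurable_F)
  then show ?thesis
    by (simp add: sum_distrib_left[symmetric] sum_integral_signed_sup right_diff_distrib[symmetric] mult.assoc)
qed

text \<open>The centred sum of one fixed hypothesis has mean zero and is dominated by a function of
  integral at most 2 N R(F).\<close>

lemma rademacher_complexity_nonneg: "0 \<le> rademacher_complexity N D F"
proof -
  obtain \<mu>\<^sub>0 where \<mu>\<^sub>0: "\<mu>\<^sub>0 \<in> F" using F_nonempty by blast
  note b0 = bounded_measurable_F[OF \<mu>\<^sub>0]
  let ?f = "\<lambda>v. 1 * (\<Sum>i<N. (\<integral>u. \<mu>\<^sub>0 u \<partial>D) - \<mu>\<^sub>0 (v i))"
  have comp: "(\<integral>v. \<mu>\<^sub>0 (v i) \<partial>W) = (\<integral>u. \<mu>\<^sub>0 u \<partial>D)" if "i < N" for i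
    using integral_resample[OF that bounded_measurable_component[OF that b0]] by (simp add: W.prob_space)
  have bc: "bounded_measurable W (\<lambda>v. (\<integral>u. \<mu>\<^sub>0 u \<partial>D) - \<mu>\<^sub>0 (v i))" if "i < N" for i
    using that by (intro bounded_measurable_diff bounded_measurable_const bounded_measurable_component b0)
  have "integral\<^sup>L W ?f \<le> 2 * N * rademacher_complexity N D F"
    using bc by (intro W.integral_le_of_majorized[OF deviation_F \<mu>\<^sub>0] bounded_measurable_cmult bounded_measurable_sum) auto
  moreover have "integral\<^sup>L W ?f = (\<Sum>i<N. \<integral>v. (\<integral>u. \<mu>\<^sub>0 u \<partial>D) - \<mu>\<^sub>0 (v i) \<partial>W)"
    using bc by (simp add: Bochner_Integration.integral_sum W.integrable_bounded_measurable)
  moreover have "(\<integral>v. (\<integral>u. \<mu>\<^sub>0 u \<partial>D) - \<mu>\<^sub>0 (v i) \<partial>W) = 0" if "i < N" for i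
    using comp[OF that] W.integrable_bounded_measurable[OF bounded_measurable_component[OF that b0]]
    by (simp add: W.prob_space)
  ultimately show ?thesis using N_pos by (simp add: zero_le_mult_iff)
qed

text \<open>R(F) has no absolute value inside, so a modulus cannot be symmetrized directly. The
  deviation of a reference hypothesis \<open>\<mu>\<^sub>0\<close> is split off, and the difference
  to it is at most the sum of the two one-sided suprema.\<close>

lemma deviation_F_abs:
  "majorized W F (\<lambda>\<mu> v. \<bar>\<Sum>i<N. (\<integral>u. \<mu> u \<partial>D) - \<mu> (v i)\<bar>)
     (4 * N * rademacher_complexity N D F + b / 2 * sqrt N)"
proof -
  let ?d = "\<lambda>\<mu> v. \<Sum>i<N. (\<integral>u. \<mu> u \<partial>D) - \<mu> (v i)"
  obtain \<mu>\<^sub>0 where \<mu>\<^sub>0: "\<mu>\<^sub>0 \<in> F" using F_nonempty by blast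
  note b0 = bounded_measurable_F[OF \<mu>\<^sub>0]
  define p where "p = (\<integral>u. \<mu>\<^sub>0 u \<partial>D)"
  have bg: "bounded_measurable D (\<lambda>u. p - \<mu>\<^sub>0 u)" using b0 by auto
  have g0: "(\<integral>u. p - \<mu>\<^sub>0 u \<partial>D) = 0"
    using integrable_bounded_measurable[OF b0] by (simp add: p_def prob_space)
  \<comment> \<open>Variance of a variable with values in \<open>[0, b]\<close>: its square is at
    most \<open>b\<close> times itself, so the variance is at most p (b - p) \<le> b^2 / 4.\<close>
  have "(\<integral>u. (p - \<mu>\<^sub>0 u)\<^sup>2 \<partial>D) \<le> (\<integral>u. (b - 2 * p) * \<mu>\<^sub>0 u + p\<^sup>2 \<partial>D)"
  proof (rule integral_mono)
    show "integrable D (\<lambda>u. (p - \<mu>\<^sub>0 u)\<^sup>2)"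
    proof -
      obtain B where B: "0 \<le> B" "\<forall>u\<in>space D. \<bar>p - \<mu>\<^sub>0 u\<bar> \<le> B"
        using bounded_measurable_bound[OF bg] by blast
      then have "(p - \<mu>\<^sub>0 u)\<^sup>2 \<le> B\<^sup>2" if "u \<in> space D" for u
        using that by (simp add: abs_le_square_iff[symmetric])
      then show ?thesis
        using measurable_F[OF \<mu>\<^sub>0] by (intro integrable_const_bound[of _ "B\<^sup>2"] AE_I2) auto
    qed
    show "integrable D (\<lambda>u. (b - 2 * p) * \<mu>\<^sub>0 u + p\<^sup>2)"
      using integrable_bounded_measurable[OF b0] by simp
    fix u assume "u \<in> space D"
    then have "\<mu>\<^sub>0 u * \<mu>\<^sub>0 u \<le> b * \<mu>\<^sub>0 u"
      using range_F[OF \<mu>\<^sub>0] by (intro mult_right_mono) auto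
    then show "(p - \<mu>\<^sub>0 u)\<^sup>2 \<le> (b - 2 * p) * \<mu>\<^sub>0 u + p\<^sup>2"
      by (simp add: power2_eq_square algebra_simps)
  qed
  also have "\<dots> = (b - 2 * p) * p + p\<^sup>2"
    using integrable_bounded_measurable[OF b0] by (simp add: prob_space p_def)
  also have "\<dots> \<le> (b / 2)\<^sup>2"
    using zero_le_power2[of "p - b / 2"] by (simp add: power2_eq_square algebra_simps)
  finally have "sqrt (N * (\<integral>u. (p - \<mu>\<^sub>0 u)\<^sup>2 \<partial>D)) \<le> sqrt (N * (b / 2)\<^sup>2)"
    by (intro real_sqrt_le_mono mult_left_mono) auto
  also have "\<dots> = b / 2 * sqrt N" using b_nonneg by (simp add: real_sqrt_mult)
  finally have e: "(\<integral>v. \<bar>?d \<mu>\<^sub>0 v\<bar> \<partial>W) \<le> b / 2 * sqrt N"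
    using expectation_abs_sum_le[OF bg g0] by (simp add: p_def)
  have bd: "bounded_measurable W (?d \<mu>\<^sub>0)"
    using b0 by (intro bounded_measurable_sum bounded_measurable_diff bounded_measurable_const bounded_measurable_component) auto
  have m0: "majorized W {()} (\<lambda>_ v. \<bar>?d \<mu>\<^sub>0 v\<bar>) (b / 2 * sqrt N)"
    using e by (intro majorizedI[of _ "\<lambda>v. \<bar>?d \<mu>\<^sub>0 v\<bar>"] bounded_measurable_lipschitz_comp[OF bd]) auto
  have m1: "majorized W F ?d (2 * N * rademacher_complexity N D F)"
    using deviation_F[of 1] by simp
  have m2: "majorized W F (\<lambda>\<mu> v. - ?d \<mu> v) (2 * N * rademacher_complexity N D F)"
    using deviation_F[of "- 1"] by simp
  show ?thesis
  proof (rule majorized_mono[OF W.majorized_add[OF m0 W.majorized_add[OF m1 m2]]])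
    fix \<mu> v assume \<mu>: "\<mu> \<in> F"
    let ?g = "\<lambda>(\<theta>, \<theta>') v. (case \<theta> of () \<Rightarrow> \<bar>?d \<mu>\<^sub>0 v\<bar>) + (case \<theta>' of (\<theta>, \<theta>') \<Rightarrow> \<lambda>v. ?d \<theta> v + - ?d \<theta>' v) v"
    have "\<bar>?d \<mu> v\<bar> \<le> \<bar>?d \<mu>\<^sub>0 v\<bar> + (?d \<mu> v + - ?d \<mu>\<^sub>0 v) \<or> \<bar>?d \<mu> v\<bar> \<le> \<bar>?d \<mu>\<^sub>0 v\<bar> + (?d \<mu>\<^sub>0 v + - ?d \<mu> v)"
      by linarith
    then show "\<exists>\<theta>'\<in>{()} \<times> F \<times> F. \<bar>?d \<mu> v\<bar> \<le> (case \<theta>' of (\<theta>, \<theta>') \<Rightarrow> \<lambda>v. \<bar>?d \<mu>\<^sub>0 v\<bar> +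
        (case \<theta>' of (\<theta>, \<theta>') \<Rightarrow> \<lambda>v. ?d \<theta> v + - ?d \<theta>' v) v) v"
      using \<mu> \<mu>\<^sub>0 by (elim disjE) (intro bexI[of _ "((), \<mu>, \<mu>\<^sub>0)"] bexI[of _ "((), \<mu>\<^sub>0, \<mu>)"]; simp)+
  qed simp
qed

text \<open>Contraction removes the absolute value that couples the two indices. Afterwards
  \<open>\<mu>\<close> is paid for by R(F) and \<open>c\<close> by walks with independent
  signs.\<close>

lemma deviation_abs_diff:
  assumes C: "chain_class D T c b"
  shows "majorized W (T \<times> F) (\<lambda>(\<tau>, \<mu>) v. \<Sum>i<N. (\<integral>u. \<bar>(1 / 2) * (\<mu> u - c \<tau> u)\<bar> \<partial>D) - \<bar>(1 / 2) * (\<mu> (v i) - c \<tau> (v i))\<bar>)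
    (N * rademacher_complexity N D F + b * sqrt N)"
proof -
  interpret C: chain_class D N T c b by (rule C)
  let ?s = "\<lambda>(\<tau>, \<mu>) u. (1 / 2) * (\<mu> u - c \<tau> u)"
  \<comment> \<open>Twice the signed sum of \<open>?s\<close> is the signed sum of
    \<open>\<mu>\<close> plus that of \<open>c \<tau>\<close> with all signs reversed, hence the
    complement of \<open>I\<close>.\<close>
  let ?\<rho> = "\<lambda>I. N * integral\<^sup>L W (signed_sup I) + integral\<^sup>L W (C.signed_SUP ({..<N} - I))"
  have "majorized W (T \<times> F) (\<lambda>\<theta> v. \<Sum>i<N. (\<integral>u. \<bar>?s \<theta> u\<bar> \<partial>D) - \<bar>?s \<theta> (v i)\<bar>) ((\<Sum>I\<in>Pow {..<N}. ?\<rho> I) / 2 ^ N)"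
  proof (rule symmetrization_contraction[where s = ?s and \<phi> = abs and \<rho> = ?\<rho>])
    show "bounded_measurable D (?s \<theta>)" if \<theta>: "\<theta> \<in> T \<times> F" for \<theta>
    proof -
      obtain \<tau> \<mu> where "\<theta> = (\<tau>, \<mu>)" "\<tau> \<in> T" "\<mu> \<in> F" using \<theta> by auto
      then show ?thesis
        by (simp only: split) (intro bounded_measurable_cmult bounded_measurable_diff bounded_measurable_F C.bounded_measurable_a)
    qed
    show "majorized W (T \<times> F) (\<lambda>\<theta> v. 2 * (\<Sum>i<N. sgn_of I i * ?s \<theta> (v i))) (?\<rho> I)" for I
    proof (rule majorizedI[of _ "\<lambda>v. N * signed_sup I v + C.signed_SUP ({..<N} - I) v"])
      show "bounded_measurable W (\<lambda>v. N * signed_sup I v + C.signed_SUP ({..<N} - I) v)"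
        by (intro bounded_measurable_add bounded_measurable_cmult bounded_measurable_signed_sup C.signed_SUP(1))
      show "(\<integral>v. N * signed_sup I v + C.signed_SUP ({..<N} - I) v \<partial>W) \<le> ?\<rho> I"
        using W.integrable_bounded_measurable[OF bounded_measurable_signed_sup]
          W.integrable_bounded_measurable[OF C.signed_SUP(1)] by simp
      fix \<theta> v assume \<theta>: "\<theta> \<in> T \<times> F" and v: "v \<in> space W"
      obtain \<tau> \<mu> where [simp]: "\<theta> = (\<tau>, \<mu>)" and \<tau>: "\<tau> \<in> T" "\<mu> \<in> F" using \<theta> by auto
      have "2 * (\<Sum>i<N. sgn_of I i * ?s \<theta> (v i)) = (\<Sum>i<N. sgn_of I i * \<mu> (v i)) + (\<Sum>i<N. sgn_of ({..<N} - I) i * c \<tau> (v i))"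
        unfolding sum_distrib_left sum.distrib[symmetric]
        by (intro sum.cong) (auto simp: sgn_of_def algebra_simps)
      also have "\<dots> \<le> N * signed_sup I v + C.signed_SUP ({..<N} - I) v"
        by (intro add_mono signed_sum_le C.signed_SUP(2) \<tau> v)
      finally show "2 * (\<Sum>i<N. sgn_of I i * ?s \<theta> (v i)) \<le> N * signed_sup I v + C.signed_SUP ({..<N} - I) v" .
    qed
  qed simp
  moreover have "(\<Sum>I\<in>Pow {..<N}. ?\<rho> I) / 2 ^ N \<le> N * rademacher_complexity N D F + b * sqrt N"
  proof -
    have "(\<Sum>I\<in>Pow {..<N}. ?\<rho> I) = N * (\<Sum>I\<in>Pow {..<N}. integral\<^sup>L W (signed_sup I)) + (\<Sum>I\<in>Pow {..<N}. integral\<^sup>L W (C.signed_SUP I))"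
      by (simp add: sum.distrib sum_distrib_left sum_compl_Pow[where f = "\<lambda>I. integral\<^sup>L W (C.signed_SUP I)"])
    also have "\<dots> \<le> N * (2 ^ N * rademacher_complexity N D F) + 2 ^ N * (b * sqrt N)"
      unfolding sum_integral_signed_sup by (intro add_left_mono C.sum_integral_signed_SUP_le)
    finally show ?thesis by (simp add: field_simps)
  qed
  ultimately show ?thesis by (rule majorized_mono) auto
qed

end

section \<open>Quantile losses\<close>

lemma pinball_loss_eq: "pinball_loss \<tau> \<xi> = \<bar>\<xi>\<bar> / 2 + (\<tau> - 1 / 2) * \<xi>"
  by (simp add: pinball_loss_def field_simps)

lemma pinball_loss_nonneg: "\<tau> \<in> {0..1} \<Longrightarrow> 0 \<le> pinball_loss \<tau> \<xi>"
  by (auto simp: pinball_loss_def mult_nonpos_nonpos)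

text \<open>Truncating \<open>q\<close> to \<open>[0, b]\<close> leaves two remainders that do not depend on \<open>m\<close> and,
  unlike \<open>q\<close> itself, are bounded and monotone in \<open>\<tau>\<close> when \<open>q\<close> is a quantile function.\<close>

lemma pinball_loss_truncation:
  assumes "m \<in> {0..b}"
  shows "pinball_loss \<tau> (q - m) = \<bar>(1 / 2) * (m - max 0 (min b q))\<bar> + (\<tau> - 1 / 2) * max 0 (min b q)
    - (\<tau> - 1 / 2) * m + \<tau> * max 0 (q - b) + (1 - \<tau>) * max 0 (- q)"
proof -
  consider "q < 0" | "0 \<le> q" "q \<le> b" | "b < q" by linarith
  then show ?thesis
    using assms unfolding pinball_loss_eq by cases (auto simp: field_simps abs_if)
qed

context rademacher_class
begin

definition deviation :: "('v \<Rightarrow> real) \<Rightarrow> (nat \<Rightarrow> 'v) \<Rightarrow> real" where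
  "deviation f v = (\<Sum>i<N. (\<integral>u. f u \<partial>D) - f (v i))"

lemma deviation_add:
  "bounded_measurable D f \<Longrightarrow> bounded_measurable D g \<Longrightarrow>
   deviation (\<lambda>u. f u + g u) v = deviation f v + deviation g v"
  by (simp add: deviation_def sum.distrib[symmetric] integrable_bounded_measurable algebra_simps)

lemma deviation_cmult: "deviation (\<lambda>u. k * f u) v = k * deviation f v"
  by (simp add: deviation_def sum_distrib_left right_diff_distrib)

lemma deviation_cong:
  assumes "v \<in> space W" "\<And>u. u \<in> space D \<Longrightarrow> f u = g u"
  shows "deviation f v = deviation g v"
  unfolding deviation_def using assms component_space[OF assms(1)]
  by (intro sum.cong arg_cong2[where f = "(-)"] Bochner_Integration.integral_cong) auto

lemma quantile_class_deviation:
  fixes q :: "real \<Rightarrow> 'v \<Rightarrow> real"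
  assumes T: "countable T" "T \<noteq> {}" "T \<subseteq> {0..1}"
    and meas: "\<And>\<tau>. \<tau> \<in> T \<Longrightarrow> q \<tau> \<in> borel_measurable D"
    and mono: "\<And>\<tau> \<tau>' u. \<tau> \<in> T \<Longrightarrow> \<tau>' \<in> T \<Longrightarrow> \<tau> \<le> \<tau>' \<Longrightarrow> u \<in> space D \<Longrightarrow> q \<tau> u \<le> q \<tau>' u"
    and loss: "\<And>\<tau> \<mu> u. \<tau> \<in> T \<Longrightarrow> \<mu> \<in> F \<Longrightarrow> u \<in> space D \<Longrightarrow> pinball_loss \<tau> (q \<tau> u - \<mu> u) \<le> b"
  shows "majorized W (T \<times> F) (\<lambda>(\<tau>, \<mu>). deviation (\<lambda>u. pinball_loss \<tau> (q \<tau> u - \<mu> u)))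
    (4 * N * rademacher_complexity N D F + 4 * b * sqrt N)"
proof -
  define c where "c \<tau> u = max 0 (min b (q \<tau> u))" for \<tau> u
  define p where "p \<tau> u = \<tau> * max 0 (q \<tau> u - b)" for \<tau> u
  define n where "n \<tau> u = (1 - \<tau>) * max 0 (- q \<tau> u)" for \<tau> u
  obtain \<mu>\<^sub>0 where \<mu>\<^sub>0: "\<mu>\<^sub>0 \<in> F" using F_nonempty by blast
  have T01: "0 \<le> \<tau>" "\<tau> \<le> 1" if "\<tau> \<in> T" for \<tau> using T(3) that by auto
  have incr: "c \<tau> u \<le> c \<tau>' u" "p \<tau> u \<le> p \<tau>' u" "n \<tau>' u \<le> n \<tau> u"
    if "\<tau> \<in> T" "\<tau>' \<in> T" "\<tau> \<le> \<tau>'" "u \<in> space D" for \<tau> \<tau>' u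
  proof -
    have le: "q \<tau> u \<le> q \<tau>' u" by (rule mono[OF that])
    then show "c \<tau> u \<le> c \<tau>' u" unfolding c_def by (intro max.mono min.mono) auto
    show "p \<tau> u \<le> p \<tau>' u" unfolding p_def using le T01[OF that(1)] that(3)
      by (intro mult_mono max.mono) auto
    show "n \<tau>' u \<le> n \<tau> u" unfolding n_def using le T01[OF that(2)] that(3)
      by (intro mult_mono max.mono) auto
  qed
  have range: "c \<tau> u \<in> {0..b}" "p \<tau> u \<in> {0..b}" "n \<tau> u \<in> {0..b}" if "\<tau> \<in> T" "u \<in> space D" for \<tau> u
  proof -
    show "c \<tau> u \<in> {0..b}" using b_nonneg by (simp add: c_def)
    have m: "0 \<le> \<mu>\<^sub>0 u" "\<mu>\<^sub>0 u \<le> b" using range_F[OF \<mu>\<^sub>0 that(2)] by auto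
    note l = loss[OF that(1) \<mu>\<^sub>0 that(2)] T01[OF that(1)]
    \<comment> \<open>Since \<open>\<mu>\<^sub>0\<close> is at most \<open>b\<close>, the remainder
      \<tau> (q - b) is at most the loss of \<open>\<mu>\<^sub>0\<close>, and this is at most
      \<open>b\<close>. For \<open>n\<close> the same holds with \<open>\<mu>\<^sub>0\<close> at
      least 0.\<close>
    have "p \<tau> u \<le> b"
    proof (cases "q \<tau> u \<le> b")
      case False
      then have "p \<tau> u \<le> \<tau> * (q \<tau> u - \<mu>\<^sub>0 u)"
        unfolding p_def using l m by (intro mult_left_mono) auto
      then show ?thesis using l(1) False m by (simp add: pinball_loss_def)
    qed (simp add: p_def b_nonneg)
    then show "p \<tau> u \<in> {0..b}" using l by (simp add: p_def)
    have "n \<tau> u \<le> b"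
    proof (cases "0 \<le> q \<tau> u")
      case False
      then have "n \<tau> u \<le> (1 - \<tau>) * (\<mu>\<^sub>0 u - q \<tau> u)"
        unfolding n_def using l m by (intro mult_left_mono) auto
      then show ?thesis using l(1) False m by (simp add: pinball_loss_def algebra_simps)
    qed (simp add: n_def b_nonneg)
    then show "n \<tau> u \<in> {0..b}" using l by (simp add: n_def)
  qed
  have measc: "c \<tau> \<in> borel_measurable D" "p \<tau> \<in> borel_measurable D" "n \<tau> \<in> borel_measurable D" if "\<tau> \<in> T" for \<tau>
    unfolding c_def p_def n_def using meas[OF that] by measurable
  interpret C: chain_class D N T c b
  proof unfold_locales
    fix \<tau> \<tau>' assume t: "\<tau> \<in> T" "\<tau>' \<in> T"
    show "(\<forall>u\<in>space D. c \<tau> u \<le> c \<tau>' u) \<or> (\<forall>u\<in>space D. c \<tau>' u \<le> c \<tau> u)"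
      using incr(1)[OF t] incr(1)[OF t(2,1)] by (cases "\<tau> \<le> \<tau>'") auto
  qed (use T b_nonneg measc(1) range(1) in simp_all)
  interpret P: chain_class D N T p b
  proof unfold_locales
    fix \<tau> \<tau>' assume t: "\<tau> \<in> T" "\<tau>' \<in> T"
    show "(\<forall>u\<in>space D. p \<tau> u \<le> p \<tau>' u) \<or> (\<forall>u\<in>space D. p \<tau>' u \<le> p \<tau> u)"
      using incr(2)[OF t] incr(2)[OF t(2,1)] by (cases "\<tau> \<le> \<tau>'") auto
  qed (use T b_nonneg measc(2) range(2) in simp_all)
  interpret M: chain_class D N T n b
  proof unfold_locales
    fix \<tau> \<tau>' assume t: "\<tau> \<in> T" "\<tau>' \<in> T"
    show "(\<forall>u\<in>space D. n \<tau> u \<le> n \<tau>' u) \<or> (\<forall>u\<in>space D. n \<tau>' u \<le> n \<tau> u)"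
      using incr(3)[OF t] incr(3)[OF t(2,1)] by (cases "\<tau> \<le> \<tau>'") auto
  qed (use T b_nonneg measc(3) range(3) in simp_all)
  have N1: "N \<ge> 1" using N_pos by simp
  note m1 = deviation_abs_diff[OF C.chain_class_axioms]
  have half: "(0 :: real) \<le> 1 / 2" by simp
  note m2 = majorized_cmult[OF C.chain_deviation_abs[OF N1] half]
  note m3 = majorized_cmult[OF deviation_F_abs half]
  note m4 = P.chain_deviation[OF N1]
  note m5 = M.chain_deviation[OF N1]
  note sum = W.majorized_add[OF m1 W.majorized_add[OF m2 W.majorized_add[OF m3 W.majorized_add[OF m4 m5]]]]
  show ?thesis
  proof (rule majorized_mono[OF sum], goal_cases)
    case 1
    \<comment> \<open>The complexity terms add up to 3 N R(F), raised to 4 N R(F) by nonnegativity.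
      The terms in \<open>sqrt N\<close> add up to exactly 1 + 11/12 + 1/4 + 11/12 + 11/12 =
      4.\<close>
    have "N * rademacher_complexity N D F + b * sqrt N + (1 / 2 * (11 / 6 * b * sqrt N) +
        (1 / 2 * (4 * N * rademacher_complexity N D F + b / 2 * sqrt N) + (11 / 12 * b * sqrt N + 11 / 12 * b * sqrt N)))
      \<le> 4 * N * rademacher_complexity N D F + 4 * b * sqrt N"
      using mult_nonneg_nonneg[OF of_nat_0_le_iff[of N] rademacher_complexity_nonneg]
      by (simp add: field_simps)
    then show ?case .
  next
    case (2 \<theta> v)
    then have \<theta>: "\<theta> \<in> T \<times> F" and v: "v \<in> space W" by auto
    obtain \<tau> \<mu> where [simp]: "\<theta> = (\<tau>, \<mu>)" and \<tau>: "\<tau> \<in> T" and \<mu>: "\<mu> \<in> F" using \<theta> by auto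
    note bm = C.bounded_measurable_a[OF \<tau>] P.bounded_measurable_a[OF \<tau>] M.bounded_measurable_a[OF \<tau>] bounded_measurable_F[OF \<mu>]
    have ba: "bounded_measurable D (\<lambda>u. \<bar>(1 / 2) * (\<mu> u - c \<tau> u)\<bar>)"
      by (rule bounded_measurable_lipschitz_comp[OF bounded_measurable_cmult[OF bounded_measurable_diff]]) (use bm in auto)
    have "deviation (\<lambda>u. pinball_loss \<tau> (q \<tau> u - \<mu> u)) v
      = deviation (\<lambda>u. \<bar>(1 / 2) * (\<mu> u - c \<tau> u)\<bar> + ((\<tau> - 1 / 2) * c \<tau> u + ((1 / 2 - \<tau>) * \<mu> u + (p \<tau> u + n \<tau> u)))) v"
    proof (rule deviation_cong[OF v])
      fix u assume "u \<in> space D"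
      from pinball_loss_truncation[OF range_F[OF \<mu> this], of \<tau> "q \<tau> u"]
      show "pinball_loss \<tau> (q \<tau> u - \<mu> u) = \<bar>(1 / 2) * (\<mu> u - c \<tau> u)\<bar> + ((\<tau> - 1 / 2) * c \<tau> u + ((1 / 2 - \<tau>) * \<mu> u + (p \<tau> u + n \<tau> u)))"
        unfolding c_def p_def n_def by (simp add: algebra_simps)
    qed
    also have "\<dots> = deviation (\<lambda>u. \<bar>(1 / 2) * (\<mu> u - c \<tau> u)\<bar>) v + ((\<tau> - 1 / 2) * deviation (c \<tau>) v
        + ((1 / 2 - \<tau>) * deviation \<mu> v + (deviation (p \<tau>) v + deviation (n \<tau>) v)))"
      using bm ba by (simp only: deviation_add deviation_cmult bounded_measurable_add bounded_measurable_cmult)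
    also have "\<dots> \<le> deviation (\<lambda>u. \<bar>(1 / 2) * (\<mu> u - c \<tau> u)\<bar>) v + (1 / 2 * \<bar>deviation (c \<tau>) v\<bar>
        + (1 / 2 * \<bar>deviation \<mu> v\<bar> + (max 0 (deviation (p \<tau>) v) + max 0 (deviation (n \<tau>) v))))"
    proof (intro add_mono order.refl)
      have half: "k * x \<le> 1 / 2 * \<bar>x\<bar>" if "\<bar>k\<bar> \<le> 1 / 2" for k x :: real
        using mult_right_mono[OF that, of "\<bar>x\<bar>"] abs_ge_self[of "k * x"] by (simp add: abs_mult)
      have k: "\<bar>\<tau> - 1 / 2\<bar> \<le> 1 / 2" "\<bar>1 / 2 - \<tau>\<bar> \<le> 1 / 2"
        using T01[OF \<tau>] by (auto simp: abs_if)
      show "(\<tau> - 1 / 2) * deviation (c \<tau>) v \<le> 1 / 2 * \<bar>deviation (c \<tau>) v\<bar>"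
        "(1 / 2 - \<tau>) * deviation \<mu> v \<le> 1 / 2 * \<bar>deviation \<mu> v\<bar>"
        by (fact half[OF k(1)] half[OF k(2)])+
    qed auto
    finally have le: "deviation (\<lambda>u. pinball_loss \<tau> (q \<tau> u - \<mu> u)) v \<le> \<dots>" .
    \<comment> \<open>The five families have independent indices; here they all take the values of
      the given pair.\<close>
    show ?case
      by (rule bexI[of _ "((\<tau>, \<mu>), \<tau>, \<mu>, \<tau>, \<tau>)"]) (use le \<tau> \<mu> in \<open>simp_all add: deviation_def\<close>)
  qed
qed

end

text \<open>Measurable suprema over levels are formed over countable sets, while \<open>T\<close> is
  an arbitrary set of levels. Quantiles are left continuous in the level, so each level must be
  approached from the left; an ordinary dense subset might approach it from the right only.\<close>

lemma countable_left_dense_subset: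
  fixes T :: "real set"
  shows "\<exists>T\<^sub>0\<subseteq>T. countable T\<^sub>0 \<and> (\<forall>t\<in>T. \<forall>e>0. \<exists>s\<in>T\<^sub>0. t - e < s \<and> s \<le> t)"
proof -
  \<comment> \<open>Points with a gap of \<open>T\<close> to their left. Such gaps are disjoint and
    contain distinct rationals, so these points are countable, apart from a least element of
    \<open>T\<close>, which has nothing to its left and is handled separately.\<close>
  define L where "L = {t \<in> T. \<exists>e>0. T \<inter> {t - e<..<t} = {}}"
  define J where "J p = {real_of_rat (fst p)<..<real_of_rat (snd p)}" for p
  define E where "E = (\<lambda>p. SOME s. s \<in> T \<inter> J p) ` {p. T \<inter> J p \<noteq> {}}"
  have some: "(SOME s. s \<in> T \<inter> A) \<in> T \<inter> A" if "T \<inter> A \<noteq> {}" for A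
    by (rule someI_ex) (use that in blast)
  have E: "E \<subseteq> T"
    unfolding E_def
  proof (rule image_subsetI)
    fix p assume "p \<in> {p. T \<inter> J p \<noteq> {}}"
    then show "(SOME s. s \<in> T \<inter> J p) \<in> T" using some[of "J p"] by simp
  qed
  have "countable E" unfolding E_def by (intro countable_image countableI_type)
  have "\<exists>r. \<forall>s\<in>T. s < t \<longrightarrow> s < real_of_rat r \<and> real_of_rat r < t" if t: "t \<in> L" for t
  proof -
    obtain e where e: "0 < e" "T \<inter> {t - e<..<t} = {}" using t by (auto simp: L_def)
    have "t - e < t" using e(1) by simp
    from of_rat_dense[OF this] obtain r where r: "t - e < real_of_rat r" "real_of_rat r < t"
      by blast
    have "s < real_of_rat r" if "s \<in> T" "s < t" for s
    proof -
      have "s \<le> t - e" using e(2) that by fastforce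
      then show ?thesis using r(1) by linarith
    qed
    then show ?thesis using r(2) by blast
  qed
  then have "\<forall>t\<in>L. \<exists>r. \<forall>s\<in>T. s < t \<longrightarrow> s < real_of_rat r \<and> real_of_rat r < t" by blast
  then obtain f where "\<forall>t\<in>L. \<forall>s\<in>T. s < t \<longrightarrow> s < real_of_rat (f t) \<and> real_of_rat (f t) < t"
    by (rule bchoice[THEN exE])
  then have f: "s < real_of_rat (f t) \<and> real_of_rat (f t) < t" if "t \<in> L" "s \<in> T" "s < t" for t s
    using that by blast
  have "f t \<noteq> f s" if "t \<in> L" "s \<in> L" "s < t" and ex: "\<exists>r\<in>T. r < s" for t s
  proof -
    obtain r where "r \<in> T" "r < s" using ex by blast
    then have "real_of_rat (f s) < s" using f[OF that(2)] by blast
    moreover have "s < real_of_rat (f t)" using f[OF that(1) _ that(3)] that(2) by (auto simp: L_def)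
    ultimately show ?thesis by auto
  qed
  then have "inj_on f {t \<in> L. \<exists>r\<in>T. r < t}"
    by (intro linorder_inj_onI) (fastforce, linarith)
  then have "countable {t \<in> L. \<exists>r\<in>T. r < t}"
    by (rule countable_image_inj_on[rotated]) (rule countableI_type)
  moreover have "{t \<in> T. \<not> (\<exists>r\<in>T. r < t)} \<subseteq> {Inf T}"
    by (auto intro!: cInf_eq_minimum[symmetric] simp: not_less)
  then have "countable {t \<in> T. \<not> (\<exists>r\<in>T. r < t)}"
    by (rule countable_subset) simp
  ultimately have "countable ({t \<in> L. \<exists>r\<in>T. r < t} \<union> {t \<in> T. \<not> (\<exists>r\<in>T. r < t)} \<union> E)"
    using \<open>countable E\<close> by auto
  moreover have "\<exists>s\<in>{t \<in> L. \<exists>r\<in>T. r < t} \<union> {t \<in> T. \<not> (\<exists>r\<in>T. r < t)} \<union> E. t - e < s \<and> s \<le> t"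
    if t: "t \<in> T" and e: "0 < e" for t e
  proof (cases "t \<in> L \<or> \<not> (\<exists>r\<in>T. r < t)")
    case True
    then show ?thesis using t e by (intro bexI[of _ t]) auto
  next
    case False
    then have "T \<inter> {t - e<..<t} \<noteq> {}" using t e by (auto simp: L_def)
    then obtain s where s: "s \<in> T" "t - e < s" "s < t" by auto
    obtain r r' where r: "t - e < real_of_rat r" "real_of_rat r < s" "s < real_of_rat r'" "real_of_rat r' < t"
      using of_rat_dense[OF s(2)] of_rat_dense[OF s(3)] by blast
    have ne: "T \<inter> J (r, r') \<noteq> {}" using s(1) r by (auto simp: J_def)
    define s' where "s' = (SOME s. s \<in> T \<inter> J (r, r'))"
    have "s' \<in> T \<inter> J (r, r')" unfolding s'_def by (rule some[OF ne])
    then have "t - e < s'" "s' \<le> t" using r by (auto simp: J_def)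
    moreover have "s' \<in> E" unfolding E_def s'_def using ne by (intro imageI) simp
    ultimately show ?thesis using r by (intro bexI[of _ s']) auto
  qed
  ultimately show ?thesis
    using E by (intro exI[of _ "{t \<in> L. \<exists>r\<in>T. r < t} \<union> {t \<in> T. \<not> (\<exists>r\<in>T. r < t)} \<union> E"]) (auto simp: L_def)
qed

text \<open>When the value \<tau> is attained, the smallest quantile is the generalized inverse of
  the distribution function. This equivalence is the source of measurability in \<open>v\<close> and
  of monotonicity and left continuity in \<tau>.\<close>

lemma cond_quantile_le_iff:
  assumes "prob_space (K v)" "sets (K v) = sets borel" "\<exists>m. is_cond_quantile K \<tau> v m"
  shows "cond_quantile K \<tau> v \<le> m \<longleftrightarrow> \<tau> \<le> measure (K v) {..m}"
proof -
  interpret prob_space "K v" by fact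
  obtain m' where "is_cond_quantile K \<tau> v m'" using assms(3) by blast
  then have Q: "is_cond_quantile K \<tau> v (cond_quantile K \<tau> v)" by (simp add: cond_quantile_eq)
  have le: "measure (K v) {..s} \<le> measure (K v) {..t}" if "s \<le> t" for s t
    using that assms(2) by (intro finite_measure_mono) auto
  show ?thesis
  proof
    assume "cond_quantile K \<tau> v \<le> m"
    from le[OF this] show "\<tau> \<le> measure (K v) {..m}" using Q by (simp add: is_cond_quantile_def)
  next
    assume *: "\<tau> \<le> measure (K v) {..m}"
    show "cond_quantile K \<tau> v \<le> m"
    proof (rule ccontr)
      assume n: "\<not> ?thesis"
      then have "measure (K v) {..m} \<le> \<tau>" using le[of m "cond_quantile K \<tau> v"] Q by (simp add: is_cond_quantile_def)
      then have "measure (K v) {..m} = \<tau>" using * by simp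
      then show False using Q n by (simp add: is_cond_quantile_def)
    qed
  qed
qed

lemma left_limit_sequence:
  fixes t :: real
  assumes "\<And>e. e > 0 \<Longrightarrow> \<exists>s\<in>T\<^sub>0. t - e < s \<and> s \<le> t"
  shows "\<exists>s. (\<forall>n. s n \<in> T\<^sub>0 \<and> s n \<le> t) \<and> s \<longlonglongrightarrow> t"
proof -
  have "\<forall>n. \<exists>s. s \<in> T\<^sub>0 \<and> t - 1 / Suc n < s \<and> s \<le> t"
    using assms[of "1 / Suc n" for n] by fastforce
  then obtain s where s: "\<And>n. s n \<in> T\<^sub>0 \<and> t - 1 / Suc n < s n \<and> s n \<le> t" by metis
  have "(\<lambda>n. t - 1 / Suc n) \<longlonglongrightarrow> t - 0"
    by (intro tendsto_diff tendsto_const LIMSEQ_Suc[OF lim_1_over_n])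
  then have "s \<longlonglongrightarrow> t"
    using s by (intro tendsto_sandwich[of "\<lambda>n. t - 1 / Suc n" s sequentially "\<lambda>_. t"] always_eventually) (auto intro: less_imp_le)
  then show ?thesis using s by blast
qed

text \<open>Monotonicity gives the upper estimate. For the lower one, a number \<open>a\<close>
  below the quantile has distribution function below \<tau>, hence eventually below
  \<open>s n\<close>.\<close>

lemma cond_quantile_left_continuous:
  assumes K: "prob_space (K v)" "sets (K v) = sets borel"
    and ex: "\<And>\<tau>. \<tau> \<in> T \<Longrightarrow> \<exists>m. is_cond_quantile K \<tau> v m"
    and "\<tau> \<in> T" "\<And>n. s n \<in> T" "\<And>n. s n \<le> \<tau>" "s \<longlonglongrightarrow> \<tau>"
  shows "(\<lambda>n. cond_quantile K (s n) v) \<longlonglongrightarrow> cond_quantile K \<tau> v"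
proof (rule order_tendstoI)
  note iff = cond_quantile_le_iff[OF K ex]
  fix a assume "cond_quantile K \<tau> v < a"
  moreover have "cond_quantile K (s n) v \<le> cond_quantile K \<tau> v" for n
    using iff[OF assms(5)[of n], of "cond_quantile K \<tau> v"] iff[OF assms(4), of "cond_quantile K \<tau> v"] assms(6)[of n] by simp
  ultimately show "\<forall>\<^sub>F n in sequentially. cond_quantile K (s n) v < a"
    by (intro always_eventually allI) (meson le_less_trans)
next
  note iff = cond_quantile_le_iff[OF K ex]
  fix a assume "a < cond_quantile K \<tau> v"
  then have "measure (K v) {..a} < \<tau>" using iff[OF assms(4), of a] by simp
  then have "\<forall>\<^sub>F n in sequentially. measure (K v) {..a} < s n"
    using assms(7) by (rule order_tendstoD(1)[rotated])
  then show "\<forall>\<^sub>F n in sequentially. a < cond_quantile K (s n) v"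
    by eventually_elim (use iff[OF assms(5)] in \<open>simp add: not_le[symmetric]\<close>)
qed

section \<open>Law of the sampled inputs and the bound uniform in level and hypothesis\<close>

lemma (in prob_space) distr_iid_projection:
  assumes "N > 0" and p: "p \<in> measurable S S'" and V: "V \<in> measurable M S"
    and indep: "indep_vars (\<lambda>_. S) U {..<N}"
    and ident: "\<And>i. i < N \<Longrightarrow> distr M S (U i) = distr M S V"
  shows "(\<lambda>\<omega>. \<lambda>i\<in>{..<N}. p (U i \<omega>)) \<in> measurable M (PiM {..<N} (\<lambda>_. S'))"
    and "distr M (PiM {..<N} (\<lambda>_. S')) (\<lambda>\<omega>. \<lambda>i\<in>{..<N}. p (U i \<omega>)) = PiM {..<N} (\<lambda>_. distr M S' (\<lambda>\<omega>. p (V \<omega>)))"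
proof -
  have U: "U i \<in> measurable M S" if "i < N" for i
    using indep that by (auto simp: indep_vars_def)
  have pU: "(\<lambda>\<omega>. p (U i \<omega>)) \<in> measurable M S'" if "i < N" for i
    using U[OF that] p by (rule measurable_compose)
  then show "(\<lambda>\<omega>. \<lambda>i\<in>{..<N}. p (U i \<omega>)) \<in> measurable M (PiM {..<N} (\<lambda>_. S'))"
    by (intro measurable_restrict) auto
  have "indep_vars (\<lambda>_. S') (\<lambda>i \<omega>. p (U i \<omega>)) {..<N}"
    using indep p by (rule indep_vars_compose2)
  then have "distr M (PiM {..<N} (\<lambda>_. S')) (\<lambda>\<omega>. \<lambda>i\<in>{..<N}. p (U i \<omega>)) = PiM {..<N} (\<lambda>i. distr M S' (\<lambda>\<omega>. p (U i \<omega>)))"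
    using assms(1) pU by (subst (asm) indep_vars_iff_distr_eq_PiM') auto
  also have "\<dots> = PiM {..<N} (\<lambda>_. distr M S' (\<lambda>\<omega>. p (V \<omega>)))"
  proof (rule PiM_cong[OF refl])
    fix i assume "i \<in> {..<N}"
    then have i: "i < N" by simp
    have "distr M S' (\<lambda>\<omega>. p (U i \<omega>)) = distr (distr M S (U i)) S' p"
      using distr_distr[OF p U[OF i]] by (simp add: comp_def)
    also have "\<dots> = distr M S' (\<lambda>\<omega>. p (V \<omega>))"
      unfolding ident[OF i] using distr_distr[OF p V] by (simp add: comp_def)
    finally show "distr M S' (\<lambda>\<omega>. p (U i \<omega>)) = distr M S' (\<lambda>\<omega>. p (V \<omega>))" .
  qed
  finally show "distr M (PiM {..<N} (\<lambda>_. S')) (\<lambda>\<omega>. \<lambda>i\<in>{..<N}. p (U i \<omega>)) = PiM {..<N} (\<lambda>_. distr M S' (\<lambda>\<omega>. p (V \<omega>)))" .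
qed

lemma (in rademacher_class) uniform_quantile_bound:
  fixes q :: "real \<Rightarrow> 'v \<Rightarrow> real" and T :: "real set"
  assumes T: "T \<noteq> {}" "T \<subseteq> {0..1}" and \<delta>: "0 < \<delta>" "\<delta> < 1" and "0 < b"
    and meas: "\<And>\<tau>. \<tau> \<in> T \<Longrightarrow> q \<tau> \<in> borel_measurable D"
    and mono: "\<And>\<tau> \<tau>' u. \<tau> \<in> T \<Longrightarrow> \<tau>' \<in> T \<Longrightarrow> \<tau> \<le> \<tau>' \<Longrightarrow> u \<in> space D \<Longrightarrow> q \<tau> u \<le> q \<tau>' u"
    and left: "\<And>\<tau> s u. \<tau> \<in> T \<Longrightarrow> (\<And>n. s n \<in> T) \<Longrightarrow> (\<And>n. s n \<le> \<tau>) \<Longrightarrow> s \<longlonglongrightarrow> \<tau> \<Longrightarrow> u \<in> space D \<Longrightarrow>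
      (\<lambda>n. q (s n) u) \<longlonglongrightarrow> q \<tau> u"
    and loss: "\<And>\<tau> \<mu> u. \<tau> \<in> T \<Longrightarrow> \<mu> \<in> F \<Longrightarrow> u \<in> space D \<Longrightarrow> pinball_loss \<tau> (q \<tau> u - \<mu> u) \<le> b"
  shows "\<exists>A\<in>sets W. measure W A \<ge> 1 - \<delta> \<and> (\<forall>v\<in>A. \<forall>\<tau>\<in>T. \<forall>\<mu>\<in>F.
    (\<integral>u. pinball_loss \<tau> (q \<tau> u - \<mu> u) \<partial>D) \<le> (1 / N) * (\<Sum>i<N. pinball_loss \<tau> (q \<tau> (v i) - \<mu> (v i)))
      + 4 * rademacher_complexity N D F + 4 * b / sqrt N + b * sqrt (ln (1 / \<delta>) / (2 * N)))"
proof -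
  obtain T\<^sub>0 where T0: "T\<^sub>0 \<subseteq> T" "countable T\<^sub>0" "\<And>t e. t \<in> T \<Longrightarrow> 0 < e \<Longrightarrow> \<exists>s\<in>T\<^sub>0. t - e < s \<and> s \<le> t"
    using countable_left_dense_subset[of T] by blast
  have T0_ne: "T\<^sub>0 \<noteq> {}"
  proof -
    obtain t where "t \<in> T" using T(1) by blast
    from T0(3)[OF this, of 1] show ?thesis by auto
  qed
  let ?l = "\<lambda>\<tau> \<mu> u. pinball_loss \<tau> (q \<tau> u - \<mu> u)"
  let ?d = "\<lambda>(\<tau>, \<mu>). deviation (?l \<tau> \<mu>)"
  have l: "0 \<le> ?l \<tau> \<mu> u" "?l \<tau> \<mu> u \<le> b" if "\<tau> \<in> T" "\<mu> \<in> F" "u \<in> space D" for \<tau> \<mu> u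
    using loss[OF that] pinball_loss_nonneg[of \<tau>] T(2) that(1) by auto
  have lm: "?l \<tau> \<mu> \<in> borel_measurable D" if "\<tau> \<in> T" "\<mu> \<in> F" for \<tau> \<mu>
    unfolding pinball_loss_eq using meas[OF that(1)] measurable_F[OF that(2)] by measurable
  have lb: "bounded_measurable D (?l \<tau> \<mu>)" if "\<tau> \<in> T" "\<mu> \<in> F" for \<tau> \<mu>
    using lm[OF that] l[OF that] by (intro bounded_measurableI[of _ _ b]) (auto simp: abs_le_iff)
  have lint: "0 \<le> (\<integral>u. ?l \<tau> \<mu> u \<partial>D)" "(\<integral>u. ?l \<tau> \<mu> u \<partial>D) \<le> b" if "\<tau> \<in> T" "\<mu> \<in> F" for \<tau> \<mu>
  proof -
    show "0 \<le> (\<integral>u. ?l \<tau> \<mu> u \<partial>D)" using l[OF that] by (intro Bochner_Integration.integral_nonneg) auto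
    have "(\<integral>u. ?l \<tau> \<mu> u \<partial>D) \<le> (\<integral>u. b \<partial>D)"
      using l[OF that] lb[OF that] by (intro integral_mono integrable_bounded_measurable) auto
    then show "(\<integral>u. ?l \<tau> \<mu> u \<partial>D) \<le> b" by (simp add: prob_space)
  qed
  define r where "r = 4 * N * rademacher_complexity N D F + 4 * b * sqrt N"
  \<comment> \<open>The value for which McDiarmid's exceptional probability exp (-2 t^2 / (N b^2))
    equals \<delta>.\<close>
  define t where "t = b * sqrt (N * ln (1 / \<delta>) / 2)"
  have ln: "0 < ln (1 / \<delta>)" using \<delta> by simp
  have maj: "majorized W (T\<^sub>0 \<times> F) ?d r"
    unfolding r_def
  proof (rule quantile_class_deviation[OF T0(2) T0_ne])
    show "T\<^sub>0 \<subseteq> {0..1}" using T0(1) T(2) by blast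
    note sub = subsetD[OF T0(1)]
    show "q \<tau> \<in> borel_measurable D" if "\<tau> \<in> T\<^sub>0" for \<tau>
      by (rule meas[OF sub[OF that]])
    show "q \<tau> u \<le> q \<tau>' u" if "\<tau> \<in> T\<^sub>0" "\<tau>' \<in> T\<^sub>0" "\<tau> \<le> \<tau>'" "u \<in> space D" for \<tau> \<tau>' u
      by (rule mono[OF sub[OF that(1)] sub[OF that(2)] that(3,4)])
    show "?l \<tau> \<mu> u \<le> b" if "\<tau> \<in> T\<^sub>0" "\<mu> \<in> F" "u \<in> space D" for \<tau> \<mu> u
      by (rule loss[OF sub[OF that(1)] that(2,3)])
  qed
  have "\<exists>A\<in>sets W. measure W A \<ge> 1 - exp (- 2 * t\<^sup>2 / (N * b\<^sup>2)) \<and> (\<forall>v\<in>A. \<forall>\<theta>\<in>T\<^sub>0 \<times> F. ?d \<theta> v \<le> r + t)"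
  proof (rule McDiarmid_majorized[OF maj])
    show "T\<^sub>0 \<times> F \<noteq> {}" using T0_ne F_nonempty by auto
    show "0 \<le> t" using \<open>0 < b\<close> ln by (simp add: t_def)
    fix \<theta> v assume "\<theta> \<in> T\<^sub>0 \<times> F" and v: "v \<in> space W"
    then obtain \<tau> \<mu> where [simp]: "\<theta> = (\<tau>, \<mu>)" and \<tau>: "\<tau> \<in> T" "\<mu> \<in> F" using T0(1) by auto
    have "\<bar>(\<integral>u. ?l \<tau> \<mu> u \<partial>D) - ?l \<tau> \<mu> (v i)\<bar> \<le> b" if "i < N" for i
      using l[OF \<tau> component_space[OF v that]] lint[OF \<tau>] by linarith
    then have "(\<Sum>i<N. \<bar>(\<integral>u. ?l \<tau> \<mu> u \<partial>D) - ?l \<tau> \<mu> (v i)\<bar>) \<le> (\<Sum>i<N. b)"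
      by (intro sum_mono) auto
    then show "\<bar>?d \<theta> v\<bar> \<le> N * b"
      by (simp add: deviation_def order.trans[OF sum_abs])
    fix i u assume i: "i < N" and u: "u \<in> space D"
    have split: "(\<Sum>j<N. g j) = g i + (\<Sum>j\<in>{..<N} - {i}. g j)" for g :: "nat \<Rightarrow> real"
      using i by (intro sum.remove) auto
    \<comment> \<open>The two sides differ by the loss at \<open>u\<close> against the loss at
      \<open>v i\<close>. As losses lie in \<open>[0, b]\<close>, the difference constant is
      \<open>b\<close>.\<close>
    show "?d \<theta> v \<le> ?d \<theta> (v(i := u)) + b"
      using l(1)[OF \<tau> component_space[OF v i]] l(2)[OF \<tau> u]
      by (simp add: deviation_def split)
  qed (use N_pos \<open>0 < b\<close> in auto)
  moreover have "exp (- 2 * t\<^sup>2 / (N * b\<^sup>2)) = \<delta>"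
  proof -
    have "- 2 * t\<^sup>2 / (N * b\<^sup>2) = - ln (1 / \<delta>)"
      using ln N_pos \<open>0 < b\<close> by (simp add: t_def power_mult_distrib field_simps)
    then show ?thesis using \<delta> by (simp add: ln_div)
  qed
  ultimately obtain A where A: "A \<in> sets W" "measure W A \<ge> 1 - \<delta>" "\<forall>v\<in>A. \<forall>\<theta>\<in>T\<^sub>0 \<times> F. ?d \<theta> v \<le> r + t"
    by (elim bexE conjE) (rule that, simp_all only:)
  \<comment> \<open>Passing from \<open>T\<^sub>0\<close> to \<open>T\<close> keeps the event
    \<open>A\<close>: for each of its points the inequality survives the limit, by dominated
    convergence in the mean and pointwise convergence in the sum.\<close>
  have dT: "deviation (?l \<tau> \<mu>) v \<le> r + t" if v: "v \<in> A" and \<tau>: "\<tau> \<in> T" and \<mu>: "\<mu> \<in> F" for v \<tau> \<mu>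
  proof -
    have vW: "v \<in> space W" using A(1) v by (auto dest: sets.sets_into_space)
    obtain s where s: "\<And>n. s n \<in> T\<^sub>0" "\<And>n. s n \<le> \<tau>" "s \<longlonglongrightarrow> \<tau>"
      using left_limit_sequence[OF T0(3)[OF \<tau>]] by blast
    have sT: "s n \<in> T" for n using s(1) T0(1) by auto
    have lim: "(\<lambda>n. ?l (s n) \<mu> u) \<longlonglongrightarrow> ?l \<tau> \<mu> u" if "u \<in> space D" for u
      unfolding pinball_loss_eq by (intro tendsto_intros s left[OF \<tau> sT s(2,3) that]) simp
    have lim_int: "(\<lambda>n. \<integral>u. ?l (s n) \<mu> u \<partial>D) \<longlonglongrightarrow> (\<integral>u. ?l \<tau> \<mu> u \<partial>D)"
    proof (rule integral_dominated_convergence[where w = "\<lambda>_. b"])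
      show "AE u in D. (\<lambda>n. ?l (s n) \<mu> u) \<longlonglongrightarrow> ?l \<tau> \<mu> u" using lim by (rule AE_I2)
      show "AE u in D. norm (?l (s n) \<mu> u) \<le> b" for n using l[OF sT \<mu>] by (intro AE_I2) simp
    qed (use lm \<tau> \<mu> sT in auto)
    have "(\<lambda>n. deviation (?l (s n) \<mu>) v) \<longlonglongrightarrow> deviation (?l \<tau> \<mu>) v"
      unfolding deviation_def using component_space[OF vW]
      by (intro tendsto_sum tendsto_diff lim_int lim) auto
    moreover have "deviation (?l (s n) \<mu>) v \<le> r + t" for n
      using A(3) v s(1)[of n] \<mu> by auto
    ultimately show ?thesis by (intro LIMSEQ_le_const2) blast+
  qed
  have "(\<integral>u. ?l \<tau> \<mu> u \<partial>D) \<le> (1 / N) * (\<Sum>i<N. ?l \<tau> \<mu> (v i))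
      + 4 * rademacher_complexity N D F + 4 * b / sqrt N + b * sqrt (ln (1 / \<delta>) / (2 * N))"
    if "v \<in> A" "\<tau> \<in> T" "\<mu> \<in> F" for v \<tau> \<mu>
  proof -
    have "N * (\<integral>u. ?l \<tau> \<mu> u \<partial>D) \<le> (\<Sum>i<N. ?l \<tau> \<mu> (v i)) + (r + t)"
      using dT[OF that] by (simp add: deviation_def sum_subtractf)
    then have "(\<integral>u. ?l \<tau> \<mu> u \<partial>D) \<le> ((\<Sum>i<N. ?l \<tau> \<mu> (v i)) + (r + t)) / N"
      using N_pos by (simp add: pos_le_divide_eq mult.commute)
    then have "(\<integral>u. ?l \<tau> \<mu> u \<partial>D) \<le> (1 / N) * (\<Sum>i<N. ?l \<tau> \<mu> (v i)) + (r / N + t / N)"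
      by (simp add: add_divide_distrib)
    moreover have "r / N = 4 * rademacher_complexity N D F + 4 * b / sqrt N"
    proof -
      have "4 * b * sqrt N / N = 4 * b * (sqrt N / N)" by simp
      also have "\<dots> = 4 * b / sqrt N" unfolding sqrt_divide_self_eq[OF of_nat_0_le_iff] by (rule divide_inverse[symmetric])
      finally show ?thesis using N_pos by (simp add: r_def add_divide_distrib)
    qed
    moreover have "t / N = b * sqrt (ln (1 / \<delta>) / (2 * N))"
    proof -
      have "sqrt (N * ln (1 / \<delta>) / 2) = sqrt ((real N)\<^sup>2 * (ln (1 / \<delta>) / (2 * N)))"
        using N_pos by (simp add: power2_eq_square)
      also have "\<dots> = N * sqrt (ln (1 / \<delta>) / (2 * N))" by (simp only: real_sqrt_mult real_sqrt_abs abs_of_nat)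
      finally show ?thesis using N_pos by (simp add: t_def)
    qed
    ultimately show ?thesis by simp
  qed
  then show ?thesis using A(1,2) by blast
qed

theorem theorem2:
  fixes M :: "'w measure" and MX :: "'x measure" and MZ :: "'z measure"
    and X :: "'w \<Rightarrow> 'x" and Y :: "'w \<Rightarrow> real" and Z :: "'w \<Rightarrow> 'z"
    and N :: nat and x :: "nat \<Rightarrow> 'w \<Rightarrow> 'x" and y :: "nat \<Rightarrow> 'w \<Rightarrow> real" and z :: "nat \<Rightarrow> 'w \<Rightarrow> 'z"
    and K :: "'x \<times> 'z \<Rightarrow> real measure"
    and F :: "('x \<times> 'z \<Rightarrow> real) set" and T :: "real set" and b \<delta> :: real
    and L :: "real \<Rightarrow> real \<Rightarrow> real" and s\<^sub>0 :: "'w \<Rightarrow> 'x \<times> real \<times> 'z"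
    and \<tau>\<^sub>h :: "'w \<Rightarrow> real" and \<mu>\<^sub>h :: "'w \<Rightarrow> real \<Rightarrow> 'x \<times> 'z \<Rightarrow> real"
  defines "D \<equiv> distr M (MX \<Otimes>\<^sub>M MZ) (\<lambda>\<omega>. (X \<omega>, Z \<omega>))"
  assumes "prob_space M"
    and "X \<in> measurable M MX" and "Y \<in> borel_measurable M" and "Z \<in> measurable M MZ"
    and "N > 0"
    and indep: "prob_space.indep_vars M (\<lambda>_. MX \<Otimes>\<^sub>M borel \<Otimes>\<^sub>M MZ)
                  (\<lambda>i \<omega>. (x i \<omega>, y i \<omega>, z i \<omega>)) {..<N}"
    and ident: "\<And>i. i < N \<Longrightarrow>
                  distr M (MX \<Otimes>\<^sub>M borel \<Otimes>\<^sub>M MZ) (\<lambda>\<omega>. (x i \<omega>, y i \<omega>, z i \<omega>)) =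
                  distr M (MX \<Otimes>\<^sub>M borel \<Otimes>\<^sub>M MZ) (\<lambda>\<omega>. (X \<omega>, Y \<omega>, Z \<omega>))"
    and "regular_cond_distr M (MX \<Otimes>\<^sub>M MZ) (\<lambda>\<omega>. (X \<omega>, Z \<omega>)) Y K"
    and "T \<subseteq> {0..1}"
    and quantile_ex: "\<And>\<tau> v. \<tau> \<in> T \<Longrightarrow> v \<in> space (MX \<Otimes>\<^sub>M MZ) \<Longrightarrow> \<exists>m. is_cond_quantile K \<tau> v m"
    and "F \<subseteq> borel_measurable (MX \<Otimes>\<^sub>M MZ)"
    and F_range: "\<And>\<mu> v. \<mu> \<in> F \<Longrightarrow> v \<in> space (MX \<Otimes>\<^sub>M MZ) \<Longrightarrow> \<mu> v \<in> {0..b}"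
    and "integrable (rademacher_space N D) (rademacher_sup N F)"
    and loss_bound: "\<And>\<tau> \<mu> v. \<tau> \<in> T \<Longrightarrow> \<mu> \<in> F \<Longrightarrow> v \<in> space (MX \<Otimes>\<^sub>M MZ) \<Longrightarrow>
                       pinball_loss \<tau> (cond_quantile K \<tau> v - \<mu> v) \<le> b"
    and solution: "\<And>\<omega>. \<omega> \<in> space M \<Longrightarrow>
                     bilevel_solution L T F N (\<lambda>i. x i \<omega>) (\<lambda>i. y i \<omega>) (\<lambda>i. z i \<omega>) (s\<^sub>0 \<omega>)
                       (\<tau>\<^sub>h \<omega>) (\<mu>\<^sub>h \<omega>)"
    and "\<delta> > 0"
  shows "\<exists>A\<in>sets M. measure M A \<ge> 1 - \<delta> \<and>
           (\<forall>\<omega>\<in>A.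
              (\<integral>v. pinball_loss (\<tau>\<^sub>h \<omega>) (cond_quantile K (\<tau>\<^sub>h \<omega>) v - \<mu>\<^sub>h \<omega> (\<tau>\<^sub>h \<omega>) v) \<partial>D)
              \<le> (1 / real N) * (\<Sum>i<N. pinball_loss (\<tau>\<^sub>h \<omega>)
                   (cond_quantile K (\<tau>\<^sub>h \<omega>) (x i \<omega>, z i \<omega>) - \<mu>\<^sub>h \<omega> (\<tau>\<^sub>h \<omega>) (x i \<omega>, z i \<omega>)))
                + 4 * rademacher_complexity N D F + 4 * b / sqrt (real N)
                + b * sqrt (ln (1 / \<delta>) / (2 * real N)))"
proof (cases "\<delta> < 1")
  case False
  then show ?thesis by (intro bexI[of _ "{}"]) auto
next
  case True
  let ?S = "MX \<Otimes>\<^sub>M MZ" and ?S3 = "MX \<Otimes>\<^sub>M borel \<Otimes>\<^sub>M MZ"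
  interpret M: prob_space M by fact
  have X: "X \<in> measurable M MX" and Y: "Y \<in> borel_measurable M" and Z: "Z \<in> measurable M MZ" by fact+
  have N: "N > 0" by fact
  have K: "K \<in> measurable ?S (prob_algebra borel)"
    using \<open>regular_cond_distr M ?S (\<lambda>\<omega>. (X \<omega>, Z \<omega>)) Y K\<close> by (simp add: regular_cond_distr_def)
  have Kv: "prob_space (K v)" "sets (K v) = sets borel" if "v \<in> space ?S" for v
    using measurable_space[OF K that] by (auto simp: space_prob_algebra)
  have XZ: "(\<lambda>\<omega>. (X \<omega>, Z \<omega>)) \<in> measurable M ?S" using X Z by measurable
  have spD: "space D = space ?S" and setsD: "sets D = sets ?S" by (simp_all add: D_def)
  have bmD: "borel_measurable D = borel_measurable ?S" by (rule measurable_cong_sets) (simp_all add: setsD)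
  interpret D: prob_space D unfolding D_def using XZ by (rule M.prob_space_distr)
  obtain \<omega>\<^sub>0 where \<omega>\<^sub>0: "\<omega>\<^sub>0 \<in> space M" using M.not_empty by blast
  have sol: "\<tau>\<^sub>h \<omega> \<in> T" "\<mu>\<^sub>h \<omega> (\<tau>\<^sub>h \<omega>) \<in> F" if "\<omega> \<in> space M" for \<omega>
    using solution[OF that] by (auto simp: bilevel_solution_def is_arg_min_def split: prod.splits)
  have T_ne: "T \<noteq> {}" and F_ne: "F \<noteq> {}" using sol[OF \<omega>\<^sub>0] by auto
  obtain \<mu>\<^sub>0 v\<^sub>0 where "\<mu>\<^sub>0 \<in> F" "v\<^sub>0 \<in> space ?S" using F_ne D.not_empty spD by auto
  from F_range[OF this] have b: "0 \<le> b" by simp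
  interpret R: rademacher_class D N F b
  proof unfold_locales
    show "\<mu> \<in> borel_measurable D" if "\<mu> \<in> F" for \<mu>
      unfolding bmD using \<open>F \<subseteq> borel_measurable ?S\<close> that by blast
    show "\<mu> u \<in> {0..b}" if "\<mu> \<in> F" "u \<in> space D" for \<mu> u
      using F_range that unfolding spD by blast
  qed fact+
  have qle: "cond_quantile K \<tau> v \<le> m \<longleftrightarrow> \<tau> \<le> measure (K v) {..m}" if "\<tau> \<in> T" "v \<in> space ?S" for \<tau> v m
    by (rule cond_quantile_le_iff[OF Kv[OF that(2)] quantile_ex[OF that]])
  have qm: "cond_quantile K \<tau> \<in> borel_measurable D" if "\<tau> \<in> T" for \<tau>
    unfolding bmD borel_measurable_iff_le
  proof
    fix m
    have "(\<lambda>v. measure (K v) {..m}) \<in> borel_measurable ?S"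
      using K by (rule measurable_compose) simp
    then have "{v \<in> space ?S. \<tau> \<le> measure (K v) {..m}} \<in> sets ?S" by measurable
    moreover have "{v \<in> space ?S. cond_quantile K \<tau> v \<le> m} = {v \<in> space ?S. \<tau> \<le> measure (K v) {..m}}"
      using qle[OF that] by blast
    ultimately show "{v \<in> space ?S. cond_quantile K \<tau> v \<le> m} \<in> sets ?S" by simp
  qed
  show ?thesis
  \<comment> \<open>McDiarmid's inequality is applied with difference constant \<open>b\<close>,
    which must be positive. For \<open>b = 0\<close> all losses on the space vanish.\<close>
  proof (cases "b = 0")
    case True
    have zero: "pinball_loss \<tau> (cond_quantile K \<tau> v - \<mu> v) = 0" if "\<tau> \<in> T" "\<mu> \<in> F" "v \<in> space ?S" for \<tau> \<mu> v
      using loss_bound[OF that] pinball_loss_nonneg[of \<tau>] \<open>T \<subseteq> {0..1}\<close> that(1) True by (auto intro!: antisym)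
    show ?thesis
    proof (intro bexI[of _ "space M"] conjI ballI)
      fix \<omega> assume \<omega>: "\<omega> \<in> space M"
      have "(\<integral>v. pinball_loss (\<tau>\<^sub>h \<omega>) (cond_quantile K (\<tau>\<^sub>h \<omega>) v - \<mu>\<^sub>h \<omega> (\<tau>\<^sub>h \<omega>) v) \<partial>D) = (\<integral>v. 0 \<partial>D)"
        using zero[OF sol[OF \<omega>]] by (intro Bochner_Integration.integral_cong) (auto simp: spD)
      moreover have "0 \<le> (\<Sum>i<N. pinball_loss (\<tau>\<^sub>h \<omega>)
          (cond_quantile K (\<tau>\<^sub>h \<omega>) (x i \<omega>, z i \<omega>) - \<mu>\<^sub>h \<omega> (\<tau>\<^sub>h \<omega>) (x i \<omega>, z i \<omega>)))"
        using sol(1)[OF \<omega>] \<open>T \<subseteq> {0..1}\<close> by (intro sum_nonneg pinball_loss_nonneg) auto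
      ultimately show "(\<integral>v. pinball_loss (\<tau>\<^sub>h \<omega>) (cond_quantile K (\<tau>\<^sub>h \<omega>) v - \<mu>\<^sub>h \<omega> (\<tau>\<^sub>h \<omega>) v) \<partial>D)
              \<le> (1 / real N) * (\<Sum>i<N. pinball_loss (\<tau>\<^sub>h \<omega>)
                   (cond_quantile K (\<tau>\<^sub>h \<omega>) (x i \<omega>, z i \<omega>) - \<mu>\<^sub>h \<omega> (\<tau>\<^sub>h \<omega>) (x i \<omega>, z i \<omega>)))
                + 4 * rademacher_complexity N D F + 4 * b / sqrt (real N)
                + b * sqrt (ln (1 / \<delta>) / (2 * real N))"
        using R.rademacher_complexity_nonneg True by simp
    qed (use \<open>\<delta> > 0\<close> M.prob_space in auto)
  next
    case False
    have "\<exists>A\<in>sets R.W. measure R.W A \<ge> 1 - \<delta> \<and> (\<forall>v\<in>A. \<forall>\<tau>\<in>T. \<forall>\<mu>\<in>F.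
        (\<integral>u. pinball_loss \<tau> (cond_quantile K \<tau> u - \<mu> u) \<partial>D) \<le> (1 / N) * (\<Sum>i<N. pinball_loss \<tau> (cond_quantile K \<tau> (v i) - \<mu> (v i)))
          + 4 * rademacher_complexity N D F + 4 * b / sqrt N + b * sqrt (ln (1 / \<delta>) / (2 * N)))"
    proof (rule R.uniform_quantile_bound[OF T_ne \<open>T \<subseteq> {0..1}\<close> \<open>\<delta> > 0\<close> \<open>\<delta> < 1\<close> _ qm])
      show "0 < b" using b False by simp
      show "cond_quantile K \<tau> u \<le> cond_quantile K \<tau>' u" if "\<tau> \<in> T" "\<tau>' \<in> T" "\<tau> \<le> \<tau>'" "u \<in> space D" for \<tau> \<tau>' u
        using qle[OF that(1), of u "cond_quantile K \<tau>' u"] qle[OF that(2), of u "cond_quantile K \<tau>' u"] that by (simp add: spD)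
      show "(\<lambda>n. cond_quantile K (s n) u) \<longlonglongrightarrow> cond_quantile K \<tau> u"
        if "\<tau> \<in> T" "\<And>n. s n \<in> T" "\<And>n. s n \<le> \<tau>" "s \<longlonglongrightarrow> \<tau>" "u \<in> space D" for \<tau> s u
      proof -
        have u: "u \<in> space ?S" using that(5) by (simp add: spD)
        show ?thesis
          by (rule cond_quantile_left_continuous[where T = T and K = K and v = u, OF Kv[OF u]]) (use that u quantile_ex in auto)
      qed
      show "pinball_loss \<tau> (cond_quantile K \<tau> u - \<mu> u) \<le> b" if "\<tau> \<in> T" "\<mu> \<in> F" "u \<in> space D" for \<tau> \<mu> u
        using loss_bound[OF that(1,2)] that(3) by (simp add: spD)
    qed
    then obtain A where A: "A \<in> sets R.W" "measure R.W A \<ge> 1 - \<delta>" "\<And>v \<tau> \<mu>. v \<in> A \<Longrightarrow> \<tau> \<in> T \<Longrightarrow> \<mu> \<in> F \<Longrightarrow>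
        (\<integral>u. pinball_loss \<tau> (cond_quantile K \<tau> u - \<mu> u) \<partial>D) \<le> (1 / N) * (\<Sum>i<N. pinball_loss \<tau> (cond_quantile K \<tau> (v i) - \<mu> (v i)))
          + 4 * rademacher_complexity N D F + 4 * b / sqrt N + b * sqrt (ln (1 / \<delta>) / (2 * N))"
      by blast
    define g where "g \<omega> = (\<lambda>i\<in>{..<N}. (x i \<omega>, z i \<omega>))" for \<omega>
    have p: "(\<lambda>s. (fst s, snd (snd s))) \<in> measurable ?S3 ?S" by measurable
    have V: "(\<lambda>\<omega>. (X \<omega>, Y \<omega>, Z \<omega>)) \<in> measurable M ?S3" using X Y Z by measurable
    \<comment> \<open>Projecting away the outcomes \<open>y i\<close> keeps independence and the
      common law, so the sampled inputs have the product law built on \<open>D\<close>.\<close>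
    note G = M.distr_iid_projection[OF N p V indep ident, folded D_def, simplified, folded g_def]
    have setsW: "sets R.W = sets (PiM {..<N} (\<lambda>_. ?S))" by (intro sets_PiM_cong) (simp_all add: setsD)
    have g: "g \<in> measurable M (PiM {..<N} (\<lambda>_. ?S))" and dg: "distr M (PiM {..<N} (\<lambda>_. ?S)) g = R.W"
      using G by (simp_all add: g_def[abs_def] D_def)
    have A': "A \<in> sets (PiM {..<N} (\<lambda>_. ?S))" using A(1) setsW by simp
    show ?thesis
    proof (intro bexI[of _ "g -` A \<inter> space M"] conjI ballI)
      show "g -` A \<inter> space M \<in> sets M" using g A' by (rule measurable_sets)
      show "1 - \<delta> \<le> measure M (g -` A \<inter> space M)"
        using A(2) measure_distr[OF g A'] by (simp add: dg)
      fix \<omega> assume "\<omega> \<in> g -` A \<inter> space M"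
      then have \<omega>: "\<omega> \<in> space M" "g \<omega> \<in> A" by auto
      \<comment> \<open>The event serves all levels and hypotheses at once, so the data-dependent
        solution may be inserted separately for each outcome, however it varies with the
        data.\<close>
      from A(3)[OF \<omega>(2) sol[OF \<omega>(1)]]
      show "(\<integral>v. pinball_loss (\<tau>\<^sub>h \<omega>) (cond_quantile K (\<tau>\<^sub>h \<omega>) v - \<mu>\<^sub>h \<omega> (\<tau>\<^sub>h \<omega>) v) \<partial>D)
              \<le> (1 / real N) * (\<Sum>i<N. pinball_loss (\<tau>\<^sub>h \<omega>)
                   (cond_quantile K (\<tau>\<^sub>h \<omega>) (x i \<omega>, z i \<omega>) - \<mu>\<^sub>h \<omega> (\<tau>\<^sub>h \<omega>) (x i \<omega>, z i \<omega>)))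
                + 4 * rademacher_complexity N D F + 4 * b / sqrt (real N)
                + b * sqrt (ln (1 / \<delta>) / (2 * real N))"
        by (simp add: g_def)
    qed
  qed
qed

end
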